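(* The algebra of feedback differential invariants in a neighborhood of a regular orbit is generated by the differential invariant $J$ of the $2$-nd order, the differential invariant $K$ of the $3$-rd order, and all their invariant derivatives (that is, all functions obtained from $J$ and $K$ by iterated application of the invariant derivations $\nabla_1,\nabla_2,\nabla_3$).
   Context: Consider control systems $\dot x=F(x,u,\dot u)$ with scalar state $x$ and scalar control $u$; write $u_1$ for $\dot u$. A feedback transformation is a (local) diffeomorphism $(x,u,t)\mapsto (X(x),U(x,u),t)$; its infinitesimal version is a feedback vector field $X_{a,b}=a(x)\partial_x+b(x,u)\partial_u$ with $a,b$ arbitrary smooth functions. Let $\kappa:\mathbb{R}^4\to\mathbb{R}^3$, $\kappa(x,u,u_1,f)=(x,u,u_1)$, be the trivial line bundle whose sections are the functions $f=F(x,u,u_1)$, let $J^k\kappa$ be its space of $k$-jets and $J^\infty\kappa$ its space of infinite jets, with the symbols $f_\sigma$ for partial derivatives of $f$ with respect to $x,u,u_1$, and let $\frac{d}{dx},\frac{d}{du},\frac{d}{du_1}$ be the total derivatives. Feedback vector fields act on $J^0\kappa$ by $$\widehat{X_{a,b}}=a\,\partial_x+b\,\partial_u+(u_1b_u+f\,b_x)\,\partial_{u_1}+a_x f\,\partial_f,$$ and $\widehat{X_{a,b}}^{(k)}$ denotes the prolongation to $J^k\kappa$. A feedback differential invariant of order $\le k$ is a smooth function $I$ on (an open subset of) $J^k\kappa$ with $\widehat{X_{a,b}}^{(k)}(I)=0$ for all $X_{a,b}$. Feedback orbits in $J^k\kappa$ are the integral manifolds of the distribution generated by the fields $\widehat{X_{a,b}}^{(k)}$.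 A point of $J^k\kappa$, $k\ge2$, is regular if $f\neq0$, $f_{u_1}\neq 0$, $f_{u_1u_1}\neq 0$ there; regular orbits are the orbits of regular points (considered where $u_1f_{u_1}-f\neq0$, so that $J$ is defined). A feedback invariant derivation is a combination of total derivatives, with coefficients functions on $J^\infty\kappa$, which commutes with all prolonged fields $\widehat{X_{a,b}}$. The following are feedback invariant derivations: $$\nabla_1=\frac{u_1f_{u_1}-f}{f_{u_1}}\frac{d}{du}+\frac{f-u_1f_{u_1}}{f_{u_1}^2}f_u\frac{d}{du_1},\qquad \nabla_2=\frac{f}{f_{u_1}}\frac{d}{du_1},$$ $$\nabla_3=f\frac{d}{dx}+\frac{f}{f_{u_1}}\frac{d}{du}+\left(\frac{f_xf_{u_1}+f_u-u_1f_{uu_1}-f f_{xu_1}}{f_{u_1u_1}}+\frac{u_1f_{u_1}-f}{f_{u_1}^2}f_u\right)\frac{d}{du_1}.$$ The invariant $J$ is $$J=\frac{f^{2}\,f_{u_{1}u_{1}}}{\left(u_{1}f_{u_{1}}-f\right)f_{u_{1}}^{2}},$$ and $K$ is the third-order invariant defined by the commutation relation $[\nabla_3,\nabla_1]=K\,\nabla_2$. "Generated" is understood in the smooth sense: locally every feedback differential invariant is a smooth function of finitely many of the functions $J$, $K$ and their iterated invariant derivatives. *)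

theory Defs
  imports "HOL-Analysis.Analysis" "HOL-Library.Groups_Big_Fun"
begin

definition partial :: "'i \<Rightarrow> (('i \<Rightarrow> real) \<Rightarrow> real) \<Rightarrow> ('i \<Rightarrow> real) \<Rightarrow> real" where
  "partial c g p = deriv (\<lambda>t. g (p(c := t))) (p c)"

definition depends_only :: "'i set \<Rightarrow> ('i \<Rightarrow> real) set \<Rightarrow> (('i \<Rightarrow> real) \<Rightarrow> real) \<Rightarrow> bool" where
  "depends_only C U g \<longleftrightarrow> (\<forall>p\<in>U. \<forall>q\<in>U. (\<forall>c\<in>C. p c = q c) \<longrightarrow> g p = g q)"

text \<open>
  All iterated partial derivatives exist and are continuous. The topology on
  \<open>'i \<Rightarrow> real\<close> is the product topology. The predicate is only used together with
  \<open>depends_only\<close> for a finite set of coordinates, where it is the usual notion of a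
  \<open>C\<^sup>\<infinity>\<close> function on an open subset of a finite-dimensional space (the projection onto
  finitely many coordinates being an open map).
\<close>

definition smooth_on :: "('i \<Rightarrow> real) set \<Rightarrow> (('i \<Rightarrow> real) \<Rightarrow> real) \<Rightarrow> bool" where
  "smooth_on U g \<longleftrightarrow>
     (\<forall>cs. continuous_on U (foldr partial cs g) \<and>
        (\<forall>p\<in>U. \<forall>c. (\<lambda>t. foldr partial cs g (p(c := t))) differentiable (at (p c))))"

datatype dir = Dx | Du | Dv

text \<open>
  \<open>Dv\<close> is the direction of the third base variable \<open>u\<^sub>1\<close>. The coordinate
  \<open>Fib (i, j, l)\<close> is the partial derivative of \<open>f\<close> of order \<open>i\<close> in \<open>x\<close>, \<open>j\<close> in \<open>u\<close> and
  \<open>l\<close> in \<open>u\<^sub>1\<close>. An element of type \<open>jet\<close> is a point of the space of infinite jets. The space of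
  \<open>k\<close>-jets is its quotient forgetting all coordinates of order above \<open>k\<close>: subsets of it are
  represented by their preimages, functions on it by functions depending only
  on \<open>jcoords k\<close>.
\<close>

datatype coord = Base dir | Fib "nat \<times> nat \<times> nat"

type_synonym jet = "coord \<Rightarrow> real"

fun coord_order :: "coord \<Rightarrow> nat" where
  "coord_order (Base d) = 0"
| "coord_order (Fib (i, j, l)) = i + j + l"

definition jcoords :: "nat \<Rightarrow> coord set" where
  "jcoords k = {c. coord_order c \<le> k}"

definition jet_open :: "nat \<Rightarrow> jet set \<Rightarrow> bool" where
  "jet_open k U \<longleftrightarrow>
     open U \<and> (\<forall>p\<in>U. \<forall>q. (\<forall>c\<in>jcoords k. p c = q c) \<longrightarrow> q \<in> U)"

definition smooth_jet_fun :: "nat \<Rightarrow> jet set \<Rightarrow> (jet \<Rightarrow> real) \<Rightarrow> bool" where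
  "smooth_jet_fun k U g \<longleftrightarrow> jet_open k U \<and> smooth_on U g \<and> depends_only (jcoords k) U g"

definition has_jet_order :: "nat \<Rightarrow> jet set \<Rightarrow> (jet \<Rightarrow> real) \<Rightarrow> bool" where
  "has_jet_order n U g \<longleftrightarrow>
     depends_only (jcoords n) U g \<and> (\<forall>m<n. \<not> depends_only (jcoords m) U g)"

fun bump :: "dir \<Rightarrow> nat \<times> nat \<times> nat \<Rightarrow> nat \<times> nat \<times> nat" where
  "bump Dx (i, j, l) = (Suc i, j, l)"
| "bump Du (i, j, l) = (i, Suc j, l)"
| "bump Dv (i, j, l) = (i, j, Suc l)"

text \<open>
  The sum has finite support whenever \<open>g\<close> locally depends on finitely many coordinates.
\<close>

definition total_deriv :: "dir \<Rightarrow> (jet \<Rightarrow> real) \<Rightarrow> jet \<Rightarrow> real" where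
  "total_deriv d g p =
     partial (Base d) g p + Sum_any (\<lambda>\<sigma>. p (Fib (bump d \<sigma>)) * partial (Fib \<sigma>) g p)"

fun total_derivs :: "nat \<times> nat \<times> nat \<Rightarrow> (jet \<Rightarrow> real) \<Rightarrow> jet \<Rightarrow> real" where
  "total_derivs (i, j, l) g =
     (total_deriv Dx ^^ i) ((total_deriv Du ^^ j) ((total_deriv Dv ^^ l) g))"

text \<open>
  The prolongation of the field with base components \<open>\<xi> d\<close> and vertical component \<open>\<phi>\<close>, given by
  its coefficients at all jet coordinates. With the characteristic
  \<open>Q = \<phi> - \<Sum>\<^sub>d \<xi>\<^sub>d f\<^sub>d\<close>, the coefficient at \<open>f\<^sub>\<sigma>\<close> is
  \<open>D\<^sub>\<sigma> Q + \<Sum>\<^sub>d \<xi>\<^sub>d f\<^bsub>\<sigma>+d\<^esub>\<close>. The prolongation to \<open>k\<close>-jets consists of the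
  coefficients at \<open>jcoords k\<close>.
\<close>

definition characteristic :: "(dir \<Rightarrow> jet \<Rightarrow> real) \<Rightarrow> (jet \<Rightarrow> real) \<Rightarrow> jet \<Rightarrow> real" where
  "characteristic \<xi> \<phi> p = \<phi> p - (\<Sum>d\<in>{Dx, Du, Dv}. \<xi> d p * p (Fib (bump d (0, 0, 0))))"

fun prolong :: "(dir \<Rightarrow> jet \<Rightarrow> real) \<Rightarrow> (jet \<Rightarrow> real) \<Rightarrow> coord \<Rightarrow> jet \<Rightarrow> real" where
  "prolong \<xi> \<phi> (Base d) p = \<xi> d p"
| "prolong \<xi> \<phi> (Fib \<sigma>) p =
     total_derivs \<sigma> (characteristic \<xi> \<phi>) p
     + (\<Sum>d\<in>{Dx, Du, Dv}. \<xi> d p * p (Fib (bump d \<sigma>)))"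

definition lift_a :: "(real \<Rightarrow> real) \<Rightarrow> jet \<Rightarrow> real" where
  "lift_a a p = a (p (Base Dx))"

definition lift_b :: "(real \<Rightarrow> real \<Rightarrow> real) \<Rightarrow> jet \<Rightarrow> real" where
  "lift_b b p = b (p (Base Dx)) (p (Base Du))"

fun feedback_base :: "(real \<Rightarrow> real) \<Rightarrow> (real \<Rightarrow> real \<Rightarrow> real) \<Rightarrow> dir \<Rightarrow> jet \<Rightarrow> real" where
  "feedback_base a b Dx p = lift_a a p"
| "feedback_base a b Du p = lift_b b p"
| "feedback_base a b Dv p =
     p (Base Dv) * partial (Base Du) (lift_b b) p
     + p (Fib (0, 0, 0)) * partial (Base Dx) (lift_b b) p"

definition feedback_vertical :: "(real \<Rightarrow> real) \<Rightarrow> jet \<Rightarrow> real" where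
  "feedback_vertical a p = partial (Base Dx) (lift_a a) p * p (Fib (0, 0, 0))"

definition feedback_field ::
    "(real \<Rightarrow> real) \<Rightarrow> (real \<Rightarrow> real \<Rightarrow> real) \<Rightarrow> coord \<Rightarrow> jet \<Rightarrow> real" where
  "feedback_field a b = prolong (feedback_base a b) (feedback_vertical a)"

definition smooth_feedback :: "(real \<Rightarrow> real) \<Rightarrow> (real \<Rightarrow> real \<Rightarrow> real) \<Rightarrow> bool" where
  "smooth_feedback a b \<longleftrightarrow> smooth_on UNIV (lift_a a) \<and> smooth_on UNIV (lift_b b)"

definition feedback_invariant :: "nat \<Rightarrow> jet set \<Rightarrow> (jet \<Rightarrow> real) \<Rightarrow> bool" where
  "feedback_invariant k U g \<longleftrightarrow>
     smooth_jet_fun k U g \<and>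
     (\<forall>a b. smooth_feedback a b \<longrightarrow>
        (\<forall>p\<in>U. (\<Sum>c\<in>jcoords k. feedback_field a b c p * partial c g p) = 0))"

text \<open>
  The orbit of \<open>p\<close> in the space of \<open>k\<close>-jets is the maximal integral manifold through \<open>p\<close> of
  the distribution spanned by the prolonged feedback fields. As a set it consists of the points
  reached from \<open>p\<close> along finitely many integral curves of these fields. Rescaling the
  field allows the unit time interval in each step. Coordinates of order above \<open>k\<close> are
  unconstrained, so that orbits are preimages of subsets of the space of \<open>k\<close>-jets.
\<close>

definition feedback_step :: "nat \<Rightarrow> jet \<Rightarrow> jet \<Rightarrow> bool" where
  "feedback_step k p q \<longleftrightarrow>
     (\<exists>a b \<gamma>. smooth_feedback a b \<and> \<gamma> 0 = p \<and> \<gamma> 1 = q \<and>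
        (\<forall>t\<in>{0..1}. \<forall>c\<in>jcoords k.
           ((\<lambda>s. \<gamma> s c) has_real_derivative feedback_field a b c (\<gamma> t)) (at t within {0..1})))"

definition feedback_orbit :: "nat \<Rightarrow> jet \<Rightarrow> jet set" where
  "feedback_orbit k p = {q. (feedback_step k)\<^sup>*\<^sup>* p q}"

definition regular :: "jet \<Rightarrow> bool" where
  "regular p \<longleftrightarrow> p (Fib (0, 0, 0)) \<noteq> 0 \<and> p (Fib (0, 0, 1)) \<noteq> 0 \<and> p (Fib (0, 0, 2)) \<noteq> 0"

text \<open>\<open>u\<^sub>1 f\<^bsub>u\<^sub>1\<^esub> - f\<close>, the factor in the denominator of \<open>J\<close>\<close>

definition J_denom :: "jet \<Rightarrow> real" where
  "J_denom p = p (Base Dv) * p (Fib (0, 0, 1)) - p (Fib (0, 0, 0))"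

definition regular_orbit :: "nat \<Rightarrow> jet set \<Rightarrow> bool" where
  "regular_orbit k S \<longleftrightarrow>
     k \<ge> 2 \<and> (\<exists>p. regular p \<and> J_denom p \<noteq> 0 \<and> S = feedback_orbit k p)"

datatype der = Nabla1 | Nabla2 | Nabla3

fun nabla :: "der \<Rightarrow> (jet \<Rightarrow> real) \<Rightarrow> jet \<Rightarrow> real" where
  "nabla Nabla1 g p =
     (let v = p (Base Dv); f = p (Fib (0, 0, 0)); fu = p (Fib (0, 1, 0)); fv = p (Fib (0, 0, 1))
      in (v * fv - f) / fv * total_deriv Du g p
         + (f - v * fv) / fv\<^sup>2 * fu * total_deriv Dv g p)"
| "nabla Nabla2 g p =
     (let f = p (Fib (0, 0, 0)); fv = p (Fib (0, 0, 1))
      in f / fv * total_deriv Dv g p)"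
| "nabla Nabla3 g p =
     (let v = p (Base Dv); f = p (Fib (0, 0, 0));
          fx = p (Fib (1, 0, 0)); fu = p (Fib (0, 1, 0)); fv = p (Fib (0, 0, 1));
          fxv = p (Fib (1, 0, 1)); fuv = p (Fib (0, 1, 1)); fvv = p (Fib (0, 0, 2))
      in f * total_deriv Dx g p + f / fv * total_deriv Du g p
         + ((fx * fv + fu - v * fuv - f * fxv) / fvv + (v * fv - f) / fv\<^sup>2 * fu)
           * total_deriv Dv g p)"

definition inv_J :: "jet \<Rightarrow> real" where
  "inv_J p =
     (let f = p (Fib (0, 0, 0)); fv = p (Fib (0, 0, 1)); fvv = p (Fib (0, 0, 2))
      in f\<^sup>2 * fvv / (J_denom p * fv\<^sup>2))"

text \<open>The coefficient \<open>K\<close> in the commutation relation \<open>[\<nabla>\<^sub>3, \<nabla>\<^sub>1] = K \<nabla>\<^sub>2\<close>\<close>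

definition inv_K :: "jet \<Rightarrow> real" where
  "inv_K p = (THE \<kappa>. \<forall>k U g. p \<in> U \<and> smooth_jet_fun k U g \<longrightarrow>
     nabla Nabla3 (nabla Nabla1 g) p - nabla Nabla1 (nabla Nabla3 g) p = \<kappa> * nabla Nabla2 g p)"

datatype generator = GenJ "der list" | GenK "der list"

fun gen_fun :: "generator \<Rightarrow> jet \<Rightarrow> real" where
  "gen_fun (GenJ w) = foldr nabla w inv_J"
| "gen_fun (GenK w) = foldr nabla w inv_K"

text \<open>
  \<open>G\<close> is a function of the values of finitely many generators, the coordinates on
  \<open>generator \<Rightarrow> real\<close> being indexed by the generators.
\<close>

definition locally_generated :: "jet set \<Rightarrow> (jet \<Rightarrow> real) \<Rightarrow> jet \<Rightarrow> bool" where
  "locally_generated U g p \<longleftrightarrow>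
     (\<exists>W C V G. open W \<and> p \<in> W \<and> W \<subseteq> U \<and> finite C \<and>
        open V \<and> smooth_on V G \<and> depends_only C V G \<and>
        (\<forall>q\<in>W. (\<lambda>s. gen_fun s q) \<in> V \<and> g q = G (\<lambda>s. gen_fun s q)))"

definition invariants_generated :: "jet set \<Rightarrow> bool" where
  "invariants_generated N \<longleftrightarrow>
     (\<forall>s. \<exists>m. feedback_invariant m N (gen_fun s)) \<and>
     (\<forall>m U g. U \<subseteq> N \<and> feedback_invariant m U g \<longrightarrow> (\<forall>p\<in>U. locally_generated U g p))"

end

theory Submission
  imports Defs
begin

text \<open>
  Order the jet coordinates by total order and then lexicographically in the orders in \<open>x\<close> and
  \<open>u\<close>. In this order \<open>\<nabla>\<^sub>3\<close>, \<open>\<nabla>\<^sub>1\<close>, \<open>\<nabla>\<^sub>2\<close> shift the leading coordinate of a function in the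
  directions \<open>x\<close>, \<open>u\<close>, \<open>u\<^sub>1\<close>; the leading coordinate of \<open>J\<close> is \<open>f\<^bsub>vv\<^esub>\<close>, that of \<open>K\<close> is
  \<open>f\<^bsub>xuv\<^esub>\<close> (with \<open>v = u\<^sub>1\<close>), and each invariant derivative is affine in its leading
  coordinate with a nonvanishing slope. So, from the top down, all
  \<open>f\<^bsub>ijl\<^esub>\<close> with \<open>l \<ge> 2\<close> or \<open>l = 1 \<le> i, j\<close> can be replaced as coordinates by invariants.
  The remaining coordinates are \<open>x\<close>, \<open>u\<close>, \<open>v\<close>, \<open>f\<^bsub>ij0\<^esub>\<close>, \<open>f\<^bsub>i01\<^esub>\<close>, \<open>f\<^bsub>0j1\<^esub>\<close>, and on
  these the feedback fields take arbitrary values at each point, as one sees by testing with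
  monomials. Hence an invariant does not depend on them.
\<close>

section \<open>Smooth functions of finitely many coordinates\<close>

text \<open>Affinity in the leading coordinate replaces an inverse function theorem: the triangular
  system is solved by an explicit formula on the whole domain, and every point of the new domain is
  the image of an old one. This is how a relation at each point of \<open>U\<close> becomes the
  vanishing of partial derivatives of the rewritten function on all of its domain. The remaining
  coordinates match the free data exactly. Sort them by the order N of the derivatives of
  \<open>a\<close> and \<open>b\<close> that enter their feedback components; there are N + 2 of
  them for each N, and also N + 2 derivatives of order N (one of \<open>a\<close>, N + 1 of
  \<open>b\<close>). Each level is thus a square linear system, and its determinant is nonzero
  because f, f_v, f_vv and v f_v - f are. The obstacle throughout is that a jet has infinitely many
  coordinates. A total derivative enlarges the set of coordinates a function depends on, so
  smoothness is always carried together with a finite set of coordinates, and derivatives are taken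
  along coordinate lines only; the chain rule and the symmetry of mixed partials are proved in this
  setting.\<close>

lemma open_fun_contains_box:
  fixes q :: "'i \<Rightarrow> real"
  assumes "open U" "q \<in> U"
  obtains F e where "finite F" "e > 0" "{y. \<forall>c\<in>F. \<bar>y c - q c\<bar> < e} \<subseteq> U"
proof -
  have "openin (product_topology (\<lambda>i. euclidean) UNIV) U"
    using assms(1) by (simp add: open_fun_def)
  from product_topology_open_contains_basis[OF this assms(2)]
  obtain X where X: "q \<in> (\<Pi>\<^sub>E i\<in>UNIV. X i)" "\<And>i. open (X i)" "finite {i. X i \<noteq> UNIV}"
    "(\<Pi>\<^sub>E i\<in>UNIV. X i) \<subseteq> U"
    by auto
  have "\<exists>e>0. ball (q i) e \<subseteq> X i" for i
    using X(1,2) by (metis PiE_UNIV_domain Pi_iff UNIV_I openE)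
  then obtain eps where eps: "\<And>i. eps i > 0" "\<And>i. ball (q i) (eps i) \<subseteq> X i"
    by metis
  define F where "F = {i. X i \<noteq> UNIV}"
  define e where "e = Min (insert 1 (eps ` F))"
  have fF: "finite F" using X(3) by (simp add: F_def)
  have "e > 0" using fF eps(1) by (simp add: e_def)
  moreover have "y \<in> U" if y: "\<forall>c\<in>F. \<bar>y c - q c\<bar> < e" for y
  proof -
    have "y i \<in> X i" for i
    proof (cases "i \<in> F")
      case True
      then have "e \<le> eps i" using fF by (simp add: e_def)
      then have "y i \<in> ball (q i) (eps i)"
        using y True by (force simp: dist_real_def abs_minus_commute)
      then show ?thesis using eps(2) by (rule subsetD[rotated])
    qed (simp add: F_def)
    then show ?thesis using X(4) by auto
  qed
  ultimately show ?thesis using fF that by blast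
qed

lemma open_box:
  fixes q :: "'i \<Rightarrow> real"
  assumes "finite F"
  shows "open {y. \<forall>c\<in>F. \<bar>y c - q c\<bar> < e}"
proof -
  have "{y. \<forall>c\<in>F. \<bar>y c - q c\<bar> < e} = (\<Inter>c\<in>F. {y. \<bar>y c - q c\<bar> < e})"
    by auto
  moreover have "open {y. \<bar>y c - q c\<bar> < e}" for c
    by (intro open_Collect_less continuous_intros continuous_on_product_coordinates)
  ultimately show ?thesis
    using assms by (simp add: open_INT)
qed

lemma eventually_line:
  fixes p :: "'i \<Rightarrow> real"
  assumes "open U" "p(c := s) \<in> U"
  shows "eventually (\<lambda>t. p(c := t) \<in> U) (nhds s)"
proof -
  have "continuous_on UNIV (\<lambda>t. p(c := t))"
  proof (rule continuous_on_coordinatewise_then_product)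
    show "continuous_on UNIV (\<lambda>t. (p(c := t)) i)" for i
      by (cases "i = c") (auto intro: continuous_intros)
  qed
  then have "open ((\<lambda>t. p(c := t)) -` U)"
    using assms(1) by (intro open_vimage)
  then show ?thesis
    using eventually_nhds_in_open[of "(\<lambda>t. p(c := t)) -` U" s] assms(2)
    by simp
qed

lemma has_partial:
  assumes "(\<lambda>t. g (p(c := t))) differentiable (at (p c))"
  shows "((\<lambda>t. g (p(c := t))) has_real_derivative partial c g p) (at (p c))"
  using assms by (simp add: partial_def DERIV_deriv_iff_real_differentiable)

lemma partial_eqI:
  assumes "((\<lambda>t. g (p(c := t))) has_real_derivative D) (at (p c))"
  shows "partial c g p = D"
  using assms by (simp add: partial_def DERIV_imp_deriv)

lemma eventually_line_eq:
  fixes U :: "('i \<Rightarrow> real) set"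
  assumes "open U" "p \<in> U" "\<And>q. q \<in> U \<Longrightarrow> g q = h q"
  shows "eventually (\<lambda>t. g (p(c := t)) = h (p(c := t))) (nhds (p c))"
proof -
  have "eventually (\<lambda>t. p(c := t) \<in> U) (nhds (p c))"
    by (rule eventually_line) (use assms in simp_all)
  then show ?thesis by (rule eventually_mono) (rule assms(3))
qed

lemma partial_cong:
  assumes "open U" "p \<in> U" "\<And>q. q \<in> U \<Longrightarrow> g q = h q"
  shows "partial c g p = partial c h p"
  unfolding partial_def by (rule deriv_cong_ev[OF eventually_line_eq[OF assms]]) auto

lemma depends_only_mono:
  "depends_only C U g \<Longrightarrow> C \<subseteq> C' \<Longrightarrow> U' \<subseteq> U \<Longrightarrow> depends_only C' U' g"
  unfolding depends_only_def by blast

lemma depends_onlyD: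
  "depends_only C U g \<Longrightarrow> p \<in> U \<Longrightarrow> q \<in> U \<Longrightarrow> (\<And>c. c \<in> C \<Longrightarrow> p c = q c) \<Longrightarrow> g p = g q"
  unfolding depends_only_def by blast

lemma partial_zero:
  assumes "open U" "depends_only C U g" "c \<notin> C" "p \<in> U"
  shows "partial c g p = 0"
proof -
  have "eventually (\<lambda>t. g (p(c := t)) = g p) (nhds (p c))"
  proof (rule eventually_mono)
    show "eventually (\<lambda>t. p(c := t) \<in> U) (nhds (p c))"
      by (rule eventually_line) (use assms in simp_all)
    show "g (p(c := t)) = g p" if "p(c := t) \<in> U" for t
      by (rule depends_onlyD[OF assms(2) that assms(4)]) (use assms(3) in auto)
  qed
  then have "partial c g p = deriv (\<lambda>_. g p) (p c)"
    unfolding partial_def by (rule deriv_cong_ev) auto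
  then show ?thesis by simp
qed

lemma depends_only_partial:
  assumes "open U" "depends_only C U g"
  shows "depends_only C U (partial c g)"
  unfolding depends_only_def
proof (intro ballI impI)
  fix p q assume pq: "p \<in> U" "q \<in> U" "\<forall>c\<in>C. p c = q c"
  show "partial c g p = partial c g q"
  proof (cases "c \<in> C")
    case True
    then have e: "p c = q c" using pq by auto
    have "eventually (\<lambda>t. p(c := t) \<in> U) (nhds (p c))"
      by (rule eventually_line) (use assms pq in simp_all)
    moreover have "eventually (\<lambda>t. q(c := t) \<in> U) (nhds (p c))"
      unfolding e by (rule eventually_line) (use assms pq in simp_all)
    ultimately have "eventually (\<lambda>t. g (p(c := t)) = g (q(c := t))) (nhds (p c))"
    proof eventually_elim
      case (elim t)
      show ?case by (rule depends_onlyD[OF assms(2) elim]) (use pq(3) in auto)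
    qed
    then show ?thesis
      unfolding partial_def e by (rule deriv_cong_ev) auto
  qed (use partial_zero[OF assms] pq in auto)
qed

section \<open>Calculus of functions with continuous iterated partial derivatives up to order
  n\<close>

primrec Ck :: "nat \<Rightarrow> ('i \<Rightarrow> real) set \<Rightarrow> (('i \<Rightarrow> real) \<Rightarrow> real) \<Rightarrow> bool" where
  "Ck 0 U g \<longleftrightarrow> continuous_on U g"
| "Ck (Suc n) U g \<longleftrightarrow> continuous_on U g \<and>
     (\<forall>p\<in>U. \<forall>c. (\<lambda>t. g (p(c := t))) differentiable (at (p c))) \<and> (\<forall>c. Ck n U (partial c g))"

lemma smooth_on_partial: "smooth_on U g \<Longrightarrow> smooth_on U (partial c g)"
  unfolding smooth_on_def
proof
  fix cs assume *: "\<forall>cs. continuous_on U (foldr partial cs g) \<and>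
        (\<forall>p\<in>U. \<forall>c. (\<lambda>t. foldr partial cs g (p(c := t))) differentiable at (p c))"
  show "continuous_on U (foldr partial cs (partial c g)) \<and>
          (\<forall>p\<in>U. \<forall>ca. (\<lambda>t. foldr partial cs (partial c g) (p(ca := t))) differentiable at (p ca))"
    using *[rule_format, of "cs @ [c]"] by simp
qed

text \<open>Closure under products, inverses and composition needs an induction on the number of
  derivatives: the partials of a product at order \<open>Suc n\<close> are sums of products at order
  \<open>n\<close>. The lists in \<open>smooth_on\<close> apply their last entry first, hence the
  induction from the end of the list.\<close>

lemma smooth_on_iff_Ck: "smooth_on U g \<longleftrightarrow> (\<forall>n. Ck n U g)"
proof
  assume g: "smooth_on U g"
  have "Ck n U g" for n
    using g
  proof (induction n arbitrary: g)
    case 0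
    then show ?case by (auto simp: smooth_on_def dest: spec[of _ "[]"])
  next
    case (Suc n)
    from Suc.prems have "continuous_on U g \<and>
        (\<forall>p\<in>U. \<forall>c. (\<lambda>t. g (p(c := t))) differentiable at (p c))"
      unfolding smooth_on_def by (metis foldr.simps(1) id_apply)
    then show ?case using Suc.IH[OF smooth_on_partial[OF Suc.prems]] by simp
  qed
  then show "\<forall>n. Ck n U g" ..
next
  assume g: "\<forall>n. Ck n U g"
  have "continuous_on U (foldr partial cs g) \<and>
        (\<forall>p\<in>U. \<forall>c. (\<lambda>t. foldr partial cs g (p(c := t))) differentiable at (p c))" for cs
    using g
  proof (induction cs arbitrary: g rule: rev_induct)
    case Nil
    then show ?case using Ck.simps(2)[of 0 U g] by (metis foldr.simps(1) id_apply)
  next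
    case (snoc c cs)
    have "\<forall>n. Ck n U (partial c g)"
      using snoc.prems Ck.simps(2)[of _ U g] by blast
    from snoc.IH[OF this] show ?case by simp
  qed
  then show "smooth_on U g" by (simp add: smooth_on_def)
qed

lemma Ck_Suc_D: "Ck (Suc n) U g \<Longrightarrow> Ck n U g"
  by (induction n arbitrary: g) auto

lemma Ck_continuous: "Ck n U g \<Longrightarrow> continuous_on U g"
  by (cases n) auto

lemma Ck_subset: "Ck n U g \<Longrightarrow> U' \<subseteq> U \<Longrightarrow> Ck n U' g"
  by (induction n arbitrary: g) (auto intro: continuous_on_subset)

lemma Ck_cong:
  assumes "open U" "\<And>p. p \<in> U \<Longrightarrow> g p = h p" "Ck n U g"
  shows "Ck n U h"
  using assms(2,3)
proof (induction n arbitrary: g h)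
  case 0
  then show ?case using continuous_on_cong by (metis Ck.simps(1))
next
  case (Suc n)
  have "continuous_on U h"
    using Suc.prems Ck_continuous continuous_on_cong by (metis (no_types))
  moreover have "(\<lambda>t. h (p(c := t))) differentiable (at (p c))" if "p \<in> U" for p c
  proof -
    have der: "((\<lambda>t. g (p(c := t))) has_real_derivative partial c g p) (at (p c))"
      using Suc.prems(2) that by (intro has_partial) auto
    have ev: "eventually (\<lambda>t. g (p(c := t)) = h (p(c := t))) (nhds (p c))"
      by (rule eventually_line_eq[OF assms(1) that Suc.prems(1)])
    have "((\<lambda>t. h (p(c := t))) has_real_derivative partial c g p) (at (p c))"
      by (rule DERIV_cong_ev[OF refl ev refl, THEN iffD1, OF der])
    then show ?thesis using real_differentiable_def by blast
  qed
  moreover have "Ck n U (partial c h)" for c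
    by (rule Suc.IH[of "partial c g"]) (use Suc.prems partial_cong[OF assms(1), of _ g h] in auto)
  ultimately show ?case by simp
qed

text \<open>The candidates \<open>g' c\<close> have to be right on \<open>U\<close> only. Elsewhere
  the operator \<open>partial\<close> takes unrelated values, and openness of \<open>U\<close> lets
  \<open>Ck_cong\<close> disregard them.\<close>

lemma Ck_SucI:
  assumes "open U" "continuous_on U g"
    "\<And>p c. p \<in> U \<Longrightarrow> ((\<lambda>t. g (p(c := t))) has_real_derivative g' c p) (at (p c))"
    "\<And>c. Ck n U (g' c)"
  shows "Ck (Suc n) U g"
proof -
  have "Ck n U (partial c g)" for c
    by (rule Ck_cong[OF assms(1) _ assms(4)[of c]]) (simp add: partial_eqI[OF assms(3)])
  then show ?thesis using assms(2,3) by (auto simp: real_differentiable_def)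
qed

lemma Ck_Suc_has_partial:
  "Ck (Suc n) U g \<Longrightarrow> p \<in> U \<Longrightarrow>
   ((\<lambda>t. g (p(c := t))) has_real_derivative partial c g p) (at (p c))"
  by (rule has_partial) simp

lemma Ck_has_partial_line:
  assumes "Ck (Suc n) U g" "p(c := t) \<in> U"
  shows "((\<lambda>t. g (p(c := t))) has_real_derivative partial c g (p(c := t))) (at t)"
  using Ck_Suc_has_partial[OF assms, of c] by simp

lemma Ck_const: "open U \<Longrightarrow> Ck n U (\<lambda>_. k)"
proof (induction n arbitrary: k)
  case (Suc n)
  show ?case by (rule Ck_SucI[where g' = "\<lambda>_ _. 0"]) (use Suc in auto)
qed simp

lemma continuous_on_coord: "continuous_on U (\<lambda>p::'i \<Rightarrow> real. p c)"
  by (rule continuous_on_subset[OF continuous_on_product_coordinates]) simp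

lemma Ck_coord: "open U \<Longrightarrow> Ck n U (\<lambda>p. p c)"
proof (cases n)
  case (Suc n)
  assume U: "open U"
  show ?thesis unfolding Suc
    by (rule Ck_SucI[where g' = "\<lambda>d p. if d = c then 1 else 0"])
       (use U in \<open>auto intro!: continuous_on_coord Ck_const derivative_eq_intros\<close>)
qed (simp add: continuous_on_coord)

lemma Ck_add: "open U \<Longrightarrow> Ck n U g \<Longrightarrow> Ck n U h \<Longrightarrow> Ck n U (\<lambda>p. g p + h p)"
proof (induction n arbitrary: g h)
  case (Suc n)
  show ?case
  proof (rule Ck_SucI[where g' = "\<lambda>c p. partial c g p + partial c h p"])
    show "((\<lambda>t. g (p(c := t)) + h (p(c := t))) has_real_derivative
      partial c g p + partial c h p) (at (p c))" if "p \<in> U" for p c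
      by (intro DERIV_add Ck_Suc_has_partial[OF _ that]) (rule Suc.prems)+
  qed (use Suc in \<open>auto intro!: continuous_intros\<close>)
qed (auto intro: continuous_intros)

lemma Ck_mult: "open U \<Longrightarrow> Ck n U g \<Longrightarrow> Ck n U h \<Longrightarrow> Ck n U (\<lambda>p. g p * h p)"
proof (induction n arbitrary: g h)
  case (Suc n)
  have *: "Ck n U g" "Ck n U h" using Suc.prems Ck_Suc_D by blast+
  show ?case
  proof (rule Ck_SucI[where g' = "\<lambda>c p. partial c g p * h p + partial c h p * g p"])
    show "((\<lambda>t. g (p(c := t)) * h (p(c := t))) has_real_derivative
      partial c g p * h p + partial c h p * g p) (at (p c))" if "p \<in> U" for p c
      by (rule DERIV_cong[OF DERIV_mult[OF Ck_Suc_has_partial[OF Suc.prems(2) that, of c]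
          Ck_Suc_has_partial[OF Suc.prems(3) that, of c]]]) simp
  qed (use Suc * in \<open>auto intro!: continuous_intros Ck_add\<close>)
qed (auto intro: continuous_intros)

lemma Ck_inverse:
  "open U \<Longrightarrow> Ck n U g \<Longrightarrow> (\<And>p. p \<in> U \<Longrightarrow> g p \<noteq> 0) \<Longrightarrow> Ck n U (\<lambda>p. inverse (g p))"
proof (induction n arbitrary: g)
  case (Suc n)
  have *: "Ck n U g" using Suc.prems Ck_Suc_D by blast
  show ?case
  \<comment> \<open>The derivative is written as a product with two inverses, not as a quotient by a
    square, so that the induction hypothesis and \<open>Ck_mult\<close> apply factor by
    factor.\<close>
  proof (rule Ck_SucI[where g' = "\<lambda>c p. (- 1) * (inverse (g p) * (partial c g p * inverse (g p)))"])
    show "((\<lambda>t. inverse (g (p(c := t)))) has_real_derivative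
      (- 1) * (inverse (g p) * (partial c g p * inverse (g p)))) (at (p c))" if "p \<in> U" for p c
      by (rule DERIV_cong[OF DERIV_inverse'[OF Ck_Suc_has_partial[OF Suc.prems(2) that, of c]]])
         (use Suc.prems(3)[OF that] in \<open>simp_all add: mult.assoc\<close>)
    show "Ck n U (\<lambda>p. (- 1) * (inverse (g p) * (partial c g p * inverse (g p))))" for c
      by (intro Ck_mult Ck_const Suc.IH) (use Suc * in auto)
  qed (use Suc in \<open>auto intro!: continuous_intros\<close>)
qed (auto intro: continuous_intros)

lemma Ck_sum:
  "open U \<Longrightarrow> (\<And>i. i \<in> A \<Longrightarrow> Ck n U (g i)) \<Longrightarrow> Ck n U (\<lambda>p. \<Sum>i\<in>A. g i p)"
  by (induction A rule: infinite_finite_induct) (auto intro: Ck_add Ck_const)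

section \<open>Chain rule, composition, symmetry of mixed partial derivatives\<close>

lemma tendsto_box:
  fixes y :: "'a \<Rightarrow> 'i \<Rightarrow> real"
  assumes "finite F" "e > 0" "\<And>c. ((\<lambda>t. y t c) \<longlongrightarrow> q c) net"
  shows "eventually (\<lambda>t. \<forall>c\<in>F. \<bar>y t c - q c\<bar> < e) net"
  using tendstoD[OF assms(3) assms(2)] assms(1)
  by (intro eventually_ball_finite ballI) (auto simp: dist_real_def)

text \<open>The curve is completed one coordinate of \<open>C\<close> at a time, with the mean value theorem in
  Caratheodory form along each new coordinate.\<close>

lemma chain_rule_curve:
  fixes H :: "('i \<Rightarrow> real) \<Rightarrow> real" and \<gamma> :: "real \<Rightarrow> 'i \<Rightarrow> real"
  assumes V: "open V" and H: "Ck 1 V H" and dep: "depends_only C V H" and C: "finite C"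
    and cont: "\<And>c. isCont (\<lambda>t. \<gamma> t c) t0" and V0: "\<gamma> t0 \<in> V"
    and der: "\<And>c. c \<in> C \<Longrightarrow> ((\<lambda>t. \<gamma> t c) has_real_derivative d c) (at t0)"
  shows "((\<lambda>t. H (\<gamma> t)) has_real_derivative (\<Sum>c\<in>C. partial c H (\<gamma> t0) * d c)) (at t0)"
proof -
  define q where "q = \<gamma> t0"
  define part where "part A t = (\<lambda>c. if c \<in> A then \<gamma> t c else q c)" for A t
  have contn: "((\<lambda>t. \<gamma> t c) \<longlongrightarrow> q c) (nhds t0)" for c
    using cont[of c] unfolding q_def isCont_def by (rule tendsto_at_iff_tendsto_nhds[THEN iffD1])
  obtain F e where F: "finite F" "e > 0" "{y. \<forall>c\<in>F. \<bar>y c - q c\<bar> < e} \<subseteq> V"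
    by (rule open_fun_contains_box[OF V V0[folded q_def]])
  have part_box: "eventually (\<lambda>t. \<forall>c\<in>F'. \<bar>part A t c - q c\<bar> < e') (nhds t0)"
    if "finite F'" "e' > 0" for F' e' A
  proof (rule tendsto_box[OF that])
    show "((\<lambda>t. part A t c) \<longlongrightarrow> q c) (nhds t0)" for c
      by (cases "c \<in> A") (simp_all add: part_def contn)
  qed
  have step: "((\<lambda>t. H (part A t)) has_real_derivative (\<Sum>c\<in>A. partial c H q * d c)) (at t0)"
    if "finite A" "A \<subseteq> C" for A
    using that
  proof (induction A)
    case empty
    then show ?case by (simp add: part_def)
  next
    case (insert c A)
    have pi: "part (insert c A) t = (part A t)(c := \<gamma> t c)" for t
      by (auto simp: part_def)
    have pc: "part A t c = q c" for t using insert by (auto simp: part_def)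
    define \<Delta> where "\<Delta> t = H (part (insert c A) t) - H (part A t)" for t
    \<comment> \<open>Where the coordinate has its initial value, the difference quotient gets its
      expected limit as default. Then \<open>\<Delta>\<close> factors through \<open>Q\<close> for
      every \<open>t\<close>, also if the coordinate does not move.\<close>
    define Q where "Q t = (if \<gamma> t c = q c then partial c H q else \<Delta> t / (\<gamma> t c - q c))" for t
    have DQ: "\<Delta> t = Q t * (\<gamma> t c - q c)" for t
      using pc[of t] fun_upd_triv[of "part A t" c] by (auto simp: Q_def \<Delta>_def pi)
    have Q0: "Q t0 = partial c H q" by (simp add: Q_def q_def)
    have "(Q \<longlongrightarrow> partial c H q) (nhds t0)"
    proof (rule tendstoI)
      fix \<epsilon> :: real assume \<epsilon>: "\<epsilon> > 0"
      have "continuous_on V (partial c H)" using H by (auto simp: One_nat_def)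
      then have "open (V \<inter> partial c H -` {x. \<bar>x - partial c H q\<bar> < \<epsilon>})"
        by (rule continuous_open_preimage[OF _ V]) (intro open_Collect_less continuous_intros)
      then have "open (partial c H -` {x. \<bar>x - partial c H q\<bar> < \<epsilon>} \<inter> V)"
        by (simp add: Int_commute)
      moreover have "q \<in> partial c H -` {x. \<bar>x - partial c H q\<bar> < \<epsilon>} \<inter> V"
        using \<epsilon> V0 q_def by simp
      ultimately obtain F' e' where F': "finite F'" "e' > 0"
        "{y. \<forall>c\<in>F'. \<bar>y c - q c\<bar> < e'} \<subseteq> partial c H -` {x. \<bar>x - partial c H q\<bar> < \<epsilon>} \<inter> V"
        by (rule open_fun_contains_box)
      have "eventually (\<lambda>t. \<forall>b\<in>insert c F'. \<bar>part (insert c A) t b - q b\<bar> < e') (nhds t0)"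
        using F' by (intro part_box) auto
      then show "eventually (\<lambda>t. dist (Q t) (partial c H q) < \<epsilon>) (nhds t0)"
      proof (rule eventually_mono)
        fix t assume t: "\<forall>b\<in>insert c F'. \<bar>part (insert c A) t b - q b\<bar> < e'"
        have tc: "\<bar>\<gamma> t c - q c\<bar> < e'" using t by (auto simp: part_def)
        have inb: "(part A t)(c := s) \<in> partial c H -` {x. \<bar>x - partial c H q\<bar> < \<epsilon>} \<inter> V"
          if "s \<in> closed_segment (q c) (\<gamma> t c)" for s
        proof -
          have "\<bar>s - q c\<bar> < e'"
            using that tc by (auto simp: closed_segment_eq_real_ivl split: if_splits)
          moreover have "\<bar>part A t b - q b\<bar> < e'" if "b \<in> F'" "b \<noteq> c" for b
            using that t F'(2) by (auto simp: part_def)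
          ultimately have "\<forall>b\<in>F'. \<bar>((part A t)(c := s)) b - q b\<bar> < e'" by auto
          then show ?thesis using F'(3) by blast
        qed
        have D: "((\<lambda>s. H ((part A t)(c := s))) has_real_derivative
            partial c H ((part A t)(c := s))) (at s)"
          if "s \<in> closed_segment (q c) (\<gamma> t c)" for s
          using inb[OF that] H by (intro Ck_has_partial_line[of 0]) auto
        have mvt: "\<exists>z\<in>closed_segment (q c) (\<gamma> t c).
            \<Delta> t = (\<gamma> t c - q c) * partial c H ((part A t)(c := z))"
        proof (cases "q c" "\<gamma> t c" rule: linorder_cases)
          case less
          have "\<exists>z. q c < z \<and> z < \<gamma> t c \<and> H ((part A t)(c := \<gamma> t c)) - H ((part A t)(c := q c))
              = (\<gamma> t c - q c) * partial c H ((part A t)(c := z))"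
            by (rule MVT2[OF less, where f = "\<lambda>s. H ((part A t)(c := s))" and
                  f' = "\<lambda>s. partial c H ((part A t)(c := s))"], rule D)
               (use less in \<open>simp add: closed_segment_eq_real_ivl\<close>)
          then show ?thesis using less pc[of t]
            by (auto simp: \<Delta>_def pi closed_segment_eq_real_ivl fun_upd_idem)
        next
          case equal
          then show ?thesis using pc[of t]
            by (intro bexI[of _ "q c"]) (auto simp: \<Delta>_def pi fun_upd_idem)
        next
          case greater
          have "\<exists>z. \<gamma> t c < z \<and> z < q c \<and> H ((part A t)(c := q c)) - H ((part A t)(c := \<gamma> t c))
              = (q c - \<gamma> t c) * partial c H ((part A t)(c := z))"
            by (rule MVT2[OF greater, where f = "\<lambda>s. H ((part A t)(c := s))" and
                  f' = "\<lambda>s. partial c H ((part A t)(c := s))"], rule D)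
               (use greater in \<open>simp add: closed_segment_eq_real_ivl\<close>)
          then obtain z where "\<gamma> t c < z" "z < q c"
            "H ((part A t)(c := q c)) - H ((part A t)(c := \<gamma> t c))
              = (q c - \<gamma> t c) * partial c H ((part A t)(c := z))" by blast
          then show ?thesis using greater pc[of t]
            by (intro bexI[of _ z])
               (auto simp: \<Delta>_def pi closed_segment_eq_real_ivl fun_upd_idem algebra_simps)
        qed
        then show "dist (Q t) (partial c H q) < \<epsilon>"
          using inb \<epsilon> by (force simp: Q_def dist_real_def)
      qed
    qed
    then have Qc: "isCont Q t0"
      unfolding isCont_def Q0[symmetric] by (rule tendsto_at_iff_tendsto_nhds[THEN iffD2])
    obtain k where k: "\<And>z. \<gamma> z c - \<gamma> t0 c = k z * (z - t0)" "isCont k t0" "k t0 = d c"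
      using der[of c] insert.prems CARAT_DERIV by (metis insert_subset)
    have "(\<Delta> has_real_derivative Q t0 * k t0) (at t0)"
      unfolding CARAT_DERIV
    proof (intro exI[of _ "\<lambda>t. Q t * k t"] conjI allI)
      have "\<Delta> t0 = 0" by (simp add: DQ q_def)
      then show "\<Delta> z - \<Delta> t0 = Q z * k z * (z - t0)" for z
        using k(1)[of z] by (simp add: DQ[of z] q_def)
      show "isCont (\<lambda>t. Q t * k t) t0" using Qc k(2) by (intro continuous_intros)
    qed simp
    then have "((\<lambda>t. \<Delta> t + H (part A t)) has_real_derivative
        Q t0 * k t0 + (\<Sum>c\<in>A. partial c H q * d c)) (at t0)"
      using insert by (intro derivative_intros) auto
    then show ?case using insert by (simp add: \<Delta>_def Q0 k(3))
  qed
  have "eventually (\<lambda>t. \<forall>c\<in>F. \<bar>part C t c - q c\<bar> < e) (nhds t0)"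
    using F by (intro part_box) auto
  \<comment> \<open>\<open>part UNIV t\<close> is the curve itself. Both it and
    \<open>part C t\<close> must lie in \<open>V\<close> before the dependence on \<open>C\<close>
    can identify the values of \<open>H\<close>.\<close>
  moreover have "eventually (\<lambda>t. \<forall>c\<in>F. \<bar>part UNIV t c - q c\<bar> < e) (nhds t0)"
    using F by (intro part_box) auto
  ultimately have "eventually (\<lambda>t. H (part C t) = H (\<gamma> t)) (nhds t0)"
  proof eventually_elim
    case (elim t)
    then have "part C t \<in> V" "part UNIV t \<in> V" using F(3) by blast+
    then show ?case
      by (intro depends_onlyD[OF dep]) (simp_all add: part_def)
  qed
  then show ?thesis
    by (rule DERIV_cong_ev[OF refl _ refl, THEN iffD1, OF _ step[OF C order_refl, unfolded q_def]])
qed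

lemma Ck_partial_compose:
  fixes H :: "('j \<Rightarrow> real) \<Rightarrow> real" and T :: "('i \<Rightarrow> real) \<Rightarrow> 'j \<Rightarrow> real"
  assumes "open U" "open V" "T ` U \<subseteq> V" "Ck 1 V H" "depends_only C V H" "finite C"
    "\<And>c. Ck 1 U (\<lambda>y. T y c)" "p \<in> U"
  shows "((\<lambda>t. H (T (p(b := t)))) has_real_derivative
    (\<Sum>c\<in>C. partial c H (T p) * partial b (\<lambda>y. T y c) p)) (at (p b))"
proof -
  have d: "((\<lambda>t. T (p(b := t)) c) has_real_derivative partial b (\<lambda>y. T y c) p) (at (p b))" for c
    using Ck_Suc_has_partial[of 0] assms(7,8) by fastforce
  show ?thesis
    using chain_rule_curve[OF assms(2,4,5,6), where \<gamma> = "\<lambda>t. T (p(b := t))" and ?t0.0 = "p b",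
      OF DERIV_isCont[OF d] _ d] assms(3,8) by auto
qed

lemma Ck_compose:
  fixes H :: "('j \<Rightarrow> real) \<Rightarrow> real" and T :: "('i \<Rightarrow> real) \<Rightarrow> 'j \<Rightarrow> real"
  assumes U: "open U" and V: "open V" "T ` U \<subseteq> V" and C: "finite C"
    and "Ck n V H" "depends_only C V H" "\<And>c. Ck n U (\<lambda>y. T y c)"
  shows "Ck n U (\<lambda>y. H (T y))"
  using assms(5-)
proof (induction n arbitrary: H)
  case 0
  have "continuous_on U T"
    using 0 by (intro continuous_on_coordinatewise_then_product) auto
  then show ?case
    using 0 V(2) continuous_on_compose2[of V H U T] by simp
next
  case (Suc n)
  have "Ck 0 V H" "\<And>c. Ck 0 U (\<lambda>y. T y c)" using Suc.prems Ck_continuous by auto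
  then have c: "continuous_on U (\<lambda>y. H (T y))"
    using V(2) by (intro continuous_on_compose2[of V H U T]
      continuous_on_coordinatewise_then_product) auto
  have *: "Ck n V H" "\<And>c. Ck n U (\<lambda>y. T y c)" using Suc.prems Ck_Suc_D by blast+
  have 1: "Ck 1 W K" if "Ck (Suc n) W K" for W and K :: "('k \<Rightarrow> real) \<Rightarrow> real"
    using that Ck_continuous[of n W "partial c K" for c] by (auto simp: One_nat_def)
  have p: "Ck n V (partial c H)" "Ck n U (partial b (\<lambda>y. T y c))" for b c
    using Suc.prems(1) Suc.prems(3)[of c] by simp_all
  show ?case
  proof (rule Ck_SucI[OF U c Ck_partial_compose[OF U V 1[OF Suc.prems(1)] Suc.prems(2) C]])
    show "Ck n U (\<lambda>p. \<Sum>c\<in>C. partial c H (T p) * partial b (\<lambda>y. T y c) p)" for b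
    proof (rule Ck_sum[OF U], rule Ck_mult[OF U])
      show "Ck n U (\<lambda>p. partial c H (T p))" for c
        by (rule Suc.IH[OF p(1) depends_only_partial[OF V(1) Suc.prems(2)] *(2)])
      show "Ck n U (partial b (\<lambda>y. T y c))" for c by (rule p(2))
    qed
  qed (rule 1[OF Suc.prems(3)])
qed

text \<open>The second difference over a square of side \<open>e\<close> with corner
  \<open>p\<close> is symmetric in the two directions. Applying the mean value theorem twice turns
  it into \<open>e * e\<close> times either mixed partial at some point of the square, and
  continuity forces equality as the square shrinks.\<close>

lemma partial_commute:
  assumes U: "open U" and g: "Ck 2 U g" and p: "p \<in> U"
  shows "partial c (partial d g) p = partial d (partial c g) p"
proof (cases "c = d")
  case False
  have mixed: "\<exists>y. (\<forall>b. \<bar>y b - p b\<bar> \<le> e) \<and> 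
      g (p(c := p c + e, d := p d + e)) - g (p(c := p c + e)) - g (p(d := p d + e)) + g p
        = e * e * partial d (partial c g) y"
    if cd: "c \<noteq> d" and e: "e > 0" and box: "\<And>y. (\<And>b. \<bar>y b - p b\<bar> \<le> e) \<Longrightarrow> y \<in> U" for c d e
  proof -
    define \<phi> where "\<phi> s = g (p(d := p d + e, c := s)) - g (p(c := s))" for s
    have g1: "Ck (Suc 0) U (partial b g)" "Ck (Suc 0) U g" for b
      using g Ck_continuous by (auto simp: numeral_2_eq_2)
    have "\<exists>z. p c < z \<and> z < p c + e \<and> \<phi> (p c + e) - \<phi> (p c) =
        (p c + e - p c) * (partial c g (p(d := p d + e, c := z)) - partial c g (p(c := z)))"
      unfolding \<phi>_def
    proof (rule MVT2)
      show "((\<lambda>s. g (p(d := p d + e, c := s)) - g (p(c := s))) has_real_derivative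
        partial c g (p(d := p d + e, c := x)) - partial c g (p(c := x))) (at x)"
        if "p c \<le> x" "x \<le> p c + e" for x
        by (intro DERIV_diff Ck_has_partial_line[OF g1(2)] box) (use that e in auto)
    qed (use e in simp)
    then obtain z where z: "p c < z" "z < p c + e" "\<phi> (p c + e) - \<phi> (p c) =
        e * (partial c g (p(d := p d + e, c := z)) - partial c g (p(c := z)))" by auto
    have "\<exists>w. p d < w \<and> w < p d + e \<and>
        partial c g (p(c := z, d := p d + e)) - partial c g (p(c := z, d := p d)) =
        (p d + e - p d) * partial d (partial c g) (p(c := z, d := w))"
    proof (rule MVT2)
      show "((\<lambda>s. partial c g (p(c := z, d := s))) has_real_derivative
        partial d (partial c g) (p(c := z, d := x))) (at x)"
        if "p d \<le> x" "x \<le> p d + e" for x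
        by (intro Ck_has_partial_line[OF g1(1)] box) (use that e z in auto)
    qed (use e in simp)
    then obtain w where w: "p d < w" "w < p d + e"
        "partial c g (p(c := z, d := p d + e)) - partial c g (p(c := z, d := p d)) =
        e * partial d (partial c g) (p(c := z, d := w))" by auto
    have "p(c := z, d := p d) = p(c := z)" using cd by auto
    then have "\<phi> (p c + e) - \<phi> (p c) = e * e * partial d (partial c g) (p(c := z, d := w))"
      using z(3) w(3) cd by (simp add: fun_upd_twist)
    moreover have "\<phi> (p c + e) - \<phi> (p c) = 
      g (p(c := p c + e, d := p d + e)) - g (p(c := p c + e)) - g (p(d := p d + e)) + g p"
      using cd by (simp add: \<phi>_def fun_upd_twist fun_upd_idem)
    ultimately show ?thesis
      using z w e by (intro exI[of _ "p(c := z, d := w)"]) auto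
  qed
  have "\<bar>partial c (partial d g) p - partial d (partial c g) p\<bar> \<le> \<epsilon>" if \<epsilon>: "\<epsilon> > 0" for \<epsilon>
  proof -
    have "open {y\<in>U. \<bar>partial a (partial b g) y - partial a (partial b g) p\<bar> < \<epsilon> / 2}" for a b
    proof -
      have "continuous_on U (partial a (partial b g))" using g by (auto simp: numeral_2_eq_2)
      then have "open (U \<inter> partial a (partial b g) -` {x. \<bar>x - partial a (partial b g) p\<bar> < \<epsilon> / 2})"
        by (rule continuous_open_preimage[OF _ U]) (intro open_Collect_less continuous_intros)
      moreover have "U \<inter> partial a (partial b g) -` {x. \<bar>x - partial a (partial b g) p\<bar> < \<epsilon> / 2} =
        {y\<in>U. \<bar>partial a (partial b g) y - partial a (partial b g) p\<bar> < \<epsilon> / 2}" by auto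
      ultimately show ?thesis by simp
    qed
    then have "open ({y\<in>U. \<bar>partial c (partial d g) y - partial c (partial d g) p\<bar> < \<epsilon> / 2} \<inter>
       {y\<in>U. \<bar>partial d (partial c g) y - partial d (partial c g) p\<bar> < \<epsilon> / 2})"
      by (intro open_Int)
    moreover have "p \<in> {y\<in>U. \<bar>partial c (partial d g) y - partial c (partial d g) p\<bar> < \<epsilon> / 2} \<inter>
       {y\<in>U. \<bar>partial d (partial c g) y - partial d (partial c g) p\<bar> < \<epsilon> / 2}"
      using p \<epsilon> by simp
    ultimately obtain F e where F: "finite F" "e > 0" "{y. \<forall>c\<in>F. \<bar>y c - p c\<bar> < e} \<subseteq>
       {y\<in>U. \<bar>partial c (partial d g) y - partial c (partial d g) p\<bar> < \<epsilon> / 2} \<inter>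
       {y\<in>U. \<bar>partial d (partial c g) y - partial d (partial c g) p\<bar> < \<epsilon> / 2}"
      by (rule open_fun_contains_box)
    have box: "y \<in> {y\<in>U. \<bar>partial c (partial d g) y - partial c (partial d g) p\<bar> < \<epsilon> / 2} \<inter>
       {y\<in>U. \<bar>partial d (partial c g) y - partial d (partial c g) p\<bar> < \<epsilon> / 2}"
      if "\<And>b. \<bar>y b - p b\<bar> \<le> e / 2" for y
    proof -
      have "\<bar>y b - p b\<bar> < e" for b using that[of b] F(2) by linarith
      then show ?thesis using F(3) by auto
    qed
    obtain y where y: "\<forall>b. \<bar>y b - p b\<bar> \<le> e / 2"
      "g (p(c := p c + e/2, d := p d + e/2)) - g (p(c := p c + e/2)) - g (p(d := p d + e/2)) + g p
        = e/2 * (e/2) * partial d (partial c g) y"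
      using mixed[OF False, of "e / 2"] F(2) box by auto
    obtain y' where y': "\<forall>b. \<bar>y' b - p b\<bar> \<le> e / 2"
      "g (p(d := p d + e/2, c := p c + e/2)) - g (p(d := p d + e/2)) - g (p(c := p c + e/2)) + g p
        = e/2 * (e/2) * partial c (partial d g) y'"
      using mixed[OF False[symmetric], of "e / 2"] F(2) box by auto
    have "e/2 * (e/2) * partial d (partial c g) y = e/2 * (e/2) * partial c (partial d g) y'"
      unfolding y(2)[symmetric] y'(2)[symmetric] using False by (simp add: fun_upd_twist)
    then have "partial d (partial c g) y = partial c (partial d g) y'"
      using F(2) by simp
    moreover have "\<bar>partial d (partial c g) y - partial d (partial c g) p\<bar> < \<epsilon> / 2"
      "\<bar>partial c (partial d g) y' - partial c (partial d g) p\<bar> < \<epsilon> / 2"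
      using box[of y] box[of y'] y(1) y'(1) by blast+
    ultimately show ?thesis by linarith
  qed
  then have "\<bar>partial c (partial d g) p - partial d (partial c g) p\<bar> \<le> 0"
    by (rule field_le_epsilon[of _ 0, simplified]) 
  then show ?thesis by simp
qed simp

section \<open>Derivatives along tangent vectors and their calculus\<close>

definition along :: "('i \<Rightarrow> real) \<Rightarrow> (('i \<Rightarrow> real) \<Rightarrow> real) \<Rightarrow> ('i \<Rightarrow> real) \<Rightarrow> real" where
  "along w g p = Sum_any (\<lambda>c. w c * partial c g p)"

text \<open>\<open>C\<close> is explicit because later arguments track which jet coordinates occur.
  One finite set serves all of \<open>U\<close>, also in \<open>loc_smooth\<close>, where it is
  merely hidden by a quantifier.\<close>

definition fin_smooth :: "'i set \<Rightarrow> ('i \<Rightarrow> real) set \<Rightarrow> (('i \<Rightarrow> real) \<Rightarrow> real) \<Rightarrow> bool" where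
  "fin_smooth C U g \<longleftrightarrow> open U \<and> finite C \<and> (\<forall>n. Ck n U g) \<and> depends_only C U g"

definition loc_smooth :: "('i \<Rightarrow> real) set \<Rightarrow> (('i \<Rightarrow> real) \<Rightarrow> real) \<Rightarrow> bool" where
  "loc_smooth U g \<longleftrightarrow> (\<exists>C. fin_smooth C U g)"

lemma fin_smoothD:
  assumes "fin_smooth C U g"
  shows "open U" "finite C" "Ck n U g" "depends_only C U g" "continuous_on U g"
  using assms Ck_continuous[of 0 U g] by (auto simp: fin_smooth_def)

lemma loc_smoothI: "fin_smooth C U g \<Longrightarrow> loc_smooth U g"
  by (auto simp: loc_smooth_def)

lemma loc_smooth_open: "loc_smooth U g \<Longrightarrow> open U"
  by (auto simp: loc_smooth_def fin_smooth_def)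

lemma loc_smooth_Ck: "loc_smooth U g \<Longrightarrow> Ck n U g"
  by (auto simp: loc_smooth_def dest: fin_smoothD(3))

lemma fin_smooth_mono:
  "fin_smooth C U g \<Longrightarrow> C \<subseteq> C' \<Longrightarrow> finite C' \<Longrightarrow> fin_smooth C' U g"
  unfolding fin_smooth_def using depends_only_mono by blast

lemma fin_smooth_subset:
  "fin_smooth C U g \<Longrightarrow> U' \<subseteq> U \<Longrightarrow> open U' \<Longrightarrow> fin_smooth C U' g"
  unfolding fin_smooth_def using depends_only_mono[of C U g C U'] Ck_subset by blast

lemma loc_smooth_subset: "loc_smooth U g \<Longrightarrow> U' \<subseteq> U \<Longrightarrow> open U' \<Longrightarrow> loc_smooth U' g"
  unfolding loc_smooth_def using fin_smooth_subset by blast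

lemma fin_smooth_cong:
  assumes "fin_smooth C U g" "\<And>p. p \<in> U \<Longrightarrow> g p = h p"
  shows "fin_smooth C U h"
proof -
  have "Ck n U h" for n
    by (rule Ck_cong[of U g]) (use assms fin_smoothD in auto)
  moreover have "depends_only C U h"
    using assms unfolding fin_smooth_def depends_only_def by metis
  ultimately show ?thesis using assms(1) by (simp add: fin_smooth_def)
qed

lemma loc_smooth_cong:
  assumes "loc_smooth U g" "\<And>p. p \<in> U \<Longrightarrow> g p = h p"
  shows "loc_smooth U h"
  using assms fin_smooth_cong unfolding loc_smooth_def by blast

lemma fin_smooth_partial: "fin_smooth C U g \<Longrightarrow> fin_smooth C U (partial c g)"
  unfolding fin_smooth_def using depends_only_partial by (metis Ck.simps(2))

lemma fin_smooth_const: "open U \<Longrightarrow> finite C \<Longrightarrow> fin_smooth C U (\<lambda>_. k)"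
  by (simp add: fin_smooth_def Ck_const depends_only_def)

lemma fin_smooth_coord: "open U \<Longrightarrow> finite C \<Longrightarrow> c \<in> C \<Longrightarrow> fin_smooth C U (\<lambda>q. q c)"
  by (simp add: fin_smooth_def Ck_coord depends_only_def)

lemma depends_only_comp2:
  "depends_only C U g \<Longrightarrow> depends_only C U h \<Longrightarrow> depends_only C U (\<lambda>q. F (g q) (h q))"
  unfolding depends_only_def by metis

lemma fin_smooth_add:
  "fin_smooth C U g \<Longrightarrow> fin_smooth C U h \<Longrightarrow> fin_smooth C U (\<lambda>q. g q + h q)"
  by (simp add: fin_smooth_def Ck_add depends_only_comp2[where F = "(+)"])

lemma fin_smooth_mult:
  "fin_smooth C U g \<Longrightarrow> fin_smooth C U h \<Longrightarrow> fin_smooth C U (\<lambda>q. g q * h q)"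
  by (simp add: fin_smooth_def Ck_mult depends_only_comp2[where F = "(*)"])

lemma fin_smooth_inverse:
  "fin_smooth C U g \<Longrightarrow> (\<And>p. p \<in> U \<Longrightarrow> g p \<noteq> 0) \<Longrightarrow> fin_smooth C U (\<lambda>q. inverse (g q))"
  using depends_only_comp2[of C U g g "\<lambda>x _. inverse x"] by (simp add: fin_smooth_def Ck_inverse)

lemma fin_smooth_minus:
  assumes "fin_smooth C U g"
  shows "fin_smooth C U (\<lambda>q. - g q)"
  using fin_smooth_mult[OF fin_smooth_const[of U C "-1"] assms] fin_smoothD[OF assms] by simp

lemma fin_smooth_diff:
  "fin_smooth C U g \<Longrightarrow> fin_smooth C U h \<Longrightarrow> fin_smooth C U (\<lambda>q. g q - h q)"
  using fin_smooth_add[OF _ fin_smooth_minus] by fastforce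

lemma fin_smooth_divide:
  "fin_smooth C U g \<Longrightarrow> fin_smooth C U h \<Longrightarrow> (\<And>p. p \<in> U \<Longrightarrow> h p \<noteq> 0) \<Longrightarrow>
    fin_smooth C U (\<lambda>q. g q / h q)"
  unfolding divide_inverse by (intro fin_smooth_mult fin_smooth_inverse)

lemma fin_smooth_power: "fin_smooth C U g \<Longrightarrow> fin_smooth C U (\<lambda>q. g q ^ n)"
  by (induction n) (auto intro: fin_smooth_mult fin_smooth_const dest: fin_smoothD)

lemma fin_smooth_sum:
  "open U \<Longrightarrow> finite C \<Longrightarrow> (\<And>i. i \<in> A \<Longrightarrow> fin_smooth C U (g i)) \<Longrightarrow>
    fin_smooth C U (\<lambda>q. \<Sum>i\<in>A. g i q)"
  by (induction A rule: infinite_finite_induct) (auto intro: fin_smooth_add fin_smooth_const)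

lemmas fin_smooth_intros =
  fin_smooth_const fin_smooth_coord fin_smooth_add fin_smooth_mult fin_smooth_minus
  fin_smooth_diff fin_smooth_divide fin_smooth_power

lemma fin_smooth_common:
  assumes "loc_smooth U g" "loc_smooth U h"
  obtains C where "fin_smooth C U g" "fin_smooth C U h"
proof -
  obtain C D where "fin_smooth C U g" "fin_smooth D U h"
    using assms by (auto simp: loc_smooth_def)
  then have "fin_smooth (C \<union> D) U g" "fin_smooth (C \<union> D) U h"
    using fin_smooth_mono fin_smoothD(2) by (metis finite_Un sup_ge1 sup_ge2)+
  then show ?thesis using that by blast
qed

lemma loc_smooth_const: "open U \<Longrightarrow> loc_smooth U (\<lambda>_. k)"
  using loc_smoothI fin_smooth_const by (metis finite.emptyI)

lemma loc_smooth_coord: "open U \<Longrightarrow> loc_smooth U (\<lambda>q. q c)"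
  by (rule loc_smoothI[of "{c}"]) (simp add: fin_smooth_coord)

lemma loc_smooth_add: "loc_smooth U g \<Longrightarrow> loc_smooth U h \<Longrightarrow> loc_smooth U (\<lambda>q. g q + h q)"
  by (erule (1) fin_smooth_common) (auto intro: loc_smoothI fin_smooth_add)

lemma loc_smooth_mult: "loc_smooth U g \<Longrightarrow> loc_smooth U h \<Longrightarrow> loc_smooth U (\<lambda>q. g q * h q)"
  by (erule (1) fin_smooth_common) (auto intro: loc_smoothI fin_smooth_mult)

lemma loc_smooth_minus: "loc_smooth U g \<Longrightarrow> loc_smooth U (\<lambda>q. - g q)"
  unfolding loc_smooth_def using fin_smooth_minus by blast

lemma loc_smooth_diff: "loc_smooth U g \<Longrightarrow> loc_smooth U h \<Longrightarrow> loc_smooth U (\<lambda>q. g q - h q)"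
  by (erule (1) fin_smooth_common) (auto intro: loc_smoothI fin_smooth_diff)

lemma loc_smooth_divide:
  "loc_smooth U g \<Longrightarrow> loc_smooth U h \<Longrightarrow> (\<And>p. p \<in> U \<Longrightarrow> h p \<noteq> 0) \<Longrightarrow>
    loc_smooth U (\<lambda>q. g q / h q)"
  by (erule (1) fin_smooth_common) (auto intro: loc_smoothI fin_smooth_divide)

lemma loc_smooth_power: "loc_smooth U g \<Longrightarrow> loc_smooth U (\<lambda>q. g q ^ n)"
  unfolding loc_smooth_def using fin_smooth_power by blast

lemma loc_smooth_sum:
  "open U \<Longrightarrow> (\<And>i. i \<in> A \<Longrightarrow> loc_smooth U (g i)) \<Longrightarrow> loc_smooth U (\<lambda>q. \<Sum>i\<in>A. g i q)"
  by (induction A rule: infinite_finite_induct) (auto intro: loc_smooth_add loc_smooth_const)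

lemma loc_smooth_partial: "loc_smooth U g \<Longrightarrow> loc_smooth U (partial c g)"
  by (auto simp: loc_smooth_def intro: fin_smooth_partial)

lemmas loc_smooth_intros =
  loc_smooth_const loc_smooth_coord loc_smooth_add loc_smooth_mult loc_smooth_minus
  loc_smooth_diff loc_smooth_divide loc_smooth_power loc_smooth_partial

lemma along_eq:
  assumes "fin_smooth C U g" "p \<in> U"
  shows "along w g p = (\<Sum>c\<in>C. w c * partial c g p)"
  unfolding along_def
proof (rule Sum_any.expand_superset)
  show "{c. w c * partial c g p \<noteq> 0} \<subseteq> C"
    using partial_zero[OF fin_smoothD(1,4)[OF assms(1)] _ assms(2)] by force
qed (rule fin_smoothD(2)[OF assms(1)])

lemma along_cong:
  assumes "open U" "p \<in> U" "\<And>q. q \<in> U \<Longrightarrow> g q = h q"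
  shows "along w g p = along w h p"
  unfolding along_def using partial_cong[OF assms] by simp

text \<open>An equation for \<open>along\<close> alone cannot be composed, since it has a value even
  where \<open>g\<close> is not differentiable. Bundled with smoothness near \<open>p\<close>, the
  rules for sums, products and quotients chain like derivative rules and leave a single equation
  between real numbers.\<close>

definition has_along ::
    "('i \<Rightarrow> real) \<Rightarrow> ('i \<Rightarrow> real) \<Rightarrow> (('i \<Rightarrow> real) \<Rightarrow> real) \<Rightarrow> real \<Rightarrow> bool" where
  "has_along w p g D \<longleftrightarrow> (\<exists>U. p \<in> U \<and> loc_smooth U g \<and> along w g p = D)"

lemma has_along_D: "has_along w p g D \<Longrightarrow> along w g p = D"
  by (auto simp: has_along_def)

lemma has_along_I: "loc_smooth U g \<Longrightarrow> p \<in> U \<Longrightarrow> has_along w p g (along w g p)"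
  by (auto simp: has_along_def)

lemma has_along_eq: "has_along w p g D \<Longrightarrow> D = D' \<Longrightarrow> has_along w p g D'"
  by simp

lemma has_along_cong:
  assumes "has_along w p g D" "open U" "p \<in> U" "\<And>q. q \<in> U \<Longrightarrow> g q = h q"
  shows "has_along w p h D"
proof -
  obtain V where V: "p \<in> V" "loc_smooth V g" "along w g p = D"
    using assms(1) by (auto simp: has_along_def)
  have "loc_smooth (U \<inter> V) h"
    by (rule loc_smooth_cong[OF loc_smooth_subset[OF V(2)]])
       (use assms loc_smooth_open[OF V(2)] in auto)
  then show ?thesis
    using along_cong[OF assms(2-4), where w = w] V assms(3) by (auto simp: has_along_def)
qed

lemma has_along_common:
  assumes "has_along w p g D" "has_along w p h E"
  obtains C U where "fin_smooth C U g" "fin_smooth C U h" "p \<in> U"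
    "D = (\<Sum>c\<in>C. w c * partial c g p)" "E = (\<Sum>c\<in>C. w c * partial c h p)"
proof -
  obtain U V where UV: "p \<in> U" "loc_smooth U g" "along w g p = D"
     "p \<in> V" "loc_smooth V h" "along w h p = E"
    using assms by (auto simp: has_along_def)
  then have "loc_smooth (U \<inter> V) g" "loc_smooth (U \<inter> V) h"
    by (auto intro: loc_smooth_subset dest: loc_smooth_open)
  then obtain C where C: "fin_smooth C (U \<inter> V) g" "fin_smooth C (U \<inter> V) h"
    by (rule fin_smooth_common)
  show ?thesis
    using that[OF C] UV along_eq[OF C(1), of p] along_eq[OF C(2), of p] by auto
qed

lemma fin_smooth_has_partial:
  "fin_smooth C U g \<Longrightarrow> p \<in> U \<Longrightarrow>
   ((\<lambda>t. g (p(c := t))) has_real_derivative partial c g p) (at (p c))"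
  by (rule Ck_Suc_has_partial[OF fin_smoothD(3)])

lemma has_along_const: "has_along w p (\<lambda>_. k) 0"
proof -
  have "along w (\<lambda>_. k) p = 0"
    by (simp add: along_def partial_def)
  then show ?thesis
    using has_along_I[OF loc_smooth_const[OF open_UNIV], of p w k] by simp
qed

lemma has_along_coord: "has_along w p (\<lambda>q. q c) (w c)"
proof -
  have "along w (\<lambda>q. q c) p = (\<Sum>d\<in>{c}. w d * partial d (\<lambda>q. q c) p)"
    by (rule along_eq[OF fin_smooth_coord[OF open_UNIV]]) auto
  also have "\<dots> = w c"
    by (simp add: partial_def)
  finally show ?thesis
    using has_along_I[OF loc_smooth_coord[OF open_UNIV], of p w c] by simp
qed

lemma along_const [simp]: "along w (\<lambda>_. k) p = 0"
  by (rule has_along_D[OF has_along_const])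

lemma along_coord [simp]: "along w (\<lambda>q. q c) p = w c"
  by (rule has_along_D[OF has_along_coord])

lemma has_along_add:
  assumes "has_along w p g D" "has_along w p h E"
  shows "has_along w p (\<lambda>q. g q + h q) (D + E)"
proof -
  obtain C U where C: "fin_smooth C U g" "fin_smooth C U h" "p \<in> U"
    "D = (\<Sum>c\<in>C. w c * partial c g p)" "E = (\<Sum>c\<in>C. w c * partial c h p)"
    using assms by (rule has_along_common)
  have "partial c (\<lambda>q. g q + h q) p = partial c g p + partial c h p" for c
    by (rule partial_eqI)
       (rule DERIV_add[OF C(1,2)[THEN fin_smooth_has_partial, OF C(3)]])
  then have "along w (\<lambda>q. g q + h q) p = D + E"
    using along_eq[OF fin_smooth_add[OF C(1,2)] C(3), of w] C(4,5)
    by (simp add: algebra_simps sum.distrib)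
  then show ?thesis
    using has_along_I[OF loc_smoothI[OF fin_smooth_add[OF C(1,2)]] C(3), of w] by simp
qed

lemma has_along_mult:
  assumes "has_along w p g D" "has_along w p h E"
  shows "has_along w p (\<lambda>q. g q * h q) (D * h p + g p * E)"
proof -
  obtain C U where C: "fin_smooth C U g" "fin_smooth C U h" "p \<in> U"
    "D = (\<Sum>c\<in>C. w c * partial c g p)" "E = (\<Sum>c\<in>C. w c * partial c h p)"
    using assms by (rule has_along_common)
  have "partial c (\<lambda>q. g q * h q) p = partial c g p * h p + g p * partial c h p" for c
    by (rule partial_eqI)
       (rule DERIV_cong[OF DERIV_mult[OF C(1,2)[THEN fin_smooth_has_partial, OF C(3)]]], simp)
  then have "along w (\<lambda>q. g q * h q) p = D * h p + g p * E"
    using along_eq[OF fin_smooth_mult[OF C(1,2)] C(3), of w] C(4,5)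
    by (simp add: algebra_simps sum.distrib sum_distrib_left)
  then show ?thesis
    using has_along_I[OF loc_smoothI[OF fin_smooth_mult[OF C(1,2)]] C(3), of w] by simp
qed

lemma has_along_inverse:
  assumes "has_along w p g D" "g p \<noteq> 0"
  shows "has_along w p (\<lambda>q. inverse (g q)) (- D / (g p)\<^sup>2)"
proof -
  obtain C U0 where C0: "fin_smooth C U0 g" "p \<in> U0"
    "D = (\<Sum>c\<in>C. w c * partial c g p)"
    by (rule has_along_common[OF assms(1,1)])
  define U where "U = U0 \<inter> g -` (- {0})"
  have "open U" unfolding U_def
    by (rule continuous_open_preimage[OF fin_smoothD(5,1)[OF C0(1)]]) auto
  then have C: "fin_smooth C U g" "p \<in> U"
    using fin_smooth_subset[OF C0(1)] C0(2) assms(2) by (auto simp: U_def)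
  have i: "fin_smooth C U (\<lambda>q. inverse (g q))"
    by (rule fin_smooth_inverse[OF C(1)]) (auto simp: U_def)
  have "partial c (\<lambda>q. inverse (g q)) p = - partial c g p / (g p)\<^sup>2" for c
    by (rule partial_eqI)
       (rule DERIV_cong[OF DERIV_inverse'[OF fin_smooth_has_partial[OF C]]],
         simp_all add: assms(2) field_simps power2_eq_square)
  then have "along w (\<lambda>q. inverse (g q)) p = - D / (g p)\<^sup>2"
    using along_eq[OF i C(2), of w] C0(3) by (simp add: sum_divide_distrib sum_negf)
  then show ?thesis
    using has_along_I[OF loc_smoothI[OF i] C(2), of w] by simp
qed

lemma has_along_minus: "has_along w p g D \<Longrightarrow> has_along w p (\<lambda>q. - g q) (- D)"
  using has_along_mult[OF has_along_const[of w p "-1"], of g D] by simp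

lemma has_along_diff:
  "has_along w p g D \<Longrightarrow> has_along w p h E \<Longrightarrow> has_along w p (\<lambda>q. g q - h q) (D - E)"
  using has_along_add[OF _ has_along_minus] by fastforce

lemma has_along_divide:
  assumes "has_along w p g D" "has_along w p h E" "h p \<noteq> 0"
  shows "has_along w p (\<lambda>q. g q / h q) ((D * h p - g p * E) / (h p)\<^sup>2)"
  unfolding divide_inverse[of "g _"]
  by (rule has_along_eq[OF has_along_mult[OF assms(1) has_along_inverse[OF assms(2,3)]]])
     (simp add: assms(3) field_simps power2_eq_square)

lemma has_along_power2:
  "has_along w p g D \<Longrightarrow> has_along w p (\<lambda>q. (g q)\<^sup>2) (2 * g p * D)"
  unfolding power2_eq_square by (rule has_along_eq[OF has_along_mult]) auto

lemma has_along_sum: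
  "(\<And>i. i \<in> A \<Longrightarrow> has_along w p (g i) (D i)) \<Longrightarrow>
    has_along w p (\<lambda>q. \<Sum>i\<in>A. g i q) (\<Sum>i\<in>A. D i)"
  by (induction A rule: infinite_finite_induct) (auto intro: has_along_add has_along_const)

lemmas has_along_intros =
  has_along_const has_along_coord has_along_add has_along_mult has_along_minus
  has_along_diff has_along_divide has_along_power2

text \<open>The case of a basis vector: the \<open>has_along\<close> rules thereby compute partial
  derivatives too.\<close>

lemma partial_along: "partial c g p = along (\<lambda>b. if b = c then 1 else 0) g p"
proof -
  have "along (\<lambda>b. if b = c then 1 else 0) g p = Sum_any (\<lambda>b. if b = c then partial b g p else 0)"
    unfolding along_def by (rule Sum_any.cong) simp
  then show ?thesis by simp
qed

text \<open>The second-order terms of the commutator of two vector fields cancel by symmetry of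
  mixed partials. Components outside \<open>C\<close> multiply vanishing derivatives of
  \<open>g\<close>, so finite sums suffice.\<close>

lemma bracket:
  assumes g: "fin_smooth C U g" and p: "p \<in> U"
    and V: "\<And>c. c \<in> C \<Longrightarrow> loc_smooth U (V c)" and W: "\<And>c. c \<in> C \<Longrightarrow> loc_smooth U (W c)"
  shows "along (\<lambda>c. V c p) (\<lambda>q. along (\<lambda>c. W c q) g q) p
      - along (\<lambda>c. W c p) (\<lambda>q. along (\<lambda>c. V c q) g q) p
    = (\<Sum>c\<in>C. (along (\<lambda>c. V c p) (W c) p - along (\<lambda>c. W c p) (V c) p) * partial c g p)"
proof -
  have *: "along (\<lambda>c. V c p) (\<lambda>q. along (\<lambda>c. W c q) g q) p =
      (\<Sum>c\<in>C. along (\<lambda>c. V c p) (W c) p * partial c g p)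
      + (\<Sum>c\<in>C. \<Sum>e\<in>C. W c p * V e p * partial e (partial c g) p)"
    if V: "\<And>c. c \<in> C \<Longrightarrow> loc_smooth U (V c)" and W: "\<And>c. c \<in> C \<Longrightarrow> loc_smooth U (W c)" for V W
  proof -
    have "has_along (\<lambda>c. V c p) p (\<lambda>q. \<Sum>c\<in>C. W c q * partial c g q)
        (\<Sum>c\<in>C. along (\<lambda>c. V c p) (W c) p * partial c g p +
               W c p * along (\<lambda>c. V c p) (partial c g) p)"
      using loc_smoothI[OF fin_smooth_partial[OF g]] p W
      by (intro has_along_sum has_along_mult has_along_I[of U])
    then have "has_along (\<lambda>c. V c p) p (\<lambda>q. along (\<lambda>c. W c q) g q)
        (\<Sum>c\<in>C. along (\<lambda>c. V c p) (W c) p * partial c g p +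
               W c p * along (\<lambda>c. V c p) (partial c g) p)"
      by (rule has_along_cong[OF _ fin_smoothD(1)[OF g] p]) (simp add: along_eq[OF g])
    then show ?thesis
      using has_along_D along_eq[OF fin_smooth_partial[OF g] p]
      by (simp add: sum.distrib sum_distrib_left mult.assoc)
  qed
  have "(\<Sum>c\<in>C. \<Sum>e\<in>C. V c p * W e p * partial e (partial c g) p)
      = (\<Sum>c\<in>C. \<Sum>e\<in>C. W c p * V e p * partial e (partial c g) p)"
    by (subst sum.swap)
       (simp add: mult.commute mult.left_commute partial_commute[OF fin_smoothD(1,3)[OF g] p])
  then show ?thesis
    by (simp add: *[OF V W] *[OF W V] sum_subtractf left_diff_distrib)
qed

section \<open>Total derivatives and prolonged fields\<close>

lemma UNIV_dir: "(UNIV :: dir set) = {Dx, Du, Dv}"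
  using dir.exhaust by auto

instance dir :: finite
  by standard (simp add: UNIV_dir)

text \<open>The total derivative as a vector field on infinite jets, so that \<open>bracket\<close>
  applies to it.\<close>

fun total_field :: "dir \<Rightarrow> coord \<Rightarrow> jet \<Rightarrow> real" where
  "total_field d (Base e) p = (if e = d then 1 else 0)"
| "total_field d (Fib \<sigma>) p = p (Fib (bump d \<sigma>))"

lemma total_field_Base: "total_field d (Base e) = (\<lambda>_. if e = d then 1 else 0)"
  and total_field_Fib: "total_field d (Fib \<sigma>) = (\<lambda>p. p (Fib (bump d \<sigma>)))"
  by (rule ext, simp)+

lemma loc_smooth_total_field: "open U \<Longrightarrow> loc_smooth U (total_field d c)"
  by (cases c) (simp_all add: total_field_Base total_field_Fib loc_smooth_const loc_smooth_coord del: total_field.simps)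

lemma finite_jcoords: "finite (jcoords k)"
proof -
  have "jcoords k \<subseteq> range Base \<union> (\<lambda>(i, j, l). Fib (i, j, l)) ` ({..k} \<times> {..k} \<times> {..k})"
  proof
    fix c assume "c \<in> jcoords k"
    then show "c \<in> range Base \<union> (\<lambda>(i, j, l). Fib (i, j, l)) ` ({..k} \<times> {..k} \<times> {..k})"
      by (cases c) (auto simp: jcoords_def image_iff)
  qed
  then show ?thesis by (rule finite_subset) auto
qed

lemma total_deriv_along:
  assumes "loc_smooth U g" "p \<in> U"
  shows "total_deriv d g p = along (\<lambda>c. total_field d c p) g p"
proof -
  obtain C0 where C0: "fin_smooth C0 U g" using assms by (auto simp: loc_smooth_def)
  \<comment> \<open>The base coordinates are adjoined so that the sum contains the term for
    \<open>Base d\<close> even if \<open>g\<close> does not depend on it.\<close>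
  define C where "C = C0 \<union> range Base"
  have C: "fin_smooth C U g" "finite C"
    using fin_smooth_mono[OF C0] fin_smoothD(2)[OF C0] by (auto simp: C_def)
  define S where "S = {\<sigma>. Fib \<sigma> \<in> C}"
  have "finite (Fib ` S)" using C(2) by (rule finite_subset[rotated]) (auto simp: S_def)
  then have S: "finite S" by (rule finite_imageD) (simp add: inj_on_def)
  have CS: "C = range Base \<union> Fib ` S" "range Base \<inter> Fib ` S = {}"
  proof -
    have "c \<in> range Base \<or> c \<in> Fib ` S" if "c \<in> C" for c
      using that by (cases c) (simp_all add: S_def)
    then show "C = range Base \<union> Fib ` S" by (auto simp: C_def S_def)
  qed auto
  have "Sum_any (\<lambda>\<sigma>. p (Fib (bump d \<sigma>)) * partial (Fib \<sigma>) g p)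
      = (\<Sum>\<sigma>\<in>S. p (Fib (bump d \<sigma>)) * partial (Fib \<sigma>) g p)"
  proof (rule Sum_any.expand_superset[OF S])
    show "{\<sigma>. p (Fib (bump d \<sigma>)) * partial (Fib \<sigma>) g p \<noteq> 0} \<subseteq> S"
      using partial_zero[OF fin_smoothD(1,4)[OF C(1)] _ assms(2)] by (force simp: S_def)
  qed
  also have "\<dots> = (\<Sum>c\<in>Fib ` S. total_field d c p * partial c g p)"
    by (subst sum.reindex) (auto simp: inj_on_def)
  finally have 1: "Sum_any (\<lambda>\<sigma>. p (Fib (bump d \<sigma>)) * partial (Fib \<sigma>) g p) = \<dots>" .
  have "(\<Sum>c\<in>range Base. total_field d c p * partial c g p)
      = (\<Sum>e\<in>UNIV. (if e = d then 1 else 0) * partial (Base e) g p)"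
    by (subst sum.reindex) (simp_all add: inj_on_def)
  then have 2: "(\<Sum>c\<in>range Base. total_field d c p * partial c g p) = partial (Base d) g p"
    unfolding UNIV_dir by (cases d) simp_all
  have "along (\<lambda>c. total_field d c p) g p = (\<Sum>c\<in>range Base \<union> Fib ` S. total_field d c p * partial c g p)"
    using along_eq[OF C(1) assms(2)] CS(1) by simp
  also have "\<dots> = partial (Base d) g p + (\<Sum>c\<in>Fib ` S. total_field d c p * partial c g p)"
    using CS(2) S 2 by (subst sum.union_disjoint) auto
  finally show ?thesis by (simp add: total_deriv_def 1)
qed

lemma total_deriv_cong:
  assumes "open U" "p \<in> U" "\<And>q. q \<in> U \<Longrightarrow> g q = h q"
  shows "total_deriv d g p = total_deriv d h p"
  unfolding total_deriv_def using partial_cong[OF assms] by simp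

lemma total_deriv_eqI: "has_along (\<lambda>c. total_field d c p) p g D \<Longrightarrow> total_deriv d g p = D"
  unfolding has_along_def using total_deriv_along by metis

lemma total_deriv_const: "total_deriv d (\<lambda>_. k) p = 0"
  by (rule total_deriv_eqI[OF has_along_const])

definition bumps :: "dir \<Rightarrow> coord set \<Rightarrow> coord set" where
  "bumps d C = C \<union> {Fib (bump d \<sigma>) |\<sigma>. Fib \<sigma> \<in> C}"

lemma finite_bumps: "finite C \<Longrightarrow> finite (bumps d C)"
proof -
  assume C: "finite C"
  have "bumps d C \<subseteq> C \<union> (\<lambda>c. case c of Base e \<Rightarrow> Base e | Fib \<sigma> \<Rightarrow> Fib (bump d \<sigma>)) ` C"
    unfolding bumps_def by force
  then show ?thesis by (rule finite_subset) (use C in auto)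
qed

lemma fin_smooth_total_deriv:
  assumes "fin_smooth C U g"
  shows "fin_smooth (bumps d C) U (total_deriv d g)"
proof -
  note C = fin_smoothD(1,2)[OF assms]
  have sub: "C \<subseteq> bumps d C" by (auto simp: bumps_def)
  have t: "fin_smooth (bumps d C) U (total_field d c)" if "c \<in> C" for c
    using that C finite_bumps[OF C(2)]
  proof (cases c)
    case (Base e)
    then show ?thesis
      unfolding Base total_field_Base using C finite_bumps[OF C(2)] by (simp add: fin_smooth_const)
  next
    case (Fib \<sigma>)
    have "Fib (bump d \<sigma>) \<in> bumps d C" using that unfolding Fib bumps_def by blast
    then show ?thesis
      unfolding Fib total_field_Fib using C finite_bumps[OF C(2)] by (simp add: fin_smooth_coord)
  qed
  have "fin_smooth (bumps d C) U (\<lambda>q. \<Sum>c\<in>C. total_field d c q * partial c g q)"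
    by (intro fin_smooth_sum fin_smooth_mult t
        fin_smooth_mono[OF fin_smooth_partial[OF assms] sub] C finite_bumps)
  then show ?thesis
    by (rule fin_smooth_cong)
       (simp add: total_deriv_along[OF loc_smoothI[OF assms]] along_eq[OF assms])
qed

lemma loc_smooth_total_deriv: "loc_smooth U g \<Longrightarrow> loc_smooth U (total_deriv d g)"
  unfolding loc_smooth_def using fin_smooth_total_deriv by blast

lemma bump_commute: "bump d (bump e \<sigma>) = bump e (bump d \<sigma>)"
  by (cases \<sigma>; cases d; cases e) auto

lemma bump_inject [simp]: "bump d \<sigma> = bump d \<tau> \<longleftrightarrow> \<sigma> = \<tau>"
  by (cases \<sigma>; cases \<tau>; cases d) auto

lemma along_total_field:
  "along (\<lambda>c. total_field d c p) (total_field e c) p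
    = (case c of Base _ \<Rightarrow> 0 | Fib \<sigma> \<Rightarrow> p (Fib (bump d (bump e \<sigma>))))"
  by (cases c) (simp_all add: total_field_Base total_field_Fib[of e])

lemma total_deriv_total_deriv_along:
  assumes "loc_smooth U g" "p \<in> U"
  shows "along w (\<lambda>q. along (\<lambda>c. total_field d c q) g q) p = along w (total_deriv d g) p"
  by (rule along_cong[OF loc_smooth_open[OF assms(1)] assms(2)])
     (simp add: total_deriv_along[OF assms(1)])

text \<open>The component of the bracket at a fibre coordinate is the difference of the two orders
  of bumping its index, which is zero; at a base coordinate both terms are zero.\<close>

lemma total_deriv_commute:
  assumes "loc_smooth U g" "p \<in> U"
  shows "total_deriv d (total_deriv e g) p = total_deriv e (total_deriv d g) p"
proof -
  obtain C where C: "fin_smooth C U g" using assms by (auto simp: loc_smooth_def)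
  have "along (\<lambda>c. total_field d c p) (\<lambda>q. along (\<lambda>c. total_field e c q) g q) p
      - along (\<lambda>c. total_field e c p) (\<lambda>q. along (\<lambda>c. total_field d c q) g q) p = 0"
    using fin_smoothD(1)[OF C]
    by (subst bracket[OF C assms(2)])
       (auto intro!: loc_smooth_total_field sum.neutral simp: along_total_field bump_commute[of e]
         split: coord.splits)
  then show ?thesis
    using assms by (simp add: total_deriv_total_deriv_along total_deriv_along[OF loc_smooth_total_deriv])
qed

text \<open>The bracket of the coordinate field at \<open>bump d \<sigma>\<close> with the total
  derivative is the coordinate field at \<open>\<sigma>\<close>, and one of its two terms vanishes
  since \<open>g\<close> does not involve the bumped coordinate. So a total derivative shifts a
  leading coordinate and keeps its slope.\<close>

lemma partial_total_deriv:
  assumes g: "fin_smooth C U g" and p: "p \<in> U" and e: "Fib (bump d \<sigma>) \<notin> C"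
  shows "partial (Fib (bump d \<sigma>)) (total_deriv d g) p = partial (Fib \<sigma>) g p"
proof -
  let ?e = "Fib (bump d \<sigma>)"
  let ?V = "\<lambda>b p::jet. if b = ?e then 1 else 0 :: real"
  have U: "open U" by (rule fin_smoothD[OF g])
  have z: "along (\<lambda>b. ?V b q) g q = 0" if "q \<in> U" for q
    using partial_zero[OF U fin_smoothD(4)[OF g] e that] by (simp add: partial_along)
  have V0: "along (\<lambda>c. total_field d c p) (?V b) p = 0" for b
    by (rule has_along_D[OF has_along_const])
  have VT: "along (\<lambda>c. ?V c p) (total_field d b) p = (if b = Fib \<sigma> then 1 else 0)" for b
    by (cases b) (simp_all add: total_field_Base total_field_Fib)
  have "along (\<lambda>c. ?V c p) (\<lambda>q. along (\<lambda>c. total_field d c q) g q) p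
      - along (\<lambda>c. total_field d c p) (\<lambda>q. along (\<lambda>c. ?V c q) g q) p
     = (\<Sum>c\<in>C. (if c = Fib \<sigma> then 1 else 0) * partial c g p)"
    by (subst bracket[OF g p])
       (auto intro!: loc_smooth_total_field loc_smooth_const U sum.cong simp: V0 VT)
  also have "along (\<lambda>c. total_field d c p) (\<lambda>q. along (\<lambda>c. ?V c q) g q) p = along (\<lambda>c. total_field d c p) (\<lambda>_. 0) p"
    by (rule along_cong[OF U p z])
  also have "\<dots> = 0" by (rule has_along_D[OF has_along_const])
  also have "along (\<lambda>c. ?V c p) (\<lambda>q. along (\<lambda>c. total_field d c q) g q) p = partial ?e (total_deriv d g) p"
    using total_deriv_total_deriv_along[OF loc_smoothI[OF g] p] by (simp add: partial_along)
  also have "(\<Sum>c\<in>C. (if c = Fib \<sigma> then 1 else 0) * partial c g p) = partial (Fib \<sigma>) g p"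
    using partial_zero[OF U fin_smoothD(4)[OF g] _ p, of "Fib \<sigma>"] fin_smoothD(2)[OF g]
    by (subst sum.cong[OF refl, of _ _ "\<lambda>c. if c = Fib \<sigma> then partial c g p else 0"]) auto
  finally show ?thesis by simp
qed

text \<open>The classical relation [X, D_d] = - sum_e D_d(X_e) D_e over the base components X_e,
  obtained by comparing components of the bracket. On base coordinates it holds for any field; on
  fibre coordinates it is the recursion \<open>rec\<close>.\<close>

lemma prolonged_commutator:
  assumes X: "\<And>c. loc_smooth U (X c)"
    and rec: "\<And>\<sigma>. X (Fib (bump d \<sigma>)) p = total_deriv d (X (Fib \<sigma>)) p
        - (\<Sum>e\<in>{Dx, Du, Dv}. total_deriv d (X (Base e)) p * p (Fib (bump e \<sigma>)))"
    and g: "loc_smooth U g" and p: "p \<in> U"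
  shows "along (\<lambda>c. X c p) (total_deriv d g) p
      = total_deriv d (\<lambda>q. along (\<lambda>c. X c q) g q) p
        - (\<Sum>e\<in>{Dx, Du, Dv}. total_deriv d (X (Base e)) p * total_deriv e g p)"
proof -
  obtain C where C: "fin_smooth C U g" using g by (auto simp: loc_smooth_def)
  have U: "open U" by (rule fin_smoothD[OF C])
  have swap: "(\<Sum>c\<in>C. - (\<Sum>e\<in>E. D e * t e c) * P c) = - (\<Sum>e\<in>E. D e * (\<Sum>c\<in>C. t e c * P c))"
    for E :: "dir set" and D and t :: "dir \<Rightarrow> coord \<Rightarrow> real" and P
    by (simp add: sum_distrib_left sum_distrib_right sum_negf sum.swap[of _ E C] mult.assoc)
  have XT: "along (\<lambda>c. X c p) (total_field d b) p - total_deriv d (X b) p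
      = - (\<Sum>e\<in>{Dx, Du, Dv}. total_deriv d (X (Base e)) p * total_field e b p)" for b
  proof (cases b)
    case (Base x1)
    then show ?thesis by (cases x1) (simp_all add: total_field_Base)
  next
    case (Fib \<tau>)
    then show ?thesis using rec[of \<tau>] by (simp add: total_field_Fib)
  qed
  have Xg: "loc_smooth U (\<lambda>q. along (\<lambda>c. X c q) g q)"
    by (rule loc_smooth_cong[of _ "\<lambda>q. \<Sum>c\<in>C. X c q * partial c g q"])
       (auto intro!: loc_smooth_sum loc_smooth_mult X loc_smooth_partial g U simp: along_eq[OF C])
  have "along (\<lambda>c. X c p) (total_deriv d g) p - total_deriv d (\<lambda>q. along (\<lambda>c. X c q) g q) p
     = along (\<lambda>c. X c p) (\<lambda>q. along (\<lambda>c. total_field d c q) g q) p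
      - along (\<lambda>c. total_field d c p) (\<lambda>q. along (\<lambda>c. X c q) g q) p"
    by (simp add: total_deriv_total_deriv_along[OF g p] total_deriv_along[OF Xg p])
  also have "\<dots> = (\<Sum>c\<in>C. (along (\<lambda>c. X c p) (total_field d c) p - along (\<lambda>c. total_field d c p) (X c) p) * partial c g p)"
    by (rule bracket[OF C p]) (auto intro!: X loc_smooth_total_field U)
  also have "\<dots> = (\<Sum>c\<in>C. - (\<Sum>e\<in>{Dx, Du, Dv}. total_deriv d (X (Base e)) p * total_field e c p) * partial c g p)"
    using XT by (simp add: total_deriv_along[OF X p])
  also have "\<dots> = - (\<Sum>e\<in>{Dx, Du, Dv}. total_deriv d (X (Base e)) p * total_deriv e g p)"
    unfolding total_deriv_along[OF g p] along_eq[OF C p] by (rule swap)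
  finally show ?thesis by simp
qed

section \<open>Feedback fields in low order\<close>

abbreviation "c_x0 \<equiv> Base Dx"
abbreviation "c_u0 \<equiv> Base Du"
abbreviation "c_v0 \<equiv> Base Dv"
abbreviation "c_f \<equiv> Fib (0, 0, 0)"
abbreviation "c_fx \<equiv> Fib (Suc 0, 0, 0)"
abbreviation "c_fu \<equiv> Fib (0, Suc 0, 0)"
abbreviation "c_fv \<equiv> Fib (0, 0, Suc 0)"
abbreviation "c_fxv \<equiv> Fib (Suc 0, 0, Suc 0)"
abbreviation "c_fuv \<equiv> Fib (0, Suc 0, Suc 0)"
abbreviation "c_fvv \<equiv> Fib (0, 0, Suc (Suc 0))"

section \<open>From the characteristic to the recursion for prolonged coefficients\<close>

lemma total_deriv_commute_UNIV:
  "loc_smooth UNIV g \<Longrightarrow> total_deriv d (total_deriv e g) = total_deriv e (total_deriv d g)"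
  by (rule ext) (rule total_deriv_commute[of UNIV], auto)

lemma loc_smooth_funpow:
  "loc_smooth U g \<Longrightarrow> loc_smooth U ((total_deriv d ^^ n) g)"
  by (induction n) (auto intro: loc_smooth_total_deriv)

lemma loc_smooth_total_derivs: "loc_smooth U g \<Longrightarrow> loc_smooth U (total_derivs \<sigma> g)"
  by (cases \<sigma>) (auto intro!: loc_smooth_funpow)

lemma total_deriv_funpow_commute:
  "loc_smooth UNIV g \<Longrightarrow>
    total_deriv d ((total_deriv e ^^ n) g) = (total_deriv e ^^ n) (total_deriv d g)"
  by (induction n) (auto simp: total_deriv_commute_UNIV[OF loc_smooth_funpow, of _ d e])

text \<open>\<open>total_derivs\<close> applies the directions in a fixed order, so the additional
  derivative has to be moved inside past the other iterates.\<close>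

lemma total_derivs_bump:
  assumes "loc_smooth UNIV g"
  shows "total_derivs (bump d \<sigma>) g = total_deriv d (total_derivs \<sigma> g)"
  using assms
  by (cases \<sigma>; cases d)
     (simp_all add: total_deriv_funpow_commute loc_smooth_funpow loc_smooth_total_deriv)

lemma loc_smooth_lift:
  assumes "smooth_feedback a b"
  shows "fin_smooth {c_x0} UNIV (lift_a a)" "fin_smooth {c_x0, c_u0} UNIV (lift_b b)"
  using assms
  by (auto simp: smooth_feedback_def fin_smooth_def smooth_on_iff_Ck depends_only_def
      lift_a_def lift_b_def)

lemma has_along_finI:
  "fin_smooth C UNIV g \<Longrightarrow> (\<Sum>c\<in>C. w c * partial c g p) = D \<Longrightarrow> has_along w p g D"
  using has_along_I[OF loc_smoothI, of C UNIV g p w] by (simp add: along_eq)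

lemma has_along_total_deriv:
  "loc_smooth UNIV g \<Longrightarrow> has_along (\<lambda>c. total_field d c p) p g (total_deriv d g p)"
  using has_along_I[of UNIV g p] by (simp add: total_deriv_along)

locale feedback =
  fixes a :: "real \<Rightarrow> real" and b :: "real \<Rightarrow> real \<Rightarrow> real"
  assumes smooth: "smooth_feedback a b"
begin

abbreviation X :: "coord \<Rightarrow> jet \<Rightarrow> real" where "X \<equiv> feedback_field a b"

definition "ax = partial c_x0 (lift_a a)"
definition "axx = partial c_x0 ax"
definition "bx = partial c_x0 (lift_b b)"
definition "bu = partial c_u0 (lift_b b)"
definition "bxx = partial c_x0 bx"
definition "bxu = partial c_x0 bu"
definition "buu = partial c_u0 bu"

lemma fin_smooth_base:
  "fin_smooth {c_x0} UNIV (lift_a a)" "fin_smooth {c_x0} UNIV ax" "fin_smooth {c_x0} UNIV axx"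
  "fin_smooth {c_x0, c_u0} UNIV (lift_b b)" "fin_smooth {c_x0, c_u0} UNIV bx"
  "fin_smooth {c_x0, c_u0} UNIV bu"
  unfolding ax_def axx_def bx_def bu_def
  by (intro fin_smooth_partial loc_smooth_lift[OF smooth])+

lemmas loc_smooth_base = fin_smooth_base[THEN loc_smoothI]

lemma has_along_base:
  "has_along w p (lift_a a) (w c_x0 * ax p)"
  "has_along w p ax (w c_x0 * axx p)"
  "has_along w p (lift_b b) (w c_x0 * bx p + w c_u0 * bu p)"
  "has_along w p bx (w c_x0 * bxx p + w c_u0 * bxu p)"
  "has_along w p bu (w c_x0 * bxu p + w c_u0 * buu p)"
proof -
  \<comment> \<open>By symmetry one name serves both mixed second derivatives of \<open>b\<close>;
    otherwise the identities below would not close algebraically.\<close>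
  have c: "partial c_u0 bx p = bxu p"
    unfolding bxu_def bx_def bu_def
    using partial_commute[OF fin_smoothD(1,3)[OF fin_smooth_base(4)]] by simp
  show "has_along w p (lift_a a) (w c_x0 * ax p)"
    "has_along w p ax (w c_x0 * axx p)"
    "has_along w p (lift_b b) (w c_x0 * bx p + w c_u0 * bu p)"
    "has_along w p bx (w c_x0 * bxx p + w c_u0 * bxu p)"
    "has_along w p bu (w c_x0 * bxu p + w c_u0 * buu p)"
    by (rule has_along_finI[OF fin_smooth_base(1)] has_along_finI[OF fin_smooth_base(2)]
          has_along_finI[OF fin_smooth_base(4)] has_along_finI[OF fin_smooth_base(5)]
          has_along_finI[OF fin_smooth_base(6)],
        simp add: c ax_def[symmetric] axx_def bx_def[symmetric] bu_def[symmetric]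
          bxx_def bxu_def[symmetric] buu_def)+
qed

lemma X_base:
  "X c_x0 = lift_a a" "X c_u0 = lift_b b" "X c_v0 = (\<lambda>p. p c_v0 * bu p + p c_f * bx p)"
  by (rule ext, simp add: feedback_field_def bu_def bx_def)+

lemma X_f: "X c_f = (\<lambda>p. ax p * p c_f)"
  by (rule ext)
     (simp add: feedback_field_def characteristic_def feedback_vertical_def ax_def)

lemma loc_smooth_X_base: "loc_smooth UNIV (X (Base d))"
  by (cases d) (auto simp: X_base intro!: loc_smooth_intros loc_smooth_base)

lemma loc_smooth_characteristic:
  "loc_smooth UNIV (characteristic (feedback_base a b) (feedback_vertical a))"
proof -
  have b: "feedback_base a b d = X (Base d)" for d
    by (rule ext) (simp add: feedback_field_def)
  have v: "feedback_vertical a = (\<lambda>p. ax p * p c_f)"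
    by (rule ext) (simp add: feedback_vertical_def ax_def)
  have "characteristic (feedback_base a b) (feedback_vertical a) =
    (\<lambda>p. ax p * p c_f - (\<Sum>d\<in>{Dx, Du, Dv}. X (Base d) p * p (Fib (bump d (0, 0, 0)))))"
    unfolding characteristic_def b v by (rule refl)
  then show ?thesis
    by (auto intro!: loc_smooth_intros loc_smooth_base loc_smooth_X_base loc_smooth_sum
        simp del: sum.insert)
qed

lemma X_Fib:
  "X (Fib \<sigma>) = (\<lambda>p. total_derivs \<sigma> (characteristic (feedback_base a b) (feedback_vertical a)) p
     + (\<Sum>d\<in>{Dx, Du, Dv}. X (Base d) p * p (Fib (bump d \<sigma>))))"
  by (rule ext) (simp add: feedback_field_def)

lemma loc_smooth_X: "loc_smooth UNIV (X c)"
proof (cases c)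
  case (Fib \<sigma>)
  show ?thesis
    unfolding Fib X_Fib
    by (intro loc_smooth_add loc_smooth_total_derivs loc_smooth_characteristic loc_smooth_sum
        loc_smooth_mult loc_smooth_X_base loc_smooth_coord open_UNIV)
qed (simp add: loc_smooth_X_base)

text \<open>Applying D_d to the characteristic form of the coefficient at \<open>\<sigma>\<close>
  gives the coefficient at \<open>bump d \<sigma>\<close> plus the terms in which D_d hits the base
  components; these are subtracted.\<close>

lemma X_bump:
  "X (Fib (bump d \<sigma>)) p = total_deriv d (X (Fib \<sigma>)) p
     - (\<Sum>e\<in>{Dx, Du, Dv}. total_deriv d (X (Base e)) p * p (Fib (bump e \<sigma>)))"
proof -
  let ?Q = "characteristic (feedback_base a b) (feedback_vertical a)"
  have "has_along (\<lambda>c. total_field d c p) p (X (Fib \<sigma>))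
     (total_deriv d (total_derivs \<sigma> ?Q) p
       + (\<Sum>e\<in>{Dx, Du, Dv}. total_deriv d (X (Base e)) p * p (Fib (bump e \<sigma>))
           + X (Base e) p * p (Fib (bump d (bump e \<sigma>)))))"
    unfolding X_Fib
    by (intro has_along_add has_along_sum has_along_mult
        has_along_total_deriv has_along_eq[OF has_along_coord] loc_smooth_total_derivs
        loc_smooth_characteristic loc_smooth_X_base) simp
  from total_deriv_eqI[OF this] show ?thesis
    unfolding X_Fib
    by (simp add: total_derivs_bump[OF loc_smooth_characteristic] bump_commute[of d] X_Fib)
qed

lemma total_deriv_X_base:
  "total_deriv Dx (X c_x0) p = ax p"
  "total_deriv Du (X c_x0) p = 0"
  "total_deriv Dv (X c_x0) p = 0"
  "total_deriv Dx (X c_u0) p = bx p"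
  "total_deriv Du (X c_u0) p = bu p"
  "total_deriv Dv (X c_u0) p = 0"
  "total_deriv Dx (X c_v0) p = p c_v0 * bxu p + p c_fx * bx p + p c_f * bxx p"
  "total_deriv Du (X c_v0) p = p c_v0 * buu p + p c_fu * bx p + p c_f * bxu p"
  "total_deriv Dv (X c_v0) p = bu p + p c_fv * bx p"
  unfolding X_base
  by (rule total_deriv_eqI, rule has_along_eq, (rule has_along_intros has_along_base)+, simp)+

section \<open>Coefficients at the jets that occur in J and in the invariant derivations\<close>

lemma X_fx: "X c_fx = (\<lambda>p. axx p * p c_f - bx p * p c_fu
    - (p c_v0 * bxu p + p c_fx * bx p + p c_f * bxx p) * p c_fv)"
proof
  fix p
  have "total_deriv Dx (X c_f) p = axx p * p c_f + ax p * p c_fx"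
    unfolding X_f
    by (rule total_deriv_eqI, rule has_along_eq, (rule has_along_intros has_along_base)+, simp)
  then show "X c_fx p = axx p * p c_f - bx p * p c_fu
    - (p c_v0 * bxu p + p c_fx * bx p + p c_f * bxx p) * p c_fv"
    using X_bump[of Dx "(0, 0, 0)" p] by (simp add: total_deriv_X_base)
qed

lemma X_fu: "X c_fu = (\<lambda>p. ax p * p c_fu - bu p * p c_fu
    - (p c_v0 * buu p + p c_fu * bx p + p c_f * bxu p) * p c_fv)"
proof
  fix p
  have "total_deriv Du (X c_f) p = ax p * p c_fu"
    unfolding X_f
    by (rule total_deriv_eqI, rule has_along_eq, (rule has_along_intros has_along_base)+, simp)
  then show "X c_fu p = ax p * p c_fu - bu p * p c_fu
    - (p c_v0 * buu p + p c_fu * bx p + p c_f * bxu p) * p c_fv"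
    using X_bump[of Du "(0, 0, 0)" p] by (simp add: total_deriv_X_base)
qed

lemma X_fv: "X c_fv = (\<lambda>p. ax p * p c_fv - (bu p + p c_fv * bx p) * p c_fv)"
proof
  fix p
  have "total_deriv Dv (X c_f) p = ax p * p c_fv"
    unfolding X_f
    by (rule total_deriv_eqI, rule has_along_eq, (rule has_along_intros has_along_base)+, simp)
  then show "X c_fv p = ax p * p c_fv - (bu p + p c_fv * bx p) * p c_fv"
    using X_bump[of Dv "(0, 0, 0)" p] by (simp add: total_deriv_X_base)
qed

lemma X_fxv: "X c_fxv = (\<lambda>p. axx p * p c_fv - bxu p * p c_fv - bu p * p c_fxv
    - bxx p * (p c_fv)\<^sup>2 - 2 * bx p * p c_fv * p c_fxv - bx p * p c_fuv
    - (p c_v0 * bxu p + p c_fx * bx p + p c_f * bxx p) * p c_fvv)"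
proof
  fix p
  have "total_deriv Dx (X c_fv) p = axx p * p c_fv + ax p * p c_fxv - bxu p * p c_fv
     - bu p * p c_fxv - bxx p * (p c_fv)\<^sup>2 - 2 * bx p * p c_fv * p c_fxv"
    unfolding X_fv
    by (rule total_deriv_eqI, rule has_along_eq, (rule has_along_intros has_along_base)+,
        simp add: algebra_simps power2_eq_square)
  then show "X c_fxv p = axx p * p c_fv - bxu p * p c_fv - bu p * p c_fxv
    - bxx p * (p c_fv)\<^sup>2 - 2 * bx p * p c_fv * p c_fxv - bx p * p c_fuv
    - (p c_v0 * bxu p + p c_fx * bx p + p c_f * bxx p) * p c_fvv"
    using X_bump[of Dx "(0, 0, Suc 0)" p] by (simp add: total_deriv_X_base)
qed

lemma X_fuv: "X c_fuv = (\<lambda>p. ax p * p c_fuv - buu p * p c_fv - 2 * bu p * p c_fuv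
    - bxu p * (p c_fv)\<^sup>2 - 2 * bx p * p c_fv * p c_fuv
    - (p c_v0 * buu p + p c_fu * bx p + p c_f * bxu p) * p c_fvv)"
proof
  fix p
  have "total_deriv Du (X c_fv) p = ax p * p c_fuv - buu p * p c_fv
     - bu p * p c_fuv - bxu p * (p c_fv)\<^sup>2 - 2 * bx p * p c_fv * p c_fuv"
    unfolding X_fv
    by (rule total_deriv_eqI, rule has_along_eq, (rule has_along_intros has_along_base)+,
        simp add: algebra_simps power2_eq_square)
  then show "X c_fuv p = ax p * p c_fuv - buu p * p c_fv - 2 * bu p * p c_fuv
    - bxu p * (p c_fv)\<^sup>2 - 2 * bx p * p c_fv * p c_fuv
    - (p c_v0 * buu p + p c_fu * bx p + p c_f * bxu p) * p c_fvv"
    using X_bump[of Du "(0, 0, Suc 0)" p] by (simp add: total_deriv_X_base)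
qed

lemma X_fvv: "X c_fvv = (\<lambda>p. (ax p - 2 * bu p - 3 * bx p * p c_fv) * p c_fvv)"
proof
  fix p
  have "total_deriv Dv (X c_fv) p = (ax p - bu p - 2 * bx p * p c_fv) * p c_fvv"
    unfolding X_fv
    by (rule total_deriv_eqI, rule has_along_eq, (rule has_along_intros has_along_base)+,
        simp add: algebra_simps power2_eq_square)
  then show "X c_fvv p = (ax p - 2 * bu p - 3 * bx p * p c_fv) * p c_fvv"
    using X_bump[of Dv "(0, 0, Suc 0)" p] by (simp add: total_deriv_X_base algebra_simps)
qed

lemmas X_low = X_base X_f X_fx X_fu X_fv X_fxv X_fuv X_fvv

end

section \<open>The regular domain\<close>

definition reg_dom :: "jet set" where
  "reg_dom = {p. regular p \<and> J_denom p \<noteq> 0}"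

lemma reg_dom_D:
  assumes "p \<in> reg_dom"
  shows "p c_f \<noteq> 0" "p c_fv \<noteq> 0" "p c_fvv \<noteq> 0" "p c_v0 * p c_fv - p c_f \<noteq> 0"
  using assms by (simp_all add: reg_dom_def regular_def J_denom_def numeral_2_eq_2)

lemma mem_reg_dom:
  "p \<in> reg_dom \<longleftrightarrow> p c_f \<noteq> 0 \<and> p c_fv \<noteq> 0 \<and> p c_fvv \<noteq> 0 \<and> p c_v0 * p c_fv - p c_f \<noteq> 0"
  by (auto simp add: reg_dom_def regular_def J_denom_def numeral_2_eq_2)

lemma open_reg_dom: "open reg_dom"
proof -
  have "reg_dom = {p. p c_f \<noteq> 0} \<inter> ({p. p c_fv \<noteq> 0} \<inter> ({p. p c_fvv \<noteq> 0} \<inter>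
      {p. p c_v0 * p c_fv - p c_f \<noteq> 0}))"
    by (auto simp: mem_reg_dom)
  also have "open \<dots>"
    by (intro open_Int open_Collect_neq continuous_intros continuous_on_coord)
  finally show ?thesis .
qed

text \<open>With an antiderivative \<open>C\<close> of \<open>c\<close>, the integrating factor
  makes y * exp (- C) constant.\<close>

lemma linear_ode_nonzero:
  fixes y c :: "real \<Rightarrow> real"
  assumes c: "continuous_on {0..1} c"
    and y: "\<And>t. t \<in> {0..1} \<Longrightarrow> (y has_real_derivative c t * y t) (at t within {0..1})"
    and "y 0 \<noteq> 0"
  shows "y 1 \<noteq> 0"
proof -
  define C where "C t = integral {0..t} c" for t
  have C: "(C has_real_derivative c t) (at t within {0..1})" if "t \<in> {0..1}" for t
    unfolding C_def by (rule integral_has_real_derivative[OF c that])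
  have "((\<lambda>t. y t * exp (- C t)) has_real_derivative 0) (at t within {0..1})" if "t \<in> {0..1}" for t
    by (rule derivative_eq_intros y C that refl | simp)+
  then obtain k where k: "\<And>t. t \<in> {0..1} \<Longrightarrow> y t * exp (- C t) = k"
    using has_field_derivative_zero_constant[of "{0..1}" "\<lambda>t. y t * exp (- C t)"] by auto
  from k[of 0] k[of 1] assms(3) show ?thesis by auto
qed

text \<open>f, f_v, f_vv and v f_v - f are relative invariants: a feedback field multiplies each by
  a factor built from a_x, b_u, b_x and f_v. Along an integral curve each solves a homogeneous
  linear equation and never reaches zero. The bound on \<open>k\<close> puts f_vv among the
  constrained coordinates.\<close>

lemma (in feedback) integral_curve_reg_dom:
  fixes \<gamma> :: "real \<Rightarrow> jet"
  assumes "k \<ge> 2" "\<gamma> 0 \<in> reg_dom"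
    and \<gamma>: "\<And>t c. t \<in> {0..1} \<Longrightarrow> c \<in> jcoords k \<Longrightarrow>
      ((\<lambda>s. \<gamma> s c) has_real_derivative X c (\<gamma> t)) (at t within {0..1})"
  shows "\<gamma> 1 \<in> reg_dom"
proof -
  have jc: "c_x0 \<in> jcoords k" "c_u0 \<in> jcoords k" "c_v0 \<in> jcoords k" "c_f \<in> jcoords k"
    "c_fv \<in> jcoords k" "c_fvv \<in> jcoords k"
    using assms(1) by (auto simp: jcoords_def)
  \<comment> \<open>Coordinates of order above \<open>k\<close> are unconstrained along the curve
    and may jump. Setting them to zero yields a curve continuous in the product topology, on which
    the derivatives of \<open>a\<close> and \<open>b\<close> take the same values.\<close>
  define \<delta> where "\<delta> t = (\<lambda>c. if c \<in> jcoords k then \<gamma> t c else 0)" for t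
  have cc: "continuous_on {0..1} (\<lambda>t. \<gamma> t c)" if "c \<in> jcoords k" for c
    by (rule DERIV_continuous_on[of _ _ "\<lambda>t. X c (\<gamma> t)"]) (rule \<gamma>[OF _ that])
  then have "continuous_on {0..1} (\<lambda>t. \<delta> t c)" for c
    by (cases "c \<in> jcoords k") (simp_all add: \<delta>_def)
  then have \<delta>: "continuous_on {0..1} \<delta>" by (rule continuous_on_coordinatewise_then_product)
  have base: "continuous_on {0..1} (\<lambda>t. g (\<gamma> t))" if g: "fin_smooth {c_x0, c_u0} UNIV g" for g
  proof -
    have "g (\<gamma> t) = g (\<delta> t)" for t
      by (rule depends_onlyD[OF fin_smoothD(4)[OF g]]) (auto simp: \<delta>_def jc)
    moreover have "continuous_on {0..1} (\<lambda>t. g (\<delta> t))"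
      by (rule continuous_on_compose2[OF fin_smoothD(5)[OF g] \<delta>]) auto
    ultimately show ?thesis by simp
  qed
  have ab: "continuous_on {0..1} (\<lambda>t. ax (\<gamma> t))" "continuous_on {0..1} (\<lambda>t. bx (\<gamma> t))"
    "continuous_on {0..1} (\<lambda>t. bu (\<gamma> t))"
    by (rule base, rule fin_smooth_mono[OF fin_smooth_base(2)], simp, simp)
       (rule base fin_smooth_base)+
  note D = \<gamma>[OF _ jc(3)] \<gamma>[OF _ jc(4)] \<gamma>[OF _ jc(5)] \<gamma>[OF _ jc(6)]
  note n = reg_dom_D[OF assms(2)]
  have "\<gamma> 1 c_f \<noteq> 0"
    by (rule linear_ode_nonzero[of "\<lambda>t. ax (\<gamma> t)"])
       (use n ab D in \<open>simp_all add: X_low\<close>)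
  moreover have "\<gamma> 1 c_fv \<noteq> 0"
  proof (rule linear_ode_nonzero[of "\<lambda>t. ax (\<gamma> t) - (bu (\<gamma> t) + \<gamma> t c_fv * bx (\<gamma> t))"])
    show "continuous_on {0..1} (\<lambda>t. ax (\<gamma> t) - (bu (\<gamma> t) + \<gamma> t c_fv * bx (\<gamma> t)))"
      by (intro continuous_intros ab cc jc)
  qed (use n D in \<open>simp_all add: X_low algebra_simps\<close>)
  moreover have "\<gamma> 1 c_fvv \<noteq> 0"
  proof (rule linear_ode_nonzero[of "\<lambda>t. ax (\<gamma> t) - 2 * bu (\<gamma> t) - 3 * bx (\<gamma> t) * \<gamma> t c_fv"])
    show "continuous_on {0..1} (\<lambda>t. ax (\<gamma> t) - 2 * bu (\<gamma> t) - 3 * bx (\<gamma> t) * \<gamma> t c_fv)"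
      by (intro continuous_intros ab cc jc)
  qed (use n D in \<open>simp_all add: X_low\<close>)
  moreover have "\<gamma> 1 c_v0 * \<gamma> 1 c_fv - \<gamma> 1 c_f \<noteq> 0"
  proof (rule linear_ode_nonzero[of "\<lambda>t. ax (\<gamma> t) - \<gamma> t c_fv * bx (\<gamma> t)"
        "\<lambda>t. \<gamma> t c_v0 * \<gamma> t c_fv - \<gamma> t c_f"])
    show "continuous_on {0..1} (\<lambda>t. ax (\<gamma> t) - \<gamma> t c_fv * bx (\<gamma> t))"
      by (intro continuous_intros ab cc jc)
    show "((\<lambda>t. \<gamma> t c_v0 * \<gamma> t c_fv - \<gamma> t c_f) has_real_derivative
        (ax (\<gamma> t) - \<gamma> t c_fv * bx (\<gamma> t)) * (\<gamma> t c_v0 * \<gamma> t c_fv - \<gamma> t c_f)) (at t within {0..1})"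
      if "t \<in> {0..1}" for t
      by (rule DERIV_cong[OF DERIV_diff[OF DERIV_mult[OF D(1,3)] D(2)]])
         (use that in \<open>simp_all add: X_low algebra_simps\<close>)
  qed (use n in simp)
  ultimately show ?thesis by (simp add: mem_reg_dom)
qed

lemma regular_orbit_subset:
  assumes "regular_orbit k S"
  shows "S \<subseteq> reg_dom"
proof -
  obtain p where p: "k \<ge> 2" "p \<in> reg_dom" "S = feedback_orbit k p"
    using assms by (auto simp: regular_orbit_def reg_dom_def)
  have "q \<in> reg_dom" if "(feedback_step k)\<^sup>*\<^sup>* p q" for q
    using that
  proof (induction rule: rtranclp_induct)
    case (step y z)
    then obtain a b \<gamma> where \<gamma>: "smooth_feedback a b" "\<gamma> 0 = y" "\<gamma> 1 = z"
      "\<forall>t\<in>{0..1}. \<forall>c\<in>jcoords k.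
           ((\<lambda>s. \<gamma> s c) has_real_derivative feedback_field a b c (\<gamma> t)) (at t within {0..1})"
      by (auto simp: feedback_step_def)
    interpret feedback a b by unfold_locales (rule \<gamma>)
    show ?case
      using integral_curve_reg_dom[OF p(1), of \<gamma>] \<gamma> step by auto
  qed (rule p)
  then show ?thesis by (auto simp: p(3) feedback_orbit_def)
qed

section \<open>Invariant derivations\<close>

fun nabla_coeff :: "der \<Rightarrow> dir \<Rightarrow> jet \<Rightarrow> real" where
  "nabla_coeff Nabla1 Dx p = 0"
| "nabla_coeff Nabla1 Du p = (p c_v0 * p c_fv - p c_f) / p c_fv"
| "nabla_coeff Nabla1 Dv p = (p c_f - p c_v0 * p c_fv) / (p c_fv)\<^sup>2 * p c_fu"
| "nabla_coeff Nabla2 Dx p = 0"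
| "nabla_coeff Nabla2 Du p = 0"
| "nabla_coeff Nabla2 Dv p = p c_f / p c_fv"
| "nabla_coeff Nabla3 Dx p = p c_f"
| "nabla_coeff Nabla3 Du p = p c_f / p c_fv"
| "nabla_coeff Nabla3 Dv p = (p c_fx * p c_fv + p c_fu - p c_v0 * p c_fuv - p c_f * p c_fxv) / p c_fvv
     + (p c_v0 * p c_fv - p c_f) / (p c_fv)\<^sup>2 * p c_fu"

lemma nabla_coeff_fun:
  "nabla_coeff Nabla1 Dx = (\<lambda>p. 0)"
  "nabla_coeff Nabla1 Du = (\<lambda>p. (p c_v0 * p c_fv - p c_f) / p c_fv)"
  "nabla_coeff Nabla1 Dv = (\<lambda>p. (p c_f - p c_v0 * p c_fv) / (p c_fv)\<^sup>2 * p c_fu)"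
  "nabla_coeff Nabla2 Dx = (\<lambda>p. 0)"
  "nabla_coeff Nabla2 Du = (\<lambda>p. 0)"
  "nabla_coeff Nabla2 Dv = (\<lambda>p. p c_f / p c_fv)"
  "nabla_coeff Nabla3 Dx = (\<lambda>p. p c_f)"
  "nabla_coeff Nabla3 Du = (\<lambda>p. p c_f / p c_fv)"
  "nabla_coeff Nabla3 Dv = (\<lambda>p. (p c_fx * p c_fv + p c_fu - p c_v0 * p c_fuv - p c_f * p c_fxv) / p c_fvv
     + (p c_v0 * p c_fv - p c_f) / (p c_fv)\<^sup>2 * p c_fu)"
  by (rule ext, simp)+

lemma nabla_eq:
  "nabla i g p = nabla_coeff i Dx p * total_deriv Dx g p + nabla_coeff i Du p * total_deriv Du g p
     + nabla_coeff i Dv p * total_deriv Dv g p"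
  by (cases i) (simp_all add: Let_def numeral_2_eq_2)

declare nabla.simps [simp del]

lemma nabla_eq_sum: "nabla i g = (\<lambda>p. \<Sum>d\<in>{Dx, Du, Dv}. nabla_coeff i d p * total_deriv d g p)"
  by (rule ext) (simp add: nabla_eq)

definition nabla_coeff_coords :: "coord set" where
  "nabla_coeff_coords = {c_x0, c_u0, c_v0, c_f, c_fx, c_fu, c_fv, c_fxv, c_fuv, c_fvv}"

lemma fin_smooth_nabla_coeff: "fin_smooth nabla_coeff_coords reg_dom (nabla_coeff i d)"
  by (cases i; cases d)
     (auto simp: nabla_coeff_fun nabla_coeff_coords_def open_reg_dom dest: reg_dom_D intro!: fin_smooth_intros)

lemma loc_smooth_nabla_coeff: "U \<subseteq> reg_dom \<Longrightarrow> open U \<Longrightarrow> loc_smooth U (nabla_coeff i d)"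
  using fin_smooth_nabla_coeff loc_smoothI loc_smooth_subset by blast

lemma loc_smooth_nabla: "loc_smooth U g \<Longrightarrow> U \<subseteq> reg_dom \<Longrightarrow> loc_smooth U (nabla i g)"
  unfolding nabla_eq_sum
  by (intro loc_smooth_sum loc_smooth_mult loc_smooth_total_deriv loc_smooth_nabla_coeff)
     (auto dest: loc_smooth_open)

lemma nabla_cong:
  "open U \<Longrightarrow> p \<in> U \<Longrightarrow> (\<And>q. q \<in> U \<Longrightarrow> g q = h q) \<Longrightarrow> nabla i g p = nabla i h p"
  unfolding nabla_eq by (simp add: total_deriv_cong[of U p g h])

definition nabla_field :: "der \<Rightarrow> jet \<Rightarrow> coord \<Rightarrow> real" where
  "nabla_field i p c = (\<Sum>d\<in>{Dx, Du, Dv}. nabla_coeff i d p * total_field d c p)"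

lemma nabla_along:
  assumes "loc_smooth U g" "p \<in> U"
  shows "nabla i g p = along (nabla_field i p) g p"
proof -
  obtain C where C: "fin_smooth C U g" using assms by (auto simp: loc_smooth_def)
  show ?thesis
    by (simp add: nabla_eq total_deriv_along[OF assms] along_eq[OF C assms(2)] nabla_field_def
        sum_distrib_left sum.distrib distrib_right mult.assoc)
qed

lemma nabla_eqI: "has_along (nabla_field i p) p g D \<Longrightarrow> nabla i g p = D"
  unfolding has_along_def using nabla_along by metis

lemma nabla_const: "nabla i (\<lambda>_. k) p = 0"
  by (rule nabla_eqI[OF has_along_const])

lemma has_along_nabla:
  "loc_smooth U g \<Longrightarrow> p \<in> U \<Longrightarrow> has_along (nabla_field i p) p g (nabla i g p)"
  using has_along_I nabla_along by metis

text \<open>Nine identities, one for each derivation and direction, checked by computation. They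
  state that the coefficients transform so as to cancel the correction term of
  \<open>prolonged_commutator\<close>.\<close>

lemma (in feedback) X_nabla_coeff:
  assumes "p \<in> reg_dom"
  shows "along (\<lambda>c. X c p) (nabla_coeff i e) p
    = nabla_coeff i Dx p * total_deriv Dx (X (Base e)) p + nabla_coeff i Du p * total_deriv Du (X (Base e)) p
     + nabla_coeff i Dv p * total_deriv Dv (X (Base e)) p"
proof -
  note n = reg_dom_D(1-3)[OF assms]
  show ?thesis
    by (cases i; cases e; simp only: nabla_coeff_fun;
        rule has_along_D, rule has_along_eq,
        (rule has_along_intros | simp only: n not_False_eq_True power_not_zero)+;
        simp add: X_low total_deriv_X_base[unfolded X_base] n del: has_along_const)
       (simp_all add: n field_simps power2_eq_square power4_eq_xxxx)
qed


lemma (in feedback) loc_smooth_X_along: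
  assumes "loc_smooth U g"
  shows "loc_smooth U (\<lambda>q. along (\<lambda>c. X c q) g q)"
proof -
  obtain C where C: "fin_smooth C U g" using assms by (auto simp: loc_smooth_def)
  have U: "open U" by (rule fin_smoothD[OF C])
  show ?thesis
    by (rule loc_smooth_cong[of _ "\<lambda>q. \<Sum>c\<in>C. X c q * partial c g q"])
       (auto intro!: loc_smooth_sum loc_smooth_mult loc_smooth_subset[OF loc_smooth_X]
         loc_smooth_partial assms U simp: along_eq[OF C])
qed

text \<open>By the product rule the commutator of the field with the derivation is the sum of
  X(coefficient) D_e and the corrections from \<open>prolonged_commutator\<close>, which cancel by
  \<open>X_nabla_coeff\<close>.\<close>

lemma (in feedback) X_nabla:
  assumes g: "loc_smooth U g" and U: "U \<subseteq> reg_dom" and p: "p \<in> U"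
  shows "along (\<lambda>c. X c p) (nabla i g) p = nabla i (\<lambda>q. along (\<lambda>c. X c q) g q) p"
proof -
  have "has_along (\<lambda>c. X c p) p (nabla i g)
     (\<Sum>d\<in>{Dx, Du, Dv}. along (\<lambda>c. X c p) (nabla_coeff i d) p * total_deriv d g p
        + nabla_coeff i d p * along (\<lambda>c. X c p) (total_deriv d g) p)"
    unfolding nabla_eq_sum
    by (intro has_along_sum has_along_mult has_along_I[OF loc_smooth_nabla_coeff[OF U loc_smooth_open[OF g]] p]
        has_along_I[OF loc_smooth_total_deriv[OF g] p])
  moreover have "loc_smooth U (X c)" for c
    by (rule loc_smooth_subset[OF loc_smooth_X _ loc_smooth_open[OF g]]) simp
  ultimately show ?thesis
    using p U X_bump[of _ _ p]
    by (simp add: has_along_D X_nabla_coeff[of p] subsetD[OF U] nabla_eq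
        prolonged_commutator[OF _ _ g p, of X] algebra_simps)
qed

section \<open>Commutators of the derivations; invariance of J and K\<close>

lemma nabla_nabla:
  assumes g: "loc_smooth U g" and U: "U \<subseteq> reg_dom" and p: "p \<in> U"
  shows "nabla i (nabla j g) p = (\<Sum>d\<in>{Dx, Du, Dv}. nabla i (nabla_coeff j d) p * total_deriv d g p
        + nabla_coeff j d p * nabla i (total_deriv d g) p)"
  by (rule nabla_eqI, unfold nabla_eq_sum[of j])
     (intro has_along_sum has_along_mult has_along_nabla[OF loc_smooth_nabla_coeff[OF U loc_smooth_open[OF g]] p]
        has_along_nabla[OF loc_smooth_total_deriv[OF g] p])

text \<open>Since the total derivatives commute, the second-order terms cancel and only derivatives
  of the coefficients remain.\<close>

lemma nabla_commutator:
  assumes g: "loc_smooth U g" and U: "U \<subseteq> reg_dom" and p: "p \<in> U"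
  shows "nabla i (nabla j g) p - nabla j (nabla i g) p
    = (\<Sum>d\<in>{Dx, Du, Dv}. (nabla i (nabla_coeff j d) p - nabla j (nabla_coeff i d) p) * total_deriv d g p)"
  unfolding nabla_nabla[OF assms]
  by (simp add: nabla_eq[of _ "total_deriv _ g"] total_deriv_commute[OF g p, of Du Dx]
      total_deriv_commute[OF g p, of Dv Dx] total_deriv_commute[OF g p, of Dv Du] algebra_simps)

text \<open>The \<open>Dv\<close> component of the commutator divided by the coefficient f / f_v of
  \<open>Nabla2\<close>. Since \<open>inv_K\<close> is a definite description, its smoothness and
  its leading coordinate are read off from this formula.\<close>

definition K_fun :: "jet \<Rightarrow> real" where
  "K_fun p = p c_fv / p c_f * (nabla Nabla3 (nabla_coeff Nabla1 Dv) p - nabla Nabla1 (nabla_coeff Nabla3 Dv) p)"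

text \<open>The \<open>Dx\<close> component vanishes because \<open>Nabla1\<close> annihilates f,
  which is the \<open>Dx\<close> coefficient of \<open>Nabla3\<close>. The \<open>Du\<close>
  components agree, so a multiple of \<open>Nabla2\<close> is left.\<close>

lemma nabla3_nabla1:
  assumes g: "loc_smooth U g" and U: "U \<subseteq> reg_dom" and p: "p \<in> U"
  shows "nabla Nabla3 (nabla Nabla1 g) p - nabla Nabla1 (nabla Nabla3 g) p
    = K_fun p * nabla Nabla2 g p"
proof -
  note n = reg_dom_D(1-3)[OF subsetD[OF U p]]
  have 1: "nabla Nabla3 (nabla_coeff Nabla1 Dx) p = 0" "nabla Nabla1 (nabla_coeff Nabla3 Dx) p = 0"
    unfolding nabla_coeff_fun nabla_const
    by (rule refl, rule nabla_eqI, rule has_along_eq, rule has_along_coord)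
       (simp add: nabla_field_def n field_simps power2_eq_square)
  \<comment> \<open>This equation is linear in the \<open>Dv\<close> coefficient of
    \<open>Nabla3\<close>, with f_vv as the essential factor; solving it for that coefficient yields
    precisely the given expression.\<close>
  have 2: "nabla Nabla3 (nabla_coeff Nabla1 Du) p = nabla Nabla1 (nabla_coeff Nabla3 Du) p"
  proof -
    have e1: "nabla Nabla3 (nabla_coeff Nabla1 Du) p =
       ((nabla_field Nabla3 p c_v0 * p c_fv + p c_v0 * nabla_field Nabla3 p c_fv - nabla_field Nabla3 p c_f) * p c_fv
        - (p c_v0 * p c_fv - p c_f) * nabla_field Nabla3 p c_fv) / (p c_fv)\<^sup>2"
      unfolding nabla_coeff_fun
      by (rule nabla_eqI, rule has_along_eq, (rule has_along_intros | rule n)+) simp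
    have e2: "nabla Nabla1 (nabla_coeff Nabla3 Du) p =
       (nabla_field Nabla1 p c_f * p c_fv - p c_f * nabla_field Nabla1 p c_fv) / (p c_fv)\<^sup>2"
      unfolding nabla_coeff_fun
      by (rule nabla_eqI, rule has_along_eq, (rule has_along_intros | rule n)+) simp
    show ?thesis
      unfolding e1 e2 by (simp add: nabla_field_def n field_simps power2_eq_square)
  qed
  show ?thesis
    unfolding nabla_commutator[OF assms] by (simp add: 1 2 K_fun_def nabla_eq[of Nabla2] n)
qed

lemma smooth_jet_fun_fin_smooth: "smooth_jet_fun k U g \<Longrightarrow> fin_smooth (jcoords k) U g"
  by (auto simp: smooth_jet_fun_def fin_smooth_def jet_open_def smooth_on_iff_Ck finite_jcoords)

lemma fin_smooth_smooth_jet_fun: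
  "fin_smooth (jcoords k) U g \<Longrightarrow> jet_open k U \<Longrightarrow> smooth_jet_fun k U g"
  by (auto simp: smooth_jet_fun_def fin_smooth_def smooth_on_iff_Ck)

lemma nabla2_c_v0: "nabla Nabla2 (\<lambda>q. q c_v0) p = p c_f / p c_fv"
  by (rule nabla_eqI, rule has_along_eq, rule has_along_coord) (simp add: nabla_field_def)

text \<open>The coefficient is unique because the coordinate v is a smooth test function whose
  \<open>Nabla2\<close>-derivative f / f_v is nonzero.\<close>

lemma inv_K_eq:
  assumes p: "p \<in> reg_dom"
  shows "inv_K p = K_fun p"
  unfolding inv_K_def
proof (rule the_equality)
  show "\<forall>k U g. p \<in> U \<and> smooth_jet_fun k U g \<longrightarrow>
     nabla Nabla3 (nabla Nabla1 g) p - nabla Nabla1 (nabla Nabla3 g) p = K_fun p * nabla Nabla2 g p"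
  proof (intro allI impI, elim conjE)
    fix k U g assume U: "p \<in> U" and g: "smooth_jet_fun k U g"
    have g: "loc_smooth U g" by (rule loc_smoothI[OF smooth_jet_fun_fin_smooth[OF g]])
    have "loc_smooth (U \<inter> reg_dom) g"
      by (rule loc_smooth_subset[OF g])
         (auto intro: open_Int loc_smooth_open[OF g] open_reg_dom)
    from nabla3_nabla1[OF this] show "nabla Nabla3 (nabla Nabla1 g) p
        - nabla Nabla1 (nabla Nabla3 g) p = K_fun p * nabla Nabla2 g p"
      using U p by simp
  qed
next
  fix \<kappa> assume *: "\<forall>k U g. p \<in> U \<and> smooth_jet_fun k U g \<longrightarrow>
     nabla Nabla3 (nabla Nabla1 g) p - nabla Nabla1 (nabla Nabla3 g) p = \<kappa> * nabla Nabla2 g p"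
  have v: "smooth_jet_fun 0 UNIV (\<lambda>q. q c_v0)"
    by (rule fin_smooth_smooth_jet_fun[OF fin_smooth_coord[OF open_UNIV finite_jcoords]])
       (simp_all add: jet_open_def jcoords_def)
  have "loc_smooth reg_dom (\<lambda>q. q c_v0)" by (rule loc_smooth_coord[OF open_reg_dom])
  from nabla3_nabla1[OF this order_refl p] *[rule_format, of UNIV 0 "\<lambda>q. q c_v0"] v
  show "\<kappa> = K_fun p"
    using reg_dom_D[OF p] by (simp add: nabla2_c_v0)
qed

lemma loc_smooth_inv_K: "loc_smooth reg_dom inv_K"
proof (rule loc_smooth_cong)
  show "loc_smooth reg_dom K_fun"
    unfolding K_fun_def
    by (intro loc_smooth_intros loc_smooth_nabla loc_smooth_nabla_coeff open_reg_dom order_refl)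
       (auto dest: reg_dom_D)
qed (simp add: inv_K_eq)

lemma inv_J_eq:
  "inv_J = (\<lambda>p. (p c_f)\<^sup>2 * p c_fvv / ((p c_v0 * p c_fv - p c_f) * (p c_fv)\<^sup>2))"
  by (rule ext) (simp add: inv_J_def J_denom_def numeral_2_eq_2 Let_def)

lemma fin_smooth_inv_J: "fin_smooth {c_v0, c_f, c_fv, c_fvv} reg_dom inv_J"
  unfolding inv_J_eq
  by (intro fin_smooth_intros open_reg_dom) (auto simp: mem_reg_dom)

context feedback
begin

lemma X_inv_J:
  assumes p: "p \<in> reg_dom"
  shows "along (\<lambda>c. X c p) inv_J p = 0"
proof -
  note n = reg_dom_D[OF p]
  have d: "(p c_v0 * p c_fv - p c_f) * (p c_fv)\<^sup>2 \<noteq> 0" using n by simp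
  show ?thesis
    unfolding inv_J_eq
    by (rule has_along_D, rule has_along_eq, (rule has_along_intros | rule d)+)
       (unfold X_low divide_eq_0_iff, rule disjI1, algebra)
qed

text \<open>No prolongation of order three is computed. Apply X to [\<open>Nabla3\<close>,
  \<open>Nabla1\<close>] v = K \<open>Nabla2\<close> v. On the left X moves through to v, and the
  commutation relation for Xv gives K \<open>Nabla2\<close> (Xv); on the right the product rule
  gives the same term plus X(K) \<open>Nabla2\<close> v. As \<open>Nabla2\<close> v is nonzero, X(K)
  = 0.\<close>

lemma X_inv_K:
  assumes p: "p \<in> reg_dom"
  shows "along (\<lambda>c. X c p) inv_K p = 0"
proof -
  let ?v = "\<lambda>q::jet. q c_v0" and ?Xv = "\<lambda>q. along (\<lambda>c. X c q) (\<lambda>q. q c_v0) q"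
  note R = open_reg_dom
  have v: "loc_smooth reg_dom ?v" by (rule loc_smooth_coord[OF R])
  have Xv: "loc_smooth reg_dom ?Xv" by (rule loc_smooth_X_along[OF v])
  note nv = loc_smooth_nabla[OF _ order_refl]
  have XX: "along (\<lambda>c. X c p) (nabla i (nabla j ?v)) p = nabla i (nabla j ?Xv) p" for i j
  proof -
    have "along (\<lambda>c. X c p) (nabla i (nabla j ?v)) p = nabla i (\<lambda>q. along (\<lambda>c. X c q) (nabla j ?v) q) p"
      by (rule X_nabla[OF nv[OF v] order_refl p])
    also have "\<dots> = nabla i (nabla j ?Xv) p"
      by (rule nabla_cong[OF R p]) (rule X_nabla[OF v order_refl])
    finally show ?thesis .
  qed
  have K: "has_along (\<lambda>c. X c p) p inv_K (along (\<lambda>c. X c p) inv_K p)"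
    by (rule has_along_I[OF loc_smooth_inv_K p])
  have n2: "has_along (\<lambda>c. X c p) p (nabla Nabla2 ?v) (nabla Nabla2 ?Xv p)"
    using has_along_I[OF nv[OF v] p] X_nabla[OF v order_refl p] by metis
  have "has_along (\<lambda>c. X c p) p (\<lambda>q. nabla Nabla3 (nabla Nabla1 ?v) q - nabla Nabla1 (nabla Nabla3 ?v) q)
     (nabla Nabla3 (nabla Nabla1 ?Xv) p - nabla Nabla1 (nabla Nabla3 ?Xv) p)"
    by (intro has_along_diff has_along_eq[OF has_along_I[OF nv[OF nv[OF v]] p] XX])
  then have "has_along (\<lambda>c. X c p) p (\<lambda>q. inv_K q * nabla Nabla2 ?v q)
     (nabla Nabla3 (nabla Nabla1 ?Xv) p - nabla Nabla1 (nabla Nabla3 ?Xv) p)"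
    by (rule has_along_cong[OF _ R p]) (simp add: inv_K_eq nabla3_nabla1[OF v order_refl])
  then have "along (\<lambda>c. X c p) inv_K p * nabla Nabla2 ?v p = 0"
    using has_along_D has_along_D[OF has_along_mult[OF K n2]]
      nabla3_nabla1[OF Xv order_refl p] inv_K_eq[OF p]
    by (metis (no_types, lifting) add_cancel_right_left)
  then show ?thesis
    using reg_dom_D[OF p] by (simp add: nabla2_c_v0)
qed

end

section \<open>Invariance of all derived generators\<close>

lemma loc_smooth_foldr_nabla:
  "loc_smooth reg_dom g \<Longrightarrow> loc_smooth reg_dom (foldr nabla w g)"
  by (induction w) (auto intro: loc_smooth_nabla)

lemma loc_smooth_gen_fun: "loc_smooth reg_dom (gen_fun s)"
  by (cases s) (auto intro!: loc_smooth_foldr_nabla loc_smooth_inv_K loc_smoothI[OF fin_smooth_inv_J])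

lemma (in feedback) X_foldr_nabla:
  assumes g: "loc_smooth reg_dom g" and X: "\<And>p. p \<in> reg_dom \<Longrightarrow> along (\<lambda>c. X c p) g p = 0"
    and p: "p \<in> reg_dom"
  shows "along (\<lambda>c. X c p) (foldr nabla w g) p = 0"
  using p
proof (induction w arbitrary: p)
  case (Cons i w)
  have "along (\<lambda>c. X c p) (nabla i (foldr nabla w g)) p
      = nabla i (\<lambda>q. along (\<lambda>c. X c q) (foldr nabla w g) q) p"
    by (rule X_nabla[OF loc_smooth_foldr_nabla[OF g] order_refl Cons.prems])
  also have "\<dots> = nabla i (\<lambda>_. 0) p"
    by (rule nabla_cong[OF open_reg_dom Cons.prems Cons.IH])
  finally show ?case by (simp add: nabla_const del: nabla.simps)
qed (simp add: X)

lemma (in feedback) X_gen_fun: "p \<in> reg_dom \<Longrightarrow> along (\<lambda>c. X c p) (gen_fun s) p = 0"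
  by (cases s)
     (auto intro!: X_foldr_nabla loc_smooth_inv_K loc_smoothI[OF fin_smooth_inv_J] X_inv_J X_inv_K)

lemma jet_open_reg_dom:
  assumes "k \<ge> 2"
  shows "jet_open k reg_dom"
proof -
  have "c_f \<in> jcoords k" "c_v0 \<in> jcoords k" "c_fv \<in> jcoords k" "c_fvv \<in> jcoords k"
    using assms by (auto simp: jcoords_def)
  then show ?thesis
    using open_reg_dom by (auto simp: jet_open_def mem_reg_dom)
qed

lemma finite_subset_jcoords:
  assumes "finite C"
  obtains m where "m \<ge> 2" "C \<subseteq> jcoords m"
proof
  show "C \<subseteq> jcoords (max 2 (Max (coord_order ` C)))"
    using assms by (auto simp: jcoords_def le_max_iff_disj)
qed simp

lemma feedback_invariant_gen_fun: "\<exists>m. feedback_invariant m reg_dom (gen_fun s)"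
proof -
  obtain C where C: "fin_smooth C reg_dom (gen_fun s)"
    using loc_smooth_gen_fun by (auto simp: loc_smooth_def)
  obtain m where m: "m \<ge> 2" "C \<subseteq> jcoords m"
    using finite_subset_jcoords[OF fin_smoothD(2)[OF C]] by blast
  have s: "fin_smooth (jcoords m) reg_dom (gen_fun s)"
    by (rule fin_smooth_mono[OF C m(2) finite_jcoords])
  have "(\<Sum>c\<in>jcoords m. feedback_field a b c p * partial c (gen_fun s) p) = 0"
    if "smooth_feedback a b" "p \<in> reg_dom" for a b p
  proof -
    interpret feedback a b by unfold_locales (rule that)
    show ?thesis using X_gen_fun[OF that(2), of s] along_eq[OF s that(2)] by simp
  qed
  then have "feedback_invariant m reg_dom (gen_fun s)"
    using fin_smooth_smooth_jet_fun[OF s jet_open_reg_dom[OF m(1)]]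
    by (simp add: feedback_invariant_def)
  then show ?thesis ..
qed

section \<open>Elimination of coordinates\<close>

text \<open>The change of coordinates. A new coordinate keeps the name of the one it replaces, so
  old and new points have the same type and replacements can be made one at a time.\<close>

definition subst_coords ::
    "'i set \<Rightarrow> ('i \<Rightarrow> ('i \<Rightarrow> real) \<Rightarrow> real) \<Rightarrow> ('i \<Rightarrow> real) \<Rightarrow> 'i \<Rightarrow> real" where
  "subst_coords A h q = (\<lambda>c. if c \<in> A then h c q else q c)"

text \<open>On a neighbourhood of \<open>U\<close> the function \<open>h\<close> of the coordinates in \<open>insert c B\<close> is affine in
  the coordinate \<open>c\<close>, with nonvanishing slope.\<close>

definition solvable :: "('i \<Rightarrow> real) set \<Rightarrow> 'i set \<Rightarrow> 'i \<Rightarrow> (('i \<Rightarrow> real) \<Rightarrow> real) \<Rightarrow> bool" where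
  "solvable U B c h \<longleftrightarrow> c \<notin> B \<and> (\<exists>D \<alpha>. U \<subseteq> D \<and> (\<forall>p q. p \<in> D \<longrightarrow> (\<forall>b\<in>B. p b = q b) \<longrightarrow> q \<in> D) \<and>
     fin_smooth (insert c B) D h \<and> fin_smooth B D \<alpha> \<and> (\<forall>p\<in>D. \<alpha> p \<noteq> 0 \<and> partial c h p = \<alpha> p))"

lemma solvable_subset: "solvable U B c h \<Longrightarrow> U' \<subseteq> U \<Longrightarrow> solvable U' B c h"
proof -
  assume *: "solvable U B c h" "U' \<subseteq> U"
  then obtain D \<alpha> where "c \<notin> B" "U \<subseteq> D" "\<forall>p q. p \<in> D \<longrightarrow> (\<forall>b\<in>B. p b = q b) \<longrightarrow> q \<in> D"
     "fin_smooth (insert c B) D h" "fin_smooth B D \<alpha>" "\<forall>p\<in>D. \<alpha> p \<noteq> 0 \<and> partial c h p = \<alpha> p"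
    unfolding solvable_def by (elim conjE exE)
  with *(2) show "solvable U' B c h"
    unfolding solvable_def by (intro conjI exI[of _ D] exI[of _ \<alpha>]) simp_all
qed

text \<open>\<open>D\<close> contains the whole line through \<open>p\<close> in direction
  \<open>c\<close>, and on it \<open>\<alpha>\<close> is constant since \<open>c\<close> is not in
  \<open>B\<close>. Hence subtracting \<alpha> p * s leaves a function with zero derivative.\<close>

lemma affine_line:
  assumes c: "c \<notin> B" and D: "\<And>p q. p \<in> D \<Longrightarrow> (\<And>b. b \<in> B \<Longrightarrow> p b = q b) \<Longrightarrow> q \<in> D"
    and h: "fin_smooth (insert c B) D h" and \<alpha>: "fin_smooth B D \<alpha>"
    and eq: "\<And>p. p \<in> D \<Longrightarrow> partial c h p = \<alpha> p" and p: "p \<in> D"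
  shows "h (p(c := t)) = h p + \<alpha> p * (t - p c)"
proof -
  have in_D: "p(c := s) \<in> D" for s
    by (rule D[OF p]) (use c in auto)
  have \<alpha>s: "\<alpha> (p(c := s)) = \<alpha> p" for s
    by (rule depends_onlyD[OF fin_smoothD(4)[OF \<alpha>] in_D p]) (use c in auto)
  have "((\<lambda>s. h (p(c := s)) - \<alpha> p * s) has_real_derivative 0) (at s)" for s
  proof -
    have "((\<lambda>s. h (p(c := s))) has_real_derivative partial c h (p(c := s))) (at s)"
      by (rule Ck_has_partial_line[OF fin_smoothD(3)[OF h] in_D])
    then have "((\<lambda>s. h (p(c := s))) has_real_derivative \<alpha> p) (at s)"
      by (simp only: eq[OF in_D] \<alpha>s)
    from DERIV_diff[OF this DERIV_cmult_Id[of "\<alpha> p"]] show ?thesis by simp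
  qed
  then have "h (p(c := t)) - \<alpha> p * t = h (p(c := p c)) - \<alpha> p * p c"
    by (intro DERIV_isconst_all[of "\<lambda>s. h (p(c := s)) - \<alpha> p * s"]) blast
  then show ?thesis by (simp add: algebra_simps)
qed

text \<open>Being affine in the coordinate \<open>c\<close>, \<open>h c\<close> is inverted exactly
  by one Newton step. The coordinates in \<open>B\<close> are disjoint from those replaced before,
  so \<open>h c\<close> can still be evaluated in the new coordinates.\<close>

lemma eliminate_one:
  fixes h :: "'i \<Rightarrow> ('i \<Rightarrow> real) \<Rightarrow> real"
  assumes sol: "solvable U B c (h c)" and A: "c \<notin> A" "A \<inter> B = {}" and C: "insert c B \<subseteq> C"
    and H: "fin_smooth C V H"
    and U: "\<And>q. q \<in> U \<Longrightarrow> subst_coords A h q \<in> V" "\<And>q. q \<in> U \<Longrightarrow> g q = H (subst_coords A h q)"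
    and V: "\<And>y. y \<in> V \<Longrightarrow> \<exists>q\<in>U. subst_coords A h q = y"
  obtains V' H' where "fin_smooth C V' H'"
    "\<And>q. q \<in> U \<Longrightarrow> subst_coords (insert c A) h q \<in> V'"
    "\<And>q. q \<in> U \<Longrightarrow> g q = H' (subst_coords (insert c A) h q)"
    "\<And>y. y \<in> V' \<Longrightarrow> \<exists>q\<in>U. subst_coords (insert c A) h q = y"
proof -
  obtain D \<alpha> where c: "c \<notin> B" and UD: "U \<subseteq> D"
    and D: "\<And>p q. p \<in> D \<Longrightarrow> (\<And>b. b \<in> B \<Longrightarrow> p b = q b) \<Longrightarrow> q \<in> D"
    and h: "fin_smooth (insert c B) D (h c)" and \<alpha>: "fin_smooth B D \<alpha>"
    and \<alpha>0: "\<And>p. p \<in> D \<Longrightarrow> \<alpha> p \<noteq> 0" and eq: "\<And>p. p \<in> D \<Longrightarrow> partial c (h c) p = \<alpha> p"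
    using sol unfolding solvable_def by (metis (no_types))
  have aff: "h c (p(c := t)) = h c p + \<alpha> p * (t - p c)" if "p \<in> D" for p t
    by (rule affine_line[OF c _ h \<alpha> eq that]) (rule D)
  have finC: "finite C" by (rule fin_smoothD[OF H])
  \<comment> \<open>The old value of the coordinate \<open>c\<close>. In \<open>y\<close> the place
    \<open>c\<close> holds the new value, so \<open>h c y\<close> is \<open>h c\<close> at a
    displaced argument, and the affine formula turns the error into the displacement.\<close>
  define r where "r y = y c + (y c - h c y) / \<alpha> y" for y
  define S where "S y = y(c := r y)" for y
  have rs: "fin_smooth C D r"
    unfolding r_def using C c finC \<alpha>0
    by (intro fin_smooth_intros fin_smooth_mono[OF h _ finC] fin_smooth_mono[OF \<alpha> _ finC]
        fin_smoothD(1)[OF h]) auto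
  have Ss: "Ck n D (\<lambda>y. S y b)" for n b
    using fin_smoothD(3)[OF rs] Ck_coord[OF fin_smoothD(1)[OF rs], of n b]
    by (cases "b = c") (simp_all add: S_def)
  have Sc: "continuous_on D S"
    by (rule continuous_on_coordinatewise_then_product) (use Ss[of 0] in simp)
  define V' where "V' = D \<inter> S -` V"
  have oV': "open V'"
    unfolding V'_def
    by (rule continuous_open_preimage[OF Sc fin_smoothD(1)[OF rs] fin_smoothD(1)[OF H]])
  define H' where "H' y = H (S y)" for y
  have "Ck n V' H'" for n
    unfolding H'_def
    by (rule Ck_compose[OF oV' fin_smoothD(1)[OF H] _ finC fin_smoothD(3,4)[OF H] Ck_subset[OF Ss]])
       (auto simp: V'_def)
  moreover have "depends_only C V' H'"
    unfolding depends_only_def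
  proof (intro ballI impI)
    fix y z assume yz: "y \<in> V'" "z \<in> V'" "\<forall>c\<in>C. y c = z c"
    then have "r y = r z"
      by (intro depends_onlyD[OF fin_smoothD(4)[OF rs]]) (auto simp: V'_def)
    then show "H' y = H' z"
      unfolding H'_def using yz
      by (intro depends_onlyD[OF fin_smoothD(4)[OF H]]) (auto simp: V'_def S_def)
  qed
  ultimately have H': "fin_smooth C V' H'"
    using oV' finC by (simp add: fin_smooth_def)
  have key: "subst_coords (insert c A) h q \<in> D" "S (subst_coords (insert c A) h q) = subst_coords A h q"
    if q: "q \<in> U" for q
  proof -
    define y where "y = subst_coords (insert c A) h q"
    have qD: "q \<in> D" using q UD by auto
    have yB: "y b = q b" if "b \<in> B" for b
      using that A c by (auto simp: y_def subst_coords_def)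
    show yD: "subst_coords (insert c A) h q \<in> D"
      by (rule D[OF qD, of y, unfolded y_def]) (use yB in \<open>simp add: y_def\<close>)
    have yc: "y c = h c q" by (simp add: y_def subst_coords_def)
    have qt: "q(c := y c) \<in> D" by (rule D[OF qD]) (use c in auto)
    have "h c y = h c (q(c := y c))"
      by (rule depends_onlyD[OF fin_smoothD(4)[OF h] _ qt])
         (use yB yD in \<open>auto simp: y_def[symmetric]\<close>)
    also have "\<dots> = h c q + \<alpha> q * (y c - q c)" by (rule aff[OF qD])
    finally have hy: "h c y = h c q + \<alpha> q * (y c - q c)" .
    have "\<alpha> y = \<alpha> q"
      by (rule depends_onlyD[OF fin_smoothD(4)[OF \<alpha>] _ qD yB]) (use yD in \<open>simp_all add: y_def\<close>)
    then have "r y = q c"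
      using \<alpha>0[OF qD] by (simp add: r_def hy yc[symmetric])
    then show "S (subst_coords (insert c A) h q) = subst_coords A h q"
      using A(1) by (auto simp: S_def y_def[symmetric] subst_coords_def) (auto simp: y_def subst_coords_def)
  qed
  show ?thesis
  proof (rule that[OF H'])
    fix q assume q: "q \<in> U"
    show "subst_coords (insert c A) h q \<in> V'" "g q = H' (subst_coords (insert c A) h q)"
      using key[OF q] U[OF q] by (auto simp: V'_def H'_def)
  next
    fix y assume y: "y \<in> V'"
    then have yD: "y \<in> D" and "S y \<in> V" by (auto simp: V'_def)
    then obtain q where q: "q \<in> U" "subst_coords A h q = S y" using V by blast
    have qD: "q \<in> D" using q UD by auto
    have SyD: "S y \<in> D" by (rule D[OF yD]) (use c in \<open>auto simp: S_def\<close>)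
    have qB: "q b = S y b" if "b \<in> insert c B" for b
    proof -
      have "b \<notin> A" using that A by auto
      then show ?thesis using fun_cong[OF q(2), of b] by (simp add: subst_coords_def)
    qed
    have "h c q = h c (S y)"
      by (rule depends_onlyD[OF fin_smoothD(4)[OF h] qD SyD qB])
    also have "\<dots> = h c y + \<alpha> y * (r y - y c)"
      unfolding S_def by (rule aff[OF yD])
    also have "\<dots> = y c"
      using \<alpha>0[OF yD] by (simp add: r_def)
    finally have hc: "h c q = y c" .
    have "subst_coords (insert c A) h q b = y b" for b
      using hc fun_cong[OF q(2), of b] by (auto simp: subst_coords_def S_def)
    then show "\<exists>q\<in>U. subst_coords (insert c A) h q = y" using q(1) by blast
  qed
qed

text \<open>The new coordinates are triangular with respect to the well-founded relation, so they
  are introduced one by one. The last clause, that \<open>V\<close> is the image of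
  \<open>U\<close>, makes facts proved at points of \<open>U\<close> available at every point of
  \<open>V\<close>.\<close>

lemma eliminate:
  fixes h :: "'i \<Rightarrow> ('i \<Rightarrow> real) \<Rightarrow> real"
  assumes g: "fin_smooth C U g" and wf: "wf {(d, c). d \<in> B c}" and fin: "finite A"
    and sol: "\<And>c. c \<in> A \<Longrightarrow> solvable U (B c) c (h c)" and C: "\<And>c. c \<in> A \<Longrightarrow> insert c (B c) \<subseteq> C"
  obtains V H where "fin_smooth C V H"
    "\<And>q. q \<in> U \<Longrightarrow> subst_coords A h q \<in> V"
    "\<And>q. q \<in> U \<Longrightarrow> g q = H (subst_coords A h q)"
    "\<And>y. y \<in> V \<Longrightarrow> \<exists>q\<in>U. subst_coords A h q = y"
proof -
  have "\<exists>V H. fin_smooth C V H \<and> (\<forall>q\<in>U. subst_coords A h q \<in> V \<and> g q = H (subst_coords A h q)) \<and>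
      (\<forall>y\<in>V. \<exists>q\<in>U. subst_coords A h q = y)"
    using fin sol C
  proof (induction A rule: finite_psubset_induct)
    case (psubset A)
    show ?case
    proof (cases "A = {}")
      case True
      then show ?thesis
        using g by (intro exI[of _ U] exI[of _ g]) (auto simp: subst_coords_def)
    next
      case False
      \<comment> \<open>The removed \<open>c\<close> is minimal and is therefore replaced last. None
        of the coordinates in \<open>B c\<close> lies in \<open>A\<close>, so they are all intact
        when its turn comes.\<close>
      then obtain c where c: "c \<in> A" "\<And>d. d \<in> B c \<Longrightarrow> d \<notin> A"
        using wf unfolding wf_eq_minimal by (metis (mono_tags, lifting) all_not_in_conv case_prodI mem_Collect_eq)
      have "\<exists>V H. fin_smooth C V H \<and>
          (\<forall>q\<in>U. subst_coords (A - {c}) h q \<in> V \<and> g q = H (subst_coords (A - {c}) h q)) \<and>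
          (\<forall>y\<in>V. \<exists>q\<in>U. subst_coords (A - {c}) h q = y)"
        by (rule psubset.IH) (use c(1) psubset.prems in auto)
      then obtain V H where VH: "fin_smooth C V H"
          "\<forall>q\<in>U. subst_coords (A - {c}) h q \<in> V \<and> g q = H (subst_coords (A - {c}) h q)"
          "\<forall>y\<in>V. \<exists>q\<in>U. subst_coords (A - {c}) h q = y"
        by blast
      obtain V' H' where "fin_smooth C V' H'"
        "\<And>q. q \<in> U \<Longrightarrow> subst_coords (insert c (A - {c})) h q \<in> V'"
        "\<And>q. q \<in> U \<Longrightarrow> g q = H' (subst_coords (insert c (A - {c})) h q)"
        "\<And>y. y \<in> V' \<Longrightarrow> \<exists>q\<in>U. subst_coords (insert c (A - {c})) h q = y"
        by (rule eliminate_one[of U "B c" c h "A - {c}" C V H g])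
           (use VH psubset.prems c in auto)
      then show ?thesis using c(1) by (metis insert_Diff)
    qed
  qed
  then show ?thesis using that by blast
qed

text \<open>Coordinates of \<open>y\<close> are exchanged for those of \<open>z\<close> one at a
  time; each segment stays in the box, and \<open>H\<close> is constant on it. The box matters:
  vanishing partials on all of \<open>V\<close> would give this only locally, as slices of
  \<open>V\<close> can be disconnected.\<close>

lemma const_in_box:
  fixes H :: "('i \<Rightarrow> real) \<Rightarrow> real"
  assumes H: "fin_smooth C V H" and box: "{y. \<forall>c\<in>F. \<bar>y c - q c\<bar> < e} \<subseteq> V"
    and zero: "\<And>y c. y \<in> V \<Longrightarrow> c \<in> C - A \<Longrightarrow> partial c H y = 0"
    and y: "\<forall>c\<in>F. \<bar>y c - q c\<bar> < e" and z: "\<forall>c\<in>F. \<bar>z c - q c\<bar> < e"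
    and yz: "\<And>c. c \<in> A \<Longrightarrow> y c = z c"
  shows "H y = H z"
proof -
  define m where "m P = (\<lambda>c. if c \<in> P then z c else y c)" for P
  have m_box: "\<forall>c\<in>F. \<bar>m P c - q c\<bar> < e" for P using y z by (auto simp: m_def)
  have mV: "m P \<in> V" for P using box m_box[of P] by blast
  have "H (m P) = H y" if "finite P" "P \<subseteq> C - A" for P
    using that
  proof (induction P)
    case empty
    then show ?case by (simp add: m_def)
  next
    case (insert c P)
    have ins: "m (insert c P) = (m P)(c := z c)" by (auto simp: m_def)
    have line: "(m P)(c := t) \<in> V" if "t \<in> closed_segment (y c) (z c)" for t
    proof -
      have "\<bar>t - q c\<bar> < e" if "c \<in> F"
        using \<open>t \<in> _\<close> y z that by (force simp: closed_segment_eq_real_ivl split: if_splits)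
      then have "\<forall>b\<in>F. \<bar>((m P)(c := t)) b - q b\<bar> < e" using m_box[of P] by auto
      then show ?thesis using box by blast
    qed
    have "((\<lambda>t. H ((m P)(c := t))) has_real_derivative 0) (at t within closed_segment (y c) (z c))"
      if "t \<in> closed_segment (y c) (z c)" for t
      using Ck_has_partial_line[OF fin_smoothD(3)[OF H] line[OF that]] zero[OF line[OF that], of c]
        insert.prems by (simp add: has_field_derivative_at_within)
    then have "\<exists>k. \<forall>t\<in>closed_segment (y c) (z c). H ((m P)(c := t)) = k"
      by (intro has_field_derivative_zero_constant) auto
    then obtain k where k: "\<And>t. t \<in> closed_segment (y c) (z c) \<Longrightarrow> H ((m P)(c := t)) = k"
      by blast
    have "m P c = y c" using insert.hyps by (simp add: m_def)
    then have "(m P)(c := y c) = m P" by auto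
    then have "H (m P) = H (m (insert c P))"
      using k[of "y c"] k[of "z c"] by (simp add: ins)
    then show ?case using insert by simp
  qed
  from this[of "C - A"] have "H (m (C - A)) = H y"
    using fin_smoothD(2)[OF H] by simp
  moreover have "H (m (C - A)) = H z"
  proof (rule depends_onlyD[OF fin_smoothD(4)[OF H] mV])
    show "z \<in> V" using box z by blast
  qed (use yz in \<open>auto simp: m_def\<close>)
  ultimately show ?thesis by simp
qed

text \<open>The chain rule in new coordinates: the transported vector has component w(h c) at a
  replaced coordinate and its old component elsewhere.\<close>

lemma along_subst_coords:
  fixes h :: "'i \<Rightarrow> ('i \<Rightarrow> real) \<Rightarrow> real"
  assumes g: "fin_smooth C U g" and H: "fin_smooth C V H"
    and h: "\<And>c. c \<in> A \<Longrightarrow> fin_smooth C U (h c)"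
    and U: "\<And>q. q \<in> U \<Longrightarrow> subst_coords A h q \<in> V" "\<And>q. q \<in> U \<Longrightarrow> g q = H (subst_coords A h q)"
    and q: "q \<in> U"
  shows "along w g q = (\<Sum>c\<in>C. partial c H (subst_coords A h q) *
      (if c \<in> A then along w (h c) q else w c))"
proof -
  note oU = fin_smoothD(1,2)[OF g]
  let ?T = "\<lambda>c q. subst_coords A h q c"
  have T: "?T c = (if c \<in> A then h c else (\<lambda>q. q c))" for c
    by (auto simp: subst_coords_def)
  have Ts: "Ck 1 U (?T c)" for c
    by (cases "c \<in> A") (simp_all add: T fin_smoothD(3)[OF h] Ck_coord[OF oU(1)] del: One_nat_def)
  have Tf: "fin_smooth C U (?T c)" if "c \<in> C" for c
    using that by (cases "c \<in> A") (simp_all add: T h fin_smooth_coord oU)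
  have Ta: "along w (?T c) q = (if c \<in> A then along w (h c) q else w c)" for c
    unfolding T by simp
  have pg: "partial b g q = (\<Sum>c\<in>C. partial c H (subst_coords A h q) * partial b (?T c) q)" for b
  proof -
    have "partial b g q = partial b (\<lambda>q. H (subst_coords A h q)) q"
      by (rule partial_cong[OF oU(1) q U(2)])
    also have "\<dots> = (\<Sum>c\<in>C. partial c H (subst_coords A h q) * partial b (?T c) q)"
      by (rule partial_eqI, rule Ck_partial_compose[OF oU(1) fin_smoothD(1)[OF H] _
            fin_smoothD(3,4)[OF H] oU(2) Ts q]) (use U(1) in auto)
    finally show ?thesis .
  qed
  have "along w g q = (\<Sum>b\<in>C. \<Sum>c\<in>C. partial c H (subst_coords A h q) * (w b * partial b (?T c) q))"
    unfolding along_eq[OF g q] pg by (simp add: sum_distrib_left mult.left_commute)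
  also have "\<dots> = (\<Sum>c\<in>C. partial c H (subst_coords A h q) * (\<Sum>b\<in>C. w b * partial b (?T c) q))"
    by (subst sum.swap) (simp add: sum_distrib_left)
  also have "\<dots> = (\<Sum>c\<in>C. partial c H (subst_coords A h q) * along w (?T c) q)"
    by (intro sum.cong refl) (simp add: along_eq[OF Tf q])
  finally show ?thesis unfolding Ta .
qed

section \<open>Leading coordinates of the generators\<close>

text \<open>The strict predecessors in the elimination order, base coordinates preceding all fibre
  coordinates. The bound on the total order makes the set finite, so that it can serve as a
  coordinate set.\<close>

fun below :: "nat \<times> nat \<times> nat \<Rightarrow> coord set" where
  "below (i, j, l) = range Base \<union> {Fib (i', j', l') |i' j' l'.
     i' + j' + l' < i + j + l \<or> i' + j' + l' = i + j + l \<and> (i' < i \<or> i' = i \<and> j' < j)}"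

lemma below_subset_jcoords: "insert (Fib \<sigma>) (below \<sigma>) \<subseteq> jcoords (coord_order (Fib \<sigma>))"
  by (cases \<sigma>) (auto simp: jcoords_def)

lemma finite_below: "finite (below \<sigma>)"
  using below_subset_jcoords finite_jcoords finite_subset by (metis insert_subset)

lemma not_mem_below: "Fib \<sigma> \<notin> below \<sigma>"
  by (cases \<sigma>) auto

fun nabla_dir :: "der \<Rightarrow> dir" where
  "nabla_dir Nabla1 = Du"
| "nabla_dir Nabla2 = Dv"
| "nabla_dir Nabla3 = Dx"

text \<open>The slope may be any function here, which keeps the step for a derivation uniform. That
  it does not involve the leading coordinate, so that \<open>h\<close> is affine in it, is shown
  separately.\<close>

definition lead :: "nat \<times> nat \<times> nat \<Rightarrow> (jet \<Rightarrow> real) \<Rightarrow> (jet \<Rightarrow> real) \<Rightarrow> bool" where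
  "lead \<sigma> \<alpha> h \<longleftrightarrow> fin_smooth (insert (Fib \<sigma>) (below \<sigma>)) reg_dom h \<and>
     (\<forall>p\<in>reg_dom. partial (Fib \<sigma>) h p = \<alpha> p)"

lemma fin_smooth_nabla_coeff_low:
  "i \<noteq> Nabla3 \<Longrightarrow> fin_smooth {c_v0, c_f, c_fu, c_fv} reg_dom (nabla_coeff i d)"
  by (cases i; cases d)
     (auto simp: nabla_coeff_fun open_reg_dom dest: reg_dom_D intro!: fin_smooth_intros)

text \<open>Among the directions with nonzero coefficient, \<open>nabla_dir i\<close> gives the
  largest shift, so only this term reaches the new leader. The bound on the order places the
  coefficients themselves below the new leader: those of \<open>Nabla3\<close> have order two, the
  others order at most one.\<close>

lemma lead_nabla:
  assumes h: "lead \<sigma> \<alpha> h" and ord: "coord_order (Fib \<sigma>) \<ge> (if i = Nabla3 then 2 else 1)"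
  shows "lead (bump (nabla_dir i) \<sigma>) (\<lambda>p. nabla_coeff i (nabla_dir i) p * \<alpha> p) (nabla i h)"
proof -
  define \<tau> where "\<tau> = bump (nabla_dir i) \<sigma>"
  obtain a b c where \<sigma>: "\<sigma> = (a, b, c)" by (cases \<sigma>)
  let ?B = "insert (Fib \<sigma>) (below \<sigma>)"
  have hs: "fin_smooth ?B reg_dom h" using h by (simp add: lead_def)
  have fin: "finite (below \<tau>)" "finite (insert (Fib \<tau>) (below \<tau>))"
    using finite_below by auto
  have nabla_coeff: "fin_smooth (below \<tau>) reg_dom (nabla_coeff i d)" for d
  proof (cases "i = Nabla3")
    case True
    show ?thesis
      by (rule fin_smooth_mono[OF fin_smooth_nabla_coeff _ fin(1)])
         (use True ord in \<open>auto simp: nabla_coeff_coords_def \<tau>_def \<sigma>\<close>)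
  next
    case False
    show ?thesis
      by (rule fin_smooth_mono[OF fin_smooth_nabla_coeff_low[OF False] _ fin(1)])
         (use False ord in \<open>cases i; auto simp: \<tau>_def \<sigma>\<close>)
  qed
  have tm: "fin_smooth (insert (Fib \<tau>) (below \<tau>)) reg_dom (\<lambda>q. nabla_coeff i d q * total_deriv d h q)
     \<and> (\<forall>p\<in>reg_dom. partial (Fib \<tau>) (\<lambda>q. nabla_coeff i d q * total_deriv d h q) p
         = (if d = nabla_dir i then nabla_coeff i d p * \<alpha> p else 0))" (is "?sm \<and> ?pa") for d
  proof (cases "nabla_coeff i d = (\<lambda>_. 0)")
    case True
    \<comment> \<open>The coefficient along \<open>nabla_dir i\<close> is not identically zero. At
      the all-ones point v f_v - f vanishes, hence the second test point with v = 2.\<close>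
    then have "d \<noteq> nabla_dir i" by (cases i; cases d) (auto simp: nabla_coeff_fun fun_eq_iff dest: spec[of _ "\<lambda>_. 1"] spec[of _ "\<lambda>c. if c = c_v0 then 2 else 1"])
    then show ?thesis
      using True fin open_reg_dom by (auto simp: fin_smooth_const partial_along)
  next
    case False
    have D: "fin_smooth (bumps d ?B) reg_dom (total_deriv d h)"
      by (rule fin_smooth_total_deriv[OF hs])
    have sub: "bumps d ?B \<subseteq> (if d = nabla_dir i then insert (Fib \<tau>) (below \<tau>) else below \<tau>)"
      using False
      by (cases i; cases d) (auto simp: nabla_coeff_fun bumps_def \<tau>_def \<sigma>)
    then have D': "fin_smooth (insert (Fib \<tau>) (below \<tau>)) reg_dom (total_deriv d h)"
      by (intro fin_smooth_mono[OF D _ fin(2)]) (auto split: if_splits)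
    have sm: ?sm
      by (intro fin_smooth_mult D' fin_smooth_mono[OF nabla_coeff _ fin(2)]) auto
    have "partial (Fib \<tau>) (\<lambda>q. nabla_coeff i d q * total_deriv d h q) p
         = (if d = nabla_dir i then nabla_coeff i d p * \<alpha> p else 0)" if p: "p \<in> reg_dom" for p
    proof -
      have 1: "partial (Fib \<tau>) (nabla_coeff i d) p = 0"
        by (rule partial_zero[OF open_reg_dom fin_smoothD(4)[OF nabla_coeff] not_mem_below p])
      have 2: "partial (Fib \<tau>) (total_deriv d h) p = (if d = nabla_dir i then \<alpha> p else 0)"
      proof (cases "d = nabla_dir i")
        case True
        have "Fib (bump d \<sigma>) \<notin> ?B" by (cases d) (auto simp: \<sigma>)
        from partial_total_deriv[OF hs p this] show ?thesis
          using h p True by (simp add: \<tau>_def lead_def)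
      next
        case False
        then have "Fib \<tau> \<notin> bumps d ?B" using sub not_mem_below[of \<tau>] by auto
        from partial_zero[OF open_reg_dom fin_smoothD(4)[OF D] this p] False show ?thesis by simp
      qed
      have "has_along (\<lambda>b. if b = Fib \<tau> then 1 else 0) p (\<lambda>q. nabla_coeff i d q * total_deriv d h q)
        (partial (Fib \<tau>) (nabla_coeff i d) p * total_deriv d h p
          + nabla_coeff i d p * partial (Fib \<tau>) (total_deriv d h) p)"
        unfolding partial_along
        by (intro has_along_mult has_along_I[OF loc_smoothI[OF nabla_coeff] p] has_along_I[OF loc_smoothI[OF D] p])
      from has_along_D[OF this] show ?thesis
        by (simp add: 1 2 flip: partial_along)
    qed
    then show ?thesis using sm by blast
  qed
  have "fin_smooth (insert (Fib \<tau>) (below \<tau>)) reg_dom (nabla i h)"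
    unfolding nabla_eq_sum by (intro fin_smooth_sum open_reg_dom fin(2)) (use tm in blast)
  moreover have "partial (Fib \<tau>) (nabla i h) p = nabla_coeff i (nabla_dir i) p * \<alpha> p" if p: "p \<in> reg_dom" for p
  proof -
    have "has_along (\<lambda>b. if b = Fib \<tau> then 1 else 0) p (nabla i h)
        (\<Sum>d\<in>{Dx, Du, Dv}. if d = nabla_dir i then nabla_coeff i d p * \<alpha> p else 0)"
      unfolding nabla_eq_sum
      by (intro has_along_sum has_along_eq[OF has_along_I[OF loc_smoothI[OF tm[THEN conjunct1]] p]])
         (use tm p in \<open>auto simp flip: partial_along\<close>)
    from has_along_D[OF this] show ?thesis
      unfolding partial_along by (cases i) simp_all
  qed
  ultimately show ?thesis by (simp add: lead_def \<tau>_def)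
qed

lemma lead_inv_J:
  "lead (0, 0, 2) (\<lambda>p. (p c_f)\<^sup>2 / ((p c_v0 * p c_fv - p c_f) * (p c_fv)\<^sup>2)) inv_J"
proof -
  have "partial c_fvv inv_J p = (p c_f)\<^sup>2 / ((p c_v0 * p c_fv - p c_f) * (p c_fv)\<^sup>2)"
    if p: "p \<in> reg_dom" for p
  proof -
    have d: "(p c_v0 * p c_fv - p c_f) * (p c_fv)\<^sup>2 \<noteq> 0" using reg_dom_D[OF p] by simp
    show ?thesis
      unfolding inv_J_eq partial_along
      by (rule has_along_D, rule has_along_eq, (rule has_along_intros | rule d)+)
         (use d in \<open>simp add: power2_eq_square\<close>)
  qed
  moreover have "fin_smooth (insert c_fvv (below (0, 0, 2))) reg_dom inv_J"
    by (rule fin_smooth_mono[OF fin_smooth_inv_J]) (use finite_below[of "(0, 0, 2)"] in auto)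
  ultimately show ?thesis by (simp add: lead_def numeral_2_eq_2)
qed

text \<open>f_xuv arises only when \<open>Nabla1\<close> differentiates f_xv in the
  \<open>Dv\<close> coefficient of \<open>Nabla3\<close>, where its slope is - f / f_vv. The factor
  (v f_v - f) / f_v from \<open>Nabla1\<close>, the minus sign of the commutator and the prefactor
  f_v / f produce the slope. The other half of the commutator has order at most two.\<close>

lemma lead_inv_K: "lead (1, 1, 1) (\<lambda>p. (p c_v0 * p c_fv - p c_f) / p c_fvv) inv_K"
proof -
  let ?C = "insert (Fib (1, 1, 1)) (below (1, 1, 1))"
  have fC: "finite ?C" "finite (below (1, 1, 1))" using finite_below[of "(1, 1, 1)"] by auto
  have 1: "fin_smooth (below (1, 1, 1)) reg_dom (nabla Nabla3 (nabla_coeff Nabla1 Dv))"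
    unfolding nabla_eq_sum
    by (intro fin_smooth_sum fin_smooth_mult open_reg_dom fC
         fin_smooth_mono[OF fin_smooth_total_deriv[OF fin_smooth_nabla_coeff_low] _ fC(2)]
         fin_smooth_mono[OF fin_smooth_nabla_coeff _ fC(2)])
       (auto simp: nabla_coeff_coords_def bumps_def)
  have "lead (1, 0, 1) (\<lambda>p. - p c_f / p c_fvv) (nabla_coeff Nabla3 Dv)"
  proof -
    have "fin_smooth (insert c_fxv (below (1, 0, 1))) reg_dom (nabla_coeff Nabla3 Dv)"
      by (rule fin_smooth_mono[OF fin_smooth_nabla_coeff])
         (use finite_below[of "(1, 0, 1)"] in \<open>auto simp: nabla_coeff_coords_def\<close>)
    moreover have "partial c_fxv (nabla_coeff Nabla3 Dv) p = - p c_f / p c_fvv" if p: "p \<in> reg_dom" for p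
    proof -
      have n: "p c_fvv \<noteq> 0" "(p c_fv)\<^sup>2 \<noteq> 0" using reg_dom_D[OF p] by auto
      show ?thesis
        unfolding nabla_coeff_fun partial_along
        by (rule has_along_D, rule has_along_eq, (rule has_along_intros | rule n)+)
           (use n in \<open>simp add: power2_eq_square\<close>)
    qed
    ultimately show ?thesis by (simp add: lead_def)
  qed
  from lead_nabla[OF this, of Nabla1]
  have 2: "lead (1, 1, 1) (\<lambda>p. (p c_v0 * p c_fv - p c_f) / p c_fv * (- p c_f / p c_fvv))
      (nabla Nabla1 (nabla_coeff Nabla3 Dv))"
    by simp
  then have 3: "fin_smooth ?C reg_dom (nabla Nabla1 (nabla_coeff Nabla3 Dv))"
    by (simp add: lead_def)
  have 4: "fin_smooth (below (1, 1, 1)) reg_dom (\<lambda>p. p c_fv / p c_f)"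
    by (intro fin_smooth_intros open_reg_dom fC) (auto dest: reg_dom_D)
  have K: "fin_smooth ?C reg_dom K_fun"
    unfolding K_fun_def
    by (intro fin_smooth_mult fin_smooth_diff 3 fin_smooth_mono[OF 1 _ fC(1)]
        fin_smooth_mono[OF 4 _ fC(1)]) auto
  have sm: "fin_smooth ?C reg_dom inv_K"
    by (rule fin_smooth_cong[OF K]) (simp add: inv_K_eq)
  have "partial (Fib (1, 1, 1)) inv_K p = (p c_v0 * p c_fv - p c_f) / p c_fvv"
    if p: "p \<in> reg_dom" for p
  proof -
    let ?w = "\<lambda>b. if b = Fib (1, 1, 1) then 1 else 0 :: real"
    have z: "has_along ?w p g 0" if "fin_smooth (below (1, 1, 1)) reg_dom g" for g
      by (rule has_along_eq[OF has_along_I[OF loc_smoothI[OF that] p]], unfold partial_along[symmetric])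
         (rule partial_zero[OF open_reg_dom fin_smoothD(4)[OF that] not_mem_below p])
    have y: "has_along ?w p (nabla Nabla1 (nabla_coeff Nabla3 Dv))
       ((p c_v0 * p c_fv - p c_f) / p c_fv * (- p c_f / p c_fvv))"
      by (rule has_along_eq[OF has_along_I[OF loc_smoothI[OF 3] p]], unfold partial_along[symmetric])
         (use 2 p in \<open>simp add: lead_def\<close>)
    have "has_along ?w p K_fun ((p c_v0 * p c_fv - p c_f) / p c_fvv)"
      unfolding K_fun_def
      by (rule has_along_eq[OF has_along_mult[OF z[OF 4] has_along_diff[OF z[OF 1] y]]])
         (use reg_dom_D[OF p] in \<open>simp add: field_simps\<close>)
    then have "has_along ?w p inv_K ((p c_v0 * p c_fv - p c_f) / p c_fvv)"
      by (rule has_along_cong[OF _ open_reg_dom p]) (simp add: inv_K_eq)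
    then show ?thesis unfolding partial_along by (rule has_along_D)
  qed
  then show ?thesis using sm by (simp add: lead_def)
qed

section \<open>The coordinates to be eliminated and the invariants replacing them\<close>

fun invariant_coord :: "coord \<Rightarrow> bool" where
  "invariant_coord (Base d) \<longleftrightarrow> False"
| "invariant_coord (Fib (i, j, l)) \<longleftrightarrow> l \<ge> 2 \<or> l = 1 \<and> i \<ge> 1 \<and> j \<ge> 1"

text \<open>The exponents count shifts from the leaders (0, 0, 2) of J and (1, 1, 1) of K.
  \<open>foldr\<close> applies the rightmost derivation first. The value at a base coordinate is a
  dummy.\<close>

fun coord_gen :: "coord \<Rightarrow> generator" where
  "coord_gen (Base d) = GenJ []"
| "coord_gen (Fib (i, j, l)) =
     (if l \<ge> 2 then GenJ (replicate i Nabla3 @ replicate j Nabla1 @ replicate (l - 2) Nabla2)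
      else GenK (replicate (i - 1) Nabla3 @ replicate (j - 1) Nabla1))"

fun coord_below :: "coord \<Rightarrow> coord set" where
  "coord_below (Base d) = {}"
| "coord_below (Fib \<sigma>) = below \<sigma>"

lemma wf_coord_below: "wf {(d, c). d \<in> coord_below c}"
proof -
  \<comment> \<open>\<open>Suc\<close> in the first component separates f itself, of order zero,
    from the base coordinates, which lie below it.\<close>
  let ?key = "\<lambda>c. case c of Base d \<Rightarrow> (0, 0, 0) | Fib (i, j, l) \<Rightarrow> (Suc (i + j + l), i, j)"
  have "{(d, c). d \<in> coord_below c} \<subseteq> inv_image (less_than <*lex*> less_than <*lex*> less_than) ?key"
  proof clarify
    fix d c assume "d \<in> coord_below c"
    then show "(d, c) \<in> inv_image (less_than <*lex*> less_than <*lex*> less_than) ?key"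
      by (cases c) auto
  qed
  then show ?thesis
    by (rule wf_subset[rotated]) (intro wf_inv_image wf_lex_prod wf_less_than)
qed

text \<open>The bound on the order is part of the claim so that the iteration can continue, also
  with \<open>Nabla3\<close>.\<close>

lemma lead_nabla_pow:
  assumes "lead \<sigma> \<alpha> h" "coord_order (Fib \<sigma>) \<ge> 2"
  shows "lead ((bump (nabla_dir i) ^^ n) \<sigma>) (\<lambda>p. nabla_coeff i (nabla_dir i) p ^ n * \<alpha> p)
      (foldr nabla (replicate n i) h)
    \<and> coord_order (Fib ((bump (nabla_dir i) ^^ n) \<sigma>)) \<ge> 2"
proof (induction n)
  case (Suc n)
  have "coord_order (Fib (bump d \<tau>)) = Suc (coord_order (Fib \<tau>))" for d \<tau>
    by (cases \<tau>; cases d) auto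
  moreover have "(if i = Nabla3 then 2 else 1) \<le> coord_order (Fib ((bump (nabla_dir i) ^^ n) \<sigma>))"
    using Suc by auto
  ultimately show ?case using Suc lead_nabla[of "(bump (nabla_dir i) ^^ n) \<sigma>"
      "\<lambda>p. nabla_coeff i (nabla_dir i) p ^ n * \<alpha> p" "foldr nabla (replicate n i) h" i]
  by (simp add: mult.assoc)
qed (use assms in simp)

lemma bump_pow:
  "(bump Dx ^^ n) (i, j, l) = (n + i, j, l)"
  "(bump Du ^^ n) (i, j, l) = (i, n + j, l)"
  "(bump Dv ^^ n) (i, j, l) = (i, j, n + l)"
  by (induction n) auto

text \<open>Each derivation multiplies the slope by its coefficient along \<open>nabla_dir\<close>,
  which is f, (v f_v - f) / f_v or f / f_v. So the slope never vanishes on \<open>reg_dom\<close>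
  and involves no jets beyond those of J, whatever the order of the generator.\<close>

lemma invariant_coord_lead:
  assumes "invariant_coord (Fib \<sigma>)"
  obtains \<alpha> where "lead \<sigma> \<alpha> (gen_fun (coord_gen (Fib \<sigma>)))" "\<And>p. p \<in> reg_dom \<Longrightarrow> \<alpha> p \<noteq> 0"
    "fin_smooth {c_v0, c_f, c_fv, c_fvv} reg_dom \<alpha>"
proof -
  obtain i j l where \<sigma>: "\<sigma> = (i, j, l)" by (cases \<sigma>)
  have nc0: "nabla_coeff i (nabla_dir i) p \<noteq> 0" if "p \<in> reg_dom" for i p
    using reg_dom_D[OF that] by (cases i) auto
  have ncs: "fin_smooth {c_v0, c_f, c_fv, c_fvv} reg_dom (nabla_coeff i (nabla_dir i))" for i
    by (cases i) (auto simp: nabla_coeff_fun open_reg_dom dest: reg_dom_D intro!: fin_smooth_intros)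
  show ?thesis
  proof (cases "l \<ge> 2")
    case True
    have l2: "Suc (Suc (l - 2)) = l" using True by simp
    define \<alpha> where "\<alpha> p = nabla_coeff Nabla3 (nabla_dir Nabla3) p ^ i * (nabla_coeff Nabla1 (nabla_dir Nabla1) p ^ j *
      (nabla_coeff Nabla2 (nabla_dir Nabla2) p ^ (l - 2) *
        ((p c_f)\<^sup>2 / ((p c_v0 * p c_fv - p c_f) * (p c_fv)\<^sup>2))))" for p
    have 1: "lead (0, 0, l) (\<lambda>p. nabla_coeff Nabla2 (nabla_dir Nabla2) p ^ (l - 2) *
         ((p c_f)\<^sup>2 / ((p c_v0 * p c_fv - p c_f) * (p c_fv)\<^sup>2)))
         (foldr nabla (replicate (l - 2) Nabla2) inv_J)"
      using lead_nabla_pow[OF lead_inv_J, where i = Nabla2 and n = "l - 2"]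
      by (simp add: bump_pow l2 del: nabla_coeff.simps)
    have 2: "lead (0, j, l) (\<lambda>p. nabla_coeff Nabla1 (nabla_dir Nabla1) p ^ j *
       (nabla_coeff Nabla2 (nabla_dir Nabla2) p ^ (l - 2) *
         ((p c_f)\<^sup>2 / ((p c_v0 * p c_fv - p c_f) * (p c_fv)\<^sup>2))))
         (foldr nabla (replicate j Nabla1 @ replicate (l - 2) Nabla2) inv_J)"
      using lead_nabla_pow[OF 1, where i = Nabla1 and n = j] True by (simp add: bump_pow del: nabla_coeff.simps)
    have "lead (i, j, l) \<alpha> (gen_fun (coord_gen (Fib \<sigma>)))"
      using lead_nabla_pow[OF 2, where i = Nabla3 and n = i] True
      unfolding \<alpha>_def by (simp add: bump_pow \<sigma> del: nabla_coeff.simps)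
    moreover have "\<alpha> p \<noteq> 0" if "p \<in> reg_dom" for p
      using nc0[OF that] reg_dom_D[OF that] by (simp add: \<alpha>_def del: nabla_coeff.simps nabla_dir.simps)
    moreover have "fin_smooth {c_v0, c_f, c_fv, c_fvv} reg_dom \<alpha>"
      unfolding \<alpha>_def
      by (intro fin_smooth_intros ncs open_reg_dom) (auto simp: mem_reg_dom)
    ultimately show ?thesis using that unfolding \<sigma> by blast
  next
    case False
    with assms have l: "l = 1" "Suc (i - 1) = i" "Suc (j - 1) = j" by (auto simp: \<sigma>)
    define \<alpha> where "\<alpha> p = nabla_coeff Nabla3 (nabla_dir Nabla3) p ^ (i - 1) * (nabla_coeff Nabla1 (nabla_dir Nabla1) p ^ (j - 1) *
      ((p c_v0 * p c_fv - p c_f) / p c_fvv))" for p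
    have 1: "lead (1, j, 1) (\<lambda>p. nabla_coeff Nabla1 (nabla_dir Nabla1) p ^ (j - 1) *
         ((p c_v0 * p c_fv - p c_f) / p c_fvv))
         (foldr nabla (replicate (j - 1) Nabla1) inv_K)"
      using lead_nabla_pow[OF lead_inv_K, where i = Nabla1 and n = "j - 1"] l
      by (simp add: bump_pow l del: nabla_coeff.simps)
    have "lead (i, j, l) \<alpha> (gen_fun (coord_gen (Fib \<sigma>)))"
      using lead_nabla_pow[OF 1, where i = Nabla3 and n = "i - 1"] l
      unfolding \<alpha>_def by (simp add: bump_pow \<sigma> del: nabla_coeff.simps)
    moreover have "\<alpha> p \<noteq> 0" if "p \<in> reg_dom" for p
      using nc0[OF that] reg_dom_D[OF that] by (simp add: \<alpha>_def del: nabla_coeff.simps nabla_dir.simps)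
    moreover have "fin_smooth {c_v0, c_f, c_fv, c_fvv} reg_dom \<alpha>"
      unfolding \<alpha>_def
      by (intro fin_smooth_intros ncs open_reg_dom) (auto simp: mem_reg_dom)
    ultimately show ?thesis using that unfolding \<sigma> by blast
  qed
qed

lemma solvable_gen:
  assumes "invariant_coord c"
  shows "solvable reg_dom (coord_below c) c (gen_fun (coord_gen c))"
proof -
  obtain \<sigma> where c: "c = Fib \<sigma>" using assms by (cases c) auto
  show ?thesis
  proof (cases "\<sigma> = (0, 0, 2)")
    case True
    text \<open>Here the second derivative itself is solved for, so the domain must not involve it.\<close>
    define D :: "jet set" where "D = {p. p c_f \<noteq> 0} \<inter> ({p. p c_fv \<noteq> 0} \<inter> {p. p c_v0 * p c_fv - p c_f \<noteq> 0})"
    define \<alpha> where "\<alpha> p = (p c_f)\<^sup>2 / ((p c_v0 * p c_fv - p c_f) * (p c_fv)\<^sup>2)" for p :: jet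
    have oD: "open D" unfolding D_def
      by (intro open_Int open_Collect_neq continuous_intros continuous_on_coord)
    have fin: "finite (below (0, 0, 2))" by (rule finite_below)
    have h: "fin_smooth (insert c_fvv (below (0, 0, 2))) D inv_J"
      unfolding inv_J_eq
      by (intro fin_smooth_intros oD finite.insertI fin) (auto simp: D_def)
    have a: "fin_smooth (below (0, 0, 2)) D \<alpha>"
      unfolding \<alpha>_def
      by (intro fin_smooth_intros oD fin) (auto simp: D_def)
    have "partial c_fvv inv_J p = \<alpha> p" if p: "p \<in> D" for p
    proof -
      have d: "(p c_v0 * p c_fv - p c_f) * (p c_fv)\<^sup>2 \<noteq> 0" using p by (simp add: D_def)
      show ?thesis
        unfolding inv_J_eq partial_along \<alpha>_def
        by (rule has_along_D, rule has_along_eq, (rule has_along_intros | rule d)+)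
           (use d in \<open>simp add: power2_eq_square\<close>)
    qed
    then show ?thesis
      unfolding solvable_def c True
      using h a not_mem_below[of "(0, 0, 2)"]
      by (intro conjI exI[of _ D] exI[of _ \<alpha>])
         (auto simp: D_def mem_reg_dom \<alpha>_def numeral_2_eq_2)
  next
    case False
    obtain i j l where \<sigma>: "\<sigma> = (i, j, l)" by (cases \<sigma>)
    \<comment> \<open>Every eliminated coordinate other than f_vv has order at least three. All
      coordinates entering the conditions of \<open>reg_dom\<close> then lie below it, so
      \<open>reg_dom\<close> can be the domain of solvability.\<close>
    have ord: "i + j + l \<ge> 3"
    proof (rule ccontr)
      assume "\<not> i + j + l \<ge> 3"
      then have "l = 2 \<and> i = 0 \<and> j = 0" using assms by (auto simp: c \<sigma>)
      then show False using False \<sigma> by simp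
    qed
    then have sub: "{c_v0, c_f, c_fv, c_fvv} \<subseteq> below \<sigma>" by (auto simp: \<sigma>)
    obtain \<alpha> where \<alpha>: "lead \<sigma> \<alpha> (gen_fun (coord_gen (Fib \<sigma>)))" "\<And>p. p \<in> reg_dom \<Longrightarrow> \<alpha> p \<noteq> 0"
      "fin_smooth {c_v0, c_f, c_fv, c_fvv} reg_dom \<alpha>"
      using invariant_coord_lead assms unfolding c by blast
    have a: "fin_smooth (below \<sigma>) reg_dom \<alpha>"
      by (rule fin_smooth_mono[OF \<alpha>(3) sub finite_below])
    have "q \<in> reg_dom" if "p \<in> reg_dom" "\<forall>b\<in>below \<sigma>. p b = q b" for p q
      using that sub unfolding mem_reg_dom by (simp add: subset_iff)
    then show ?thesis
      unfolding solvable_def c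
      using \<alpha> a not_mem_below[of \<sigma>]
      by (intro conjI exI[of _ reg_dom] exI[of _ \<alpha>]) (auto simp: lead_def)
  qed
qed

lemma fin_smooth_gen:
  assumes "invariant_coord c" "c \<in> jcoords m"
  shows "fin_smooth (jcoords m) reg_dom (gen_fun (coord_gen c))" "insert c (coord_below c) \<subseteq> jcoords m"
proof -
  obtain \<sigma> where c: "c = Fib \<sigma>" using assms by (cases c) auto
  show sub: "insert c (coord_below c) \<subseteq> jcoords m"
    using below_subset_jcoords[of \<sigma>] assms(2) by (auto simp: c jcoords_def)
  obtain \<alpha> where "lead \<sigma> \<alpha> (gen_fun (coord_gen (Fib \<sigma>)))"
    using invariant_coord_lead assms(1) unfolding c by blast
  then show "fin_smooth (jcoords m) reg_dom (gen_fun (coord_gen c))"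
    using sub finite_jcoords by (auto simp: c lead_def intro: fin_smooth_mono)
qed

text \<open>At \<open>q\<close> the components of the feedback fields in finitely many non-eliminated coordinates span
  the whole space. An invariant, written in the new coordinates, gives the relation whose
  coefficients \<open>\<mu>\<close> are its partial derivatives.\<close>

definition pivots_independent :: "jet \<Rightarrow> bool" where
  "pivots_independent q \<longleftrightarrow> (\<forall>P \<mu>. finite P \<and> (\<forall>c\<in>P. \<not> invariant_coord c) \<and>
     (\<forall>a b. smooth_feedback a b \<longrightarrow> (\<Sum>c\<in>P. \<mu> c * feedback_field a b c q) = 0) \<longrightarrow>
     (\<forall>c\<in>P. \<mu> c = 0))"

text \<open>In the new coordinates \<open>g\<close> becomes \<open>H\<close>. The replaced
  coordinates are invariants, so along a feedback field they contribute nothing, and invariance of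
  \<open>g\<close> is a linear relation between the field components at the pivots with partials of
  \<open>H\<close> as coefficients. Independence kills these, so near \<open>p\<close> only the
  generators matter.\<close>

lemma locally_generated_if_independent:
  assumes ind: "\<And>q. q \<in> reg_dom \<Longrightarrow> pivots_independent q"
    and UN: "U \<subseteq> reg_dom" and inv: "feedback_invariant m U g" and p: "p \<in> U"
  shows "locally_generated U g p"
proof -
  define C where "C = jcoords m"
  define A where "A = {c \<in> C. invariant_coord c}"
  define h where "h c = gen_fun (coord_gen c)" for c
  have fin: "finite C" "finite A" using finite_jcoords by (simp_all add: C_def A_def)
  have g: "fin_smooth C U g"
    using inv by (simp add: feedback_invariant_def C_def smooth_jet_fun_fin_smooth)
  note oU = fin_smoothD(1)[OF g]
  have hC: "fin_smooth C reg_dom (h c)" "insert c (coord_below c) \<subseteq> C" if "c \<in> A" for c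
    using fin_smooth_gen that by (auto simp: A_def C_def h_def)
  have hU: "fin_smooth C U (h c)" if "c \<in> A" for c
    by (rule fin_smooth_subset[OF hC(1)[OF that] UN oU])
  have sol: "solvable U (coord_below c) c (h c)" if "c \<in> A" for c
    unfolding h_def by (rule solvable_subset[OF solvable_gen UN]) (use that in \<open>simp add: A_def\<close>)
  obtain V H where H: "fin_smooth C V H"
    and U: "\<And>q. q \<in> U \<Longrightarrow> subst_coords A h q \<in> V" "\<And>q. q \<in> U \<Longrightarrow> g q = H (subst_coords A h q)"
    and V: "\<And>y. y \<in> V \<Longrightarrow> \<exists>q\<in>U. subst_coords A h q = y"
    by (rule eliminate[OF g wf_coord_below fin(2) sol hC(2)]) blast+
  have zero: "partial c H y = 0" if y: "y \<in> V" and c: "c \<in> C - A" for y c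
  proof -
    obtain q where q: "q \<in> U" "subst_coords A h q = y" using V[OF y] by blast
    have "(\<Sum>c\<in>C - A. partial c H y * feedback_field a b c q) = 0" if ab: "smooth_feedback a b" for a b
    proof -
      interpret feedback a b by unfold_locales (rule ab)
      have "along (\<lambda>c. X c q) g q = 0"
        using inv q ab unfolding feedback_invariant_def
        by (simp add: along_eq[OF g q(1)] C_def)
      then have "0 = (\<Sum>c\<in>C. partial c H y * (if c \<in> A then along (\<lambda>c. X c q) (h c) q else X c q))"
        using along_subst_coords[OF g H hU U q(1), of "\<lambda>c. X c q"] q(2) by simp
      also have "\<dots> = (\<Sum>c\<in>C - A. partial c H y * X c q)"
      proof (rule sum.mono_neutral_cong_right[OF fin(1)])
        show "\<forall>c\<in>C - (C - A). partial c H y * (if c \<in> A then along (\<lambda>c. X c q) (h c) q else X c q) = 0"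
          using X_gen_fun[of q] UN q(1) by (auto simp: h_def)
      qed auto
      finally show ?thesis by simp
    qed
    moreover have "\<forall>c\<in>C - A. \<not> invariant_coord c" by (auto simp: A_def)
    moreover have "q \<in> reg_dom" using q UN by auto
    ultimately have "\<forall>c\<in>C - A. partial c H y = 0"
      using ind[of q, unfolded pivots_independent_def, rule_format, of "C - A" "\<lambda>c. partial c H y"]
        fin(1) by auto
    then show ?thesis using c by simp
  qed
  define y0 where "y0 = subst_coords A h p"
  have "y0 \<in> V" using U p by (simp add: y0_def)
  then obtain F e where F: "finite F" "e > 0" and box: "{y. \<forall>c\<in>F. \<bar>y c - y0 c\<bar> < e} \<subseteq> V"
    by (rule open_fun_contains_box[OF fin_smoothD(1)[OF H]])
  define B where "B = {y. \<forall>c\<in>F. \<bar>y c - y0 c\<bar> < e}"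
  have oB: "open B" unfolding B_def by (rule open_box[OF F(1)])
  have BV: "B \<subseteq> V" using box by (simp add: B_def)
  define W where "W = U \<inter> subst_coords A h -` B"
  have "continuous_on U (\<lambda>q. subst_coords A h q c)" for c
    by (cases "c \<in> A") (simp_all add: subst_coords_def continuous_on_coord fin_smoothD(5)[OF hU])
  then have "continuous_on U (subst_coords A h)"
    by (rule continuous_on_coordinatewise_then_product)
  then have oW: "open W"
    unfolding W_def by (rule continuous_open_preimage[OF _ oU oB])
  have pW: "p \<in> W" using p F(2) by (simp add: W_def B_def y0_def)
  \<comment> \<open>A point rebuilt from generator values alone: the pivots are frozen at their
    values at \<open>p\<close>. \<open>H\<close> composed with this map is the required function of
    the generators.\<close>
  define T where "T s = (\<lambda>c. if c \<in> A then s (coord_gen c) else y0 c)" for s :: "generator \<Rightarrow> real"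
  define V' where "V' = T -` B"
  have Ts: "Ck n UNIV (\<lambda>s. T s c)" for n c
    by (cases "c \<in> A") (simp_all add: T_def Ck_coord Ck_const)
  have "continuous_on UNIV T"
    by (rule continuous_on_coordinatewise_then_product) (use Ts[of 0] in simp)
  then have oV': "open V'" unfolding V'_def by (intro open_vimage oB)
  have smG: "Ck n V' (\<lambda>s. H (T s))" for n
    by (rule Ck_compose[OF oV' fin_smoothD(1)[OF H] _ fin_smoothD(2)[OF H] fin_smoothD(3,4)[OF H]
          Ck_subset[OF Ts]]) (use BV in \<open>auto simp: V'_def\<close>)
  have dep: "depends_only (coord_gen ` A) V' (\<lambda>s. H (T s))"
    unfolding depends_only_def
  proof (intro ballI impI)
    fix s t :: "generator \<Rightarrow> real" assume "\<forall>c\<in>coord_gen ` A. s c = t c"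
    then have "T s = T t" by (auto simp: T_def)
    then show "H (T s) = H (T t)" by simp
  qed
  have val: "(\<lambda>s. gen_fun s q) \<in> V' \<and> g q = H (T (\<lambda>s. gen_fun s q))" if q: "q \<in> W" for q
  proof -
    have 1: "subst_coords A h q \<in> B" "q \<in> U" using q by (auto simp: W_def)
    have 2: "T (\<lambda>s. gen_fun s q) \<in> B"
      using 1 F(2) by (auto simp: B_def T_def subst_coords_def h_def)
    have "H (subst_coords A h q) = H (T (\<lambda>s. gen_fun s q))"
      by (rule const_in_box[OF H box zero, of A])
         (use 1 2 in \<open>auto simp: B_def T_def subst_coords_def h_def\<close>)
    then show ?thesis using 2 U(2)[OF 1(2)] by (simp add: V'_def)
  qed
  show ?thesis
    unfolding locally_generated_def
    by (rule exI[of _ W], rule exI[of _ "coord_gen ` A"], rule exI[of _ V'], rule exI[of _ "\<lambda>s. H (T s)"])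
       (use oW pW oV' smG dep val fin in \<open>auto simp: W_def smooth_on_iff_Ck\<close>)
qed

lemma has_jet_order_lead:
  assumes h: "lead \<sigma> \<alpha> h" "coord_order (Fib \<sigma>) = n" and p: "p \<in> reg_dom" "\<alpha> p \<noteq> 0"
  shows "has_jet_order n reg_dom h"
proof -
  have f: "fin_smooth (insert (Fib \<sigma>) (below \<sigma>)) reg_dom h"
    "partial (Fib \<sigma>) h p = \<alpha> p" using h p by (simp_all add: lead_def)
  have "depends_only (jcoords n) reg_dom h"
    using depends_only_mono[OF fin_smoothD(4)[OF f(1)], of "jcoords n" reg_dom]
      below_subset_jcoords[of \<sigma>] h(2) by auto
  moreover have "\<not> depends_only (jcoords m) reg_dom h" if "m < n" for m
    using partial_zero[OF open_reg_dom _ _ p(1), of "jcoords m" h "Fib \<sigma>"] that f(2) p(2) h(2)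
    by (auto simp: jcoords_def)
  ultimately show ?thesis by (simp add: has_jet_order_def)
qed

section \<open>Monomial test fields\<close>

text \<open>Centred at the base point of \<open>q\<close> and divided by factorials, so that exactly
  one mixed derivative is nonzero at \<open>q\<close>, with value 1.\<close>

definition bmono :: "jet \<Rightarrow> nat \<Rightarrow> nat \<Rightarrow> jet \<Rightarrow> real" where
  "bmono q k l p = (p c_x0 - q c_x0) ^ k / fact k * ((p c_u0 - q c_u0) ^ l / fact l)"

text \<open>The x-derivative; exponent zero is a separate case because truncated subtraction would
  not give zero.\<close>

definition bmono_x :: "jet \<Rightarrow> nat \<Rightarrow> nat \<Rightarrow> jet \<Rightarrow> real" where
  "bmono_x q k l p = (if k = 0 then 0 else bmono q (k - 1) l p)"

definition bmono_u :: "jet \<Rightarrow> nat \<Rightarrow> nat \<Rightarrow> jet \<Rightarrow> real" where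
  "bmono_u q k l p = (if l = 0 then 0 else bmono q k (l - 1) p)"

lemma bmono_self: "bmono q k l q = (if k = 0 \<and> l = 0 then 1 else 0)"
  by (auto simp: bmono_def power_0_left)

lemma loc_smooth_bmono: "loc_smooth UNIV (bmono q k l)"
  unfolding bmono_def by (intro loc_smooth_intros open_UNIV) auto

lemma has_along_divided_power:
  "has_along w p (\<lambda>p. (p c - a) ^ k / fact k) (w c * (if k = 0 then 0 else (p c - a) ^ (k - 1) / fact (k - 1)))"
proof (rule has_along_finI[of "{c}"])
  show "fin_smooth {c} UNIV (\<lambda>p. (p c - a) ^ k / fact k)"
    by (intro fin_smooth_intros) auto
  have "partial c (\<lambda>p. (p c - a) ^ k / fact k) p
      = (if k = 0 then 0 else (p c - a) ^ (k - 1) / fact (k - 1))"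
  proof (cases k)
    case (Suc n)
    have "((\<lambda>t. (t - a) ^ Suc n / fact (Suc n)) has_real_derivative (p c - a) ^ n / fact n) (at (p c))"
      by (rule derivative_eq_intros refl)+ (simp_all add: divide_simps)
    then show ?thesis unfolding Suc by (intro partial_eqI) simp
  qed (simp add: partial_along)
  then show "(\<Sum>b\<in>{c}. w b * partial b (\<lambda>p. (p c - a) ^ k / fact k) p)
      = w c * (if k = 0 then 0 else (p c - a) ^ (k - 1) / fact (k - 1))"
    by simp
qed

lemma has_along_bmono:
  "has_along w p (bmono q k l) (w c_x0 * bmono_x q k l p + w c_u0 * bmono_u q k l p)"
  unfolding bmono_def
  by (rule has_along_eq[OF has_along_mult[OF has_along_divided_power has_along_divided_power]])
     (simp add: bmono_x_def bmono_u_def bmono_def algebra_simps)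

lemma loc_smooth_bmono_xu: "loc_smooth UNIV (bmono_x q k l)" "loc_smooth UNIV (bmono_u q k l)"
proof -
  have "bmono_x q k l = (if k = 0 then (\<lambda>_. 0) else bmono q (k - 1) l)"
    "bmono_u q k l = (if l = 0 then (\<lambda>_. 0) else bmono q k (l - 1))"
    by (auto simp: bmono_x_def bmono_u_def)
  then show "loc_smooth UNIV (bmono_x q k l)" "loc_smooth UNIV (bmono_u q k l)"
    by (simp_all add: loc_smooth_const loc_smooth_bmono)
qed

lemma has_along_bmono_xu:
  "w c_x0 = 0 \<Longrightarrow> w c_u0 = 0 \<Longrightarrow> has_along w p (bmono_x q k l) 0"
  "w c_x0 = 0 \<Longrightarrow> w c_u0 = 0 \<Longrightarrow> has_along w p (bmono_u q k l) 0"
proof -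
  have e: "bmono_x q k l = (if k = 0 then (\<lambda>_. 0) else bmono q (k - 1) l)"
    "bmono_u q k l = (if l = 0 then (\<lambda>_. 0) else bmono q k (l - 1))"
    by (auto simp: bmono_x_def bmono_u_def)
  assume w: "w c_x0 = 0" "w c_u0 = 0"
  have b: "has_along w p (bmono q k l) 0" for k l
    by (rule has_along_eq[OF has_along_bmono]) (simp add: w)
  show "has_along w p (bmono_x q k l) 0" "has_along w p (bmono_u q k l) 0"
    unfolding e using b by (simp_all add: has_along_const)
qed

lemma total_deriv_bmono_mult:
  assumes "loc_smooth UNIV h"
  shows "total_deriv Dx (\<lambda>p. bmono q k l p * h p)
      = (\<lambda>p. bmono_x q k l p * h p + bmono q k l p * total_deriv Dx h p)"
    "total_deriv Du (\<lambda>p. bmono q k l p * h p)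
      = (\<lambda>p. bmono_u q k l p * h p + bmono q k l p * total_deriv Du h p)"
  by (rule ext, rule total_deriv_eqI,
      rule has_along_eq[OF has_along_mult[OF has_along_bmono has_along_total_deriv[OF assms]]], simp)+

lemma total_deriv_funpow_add:
  assumes "loc_smooth UNIV g" "loc_smooth UNIV h"
  shows "(total_deriv d ^^ n) (\<lambda>p. g p + h p)
    = (\<lambda>p. (total_deriv d ^^ n) g p + (total_deriv d ^^ n) h p)"
proof (induction n)
  case (Suc n)
  show ?case
    by (rule ext) (auto simp: Suc intro!: total_deriv_eqI has_along_add has_along_total_deriv
        loc_smooth_funpow assms)
qed simp

lemma total_deriv_funpow_0: "(total_deriv d ^^ n) (\<lambda>_. 0) = (\<lambda>_. 0)"
  by (induction n) (auto simp: total_deriv_const)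

section \<open>Iterated derivatives of monomial multiples at the centre\<close>

definition Dxu :: "nat \<Rightarrow> nat \<Rightarrow> (jet \<Rightarrow> real) \<Rightarrow> jet \<Rightarrow> real" where
  "Dxu i j g = (total_deriv Dx ^^ i) ((total_deriv Du ^^ j) g)"

lemma Dxu_add:
  "loc_smooth UNIV g \<Longrightarrow> loc_smooth UNIV h \<Longrightarrow>
    Dxu i j (\<lambda>p. g p + h p) = (\<lambda>p. Dxu i j g p + Dxu i j h p)"
  unfolding Dxu_def by (simp add: total_deriv_funpow_add loc_smooth_funpow)

lemma Dxu_0: "Dxu i j (\<lambda>_. 0) = (\<lambda>_. 0)"
  unfolding Dxu_def by (simp add: total_deriv_funpow_0)

lemma Dxu_Suc_x: "loc_smooth UNIV g \<Longrightarrow> Dxu (Suc i) j g = Dxu i j (total_deriv Dx g)"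
  unfolding Dxu_def by (simp add: funpow_swap1 total_deriv_funpow_commute)

lemma Dxu_Suc_u: "Dxu i (Suc j) g = Dxu i j (total_deriv Du g)"
  unfolding Dxu_def by (simp add: funpow_swap1)

lemma loc_smooth_bmono_mult: "loc_smooth UNIV h \<Longrightarrow> loc_smooth UNIV (\<lambda>p. bmono q k l p * h p)"
  by (intro loc_smooth_mult loc_smooth_bmono)

text \<open>Fewer than k + l derivatives cannot undo the zero of the monomial at \<open>q\<close>.
  With exactly k + l of them, all must fall on the monomial and in the right directions.\<close>

lemma Dxu_bmono:
  "loc_smooth UNIV h \<Longrightarrow> i + j \<le> k + l \<Longrightarrow>
    Dxu i j (\<lambda>p. bmono q k l p * h p) q = (if i = k \<and> j = l then h q else 0)"
proof (induction "i + j" arbitrary: i j k l h)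
  case 0
  then show ?case by (simp add: Dxu_def bmono_self)
next
  case (Suc n)
  note h = Suc.prems(1)
  note Dh = loc_smooth_total_deriv[OF h]
  show ?case
  proof (cases i)
    case (Suc i')
    have n: "n = i' + j" using Suc Suc.hyps(2) by simp
    \<comment> \<open>The term in which one derivative was spent on \<open>h\<close>: too few are
      left for the monomial.\<close>
    have 1: "Dxu i' j (\<lambda>p. bmono q k l p * total_deriv Dx h p) q = 0"
      using Suc.hyps(1)[OF n Dh, of k l] Suc.prems(2) Suc by auto
    have e: "Dxu i j (\<lambda>p. bmono q k l p * h p) q = Dxu i' j (\<lambda>p. bmono_x q k l p * h p) q"
      unfolding Suc Dxu_Suc_x[OF loc_smooth_bmono_mult[OF h]] total_deriv_bmono_mult(1)[OF h]
      using 1 by (simp add: Dxu_add loc_smooth_mult loc_smooth_bmono loc_smooth_bmono_xu h Dh)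
    show ?thesis
    proof (cases k)
      case 0
      then show ?thesis unfolding e using Suc by (simp add: bmono_x_def Dxu_0)
    next
      case (Suc k')
      then show ?thesis unfolding e
        using Suc.hyps(1)[OF n h, of k' l] Suc.prems(2) \<open>i = Suc i'\<close> by (simp add: bmono_x_def)
    qed
  next
    case 0
    then obtain j' where j: "j = Suc j'" "n = i + j'" using Suc.hyps(2) by (cases j) auto
    have 1: "Dxu i j' (\<lambda>p. bmono q k l p * total_deriv Du h p) q = 0"
      using Suc.hyps(1)[OF j(2) Dh, of k l] Suc.prems(2) j(1) by auto
    have e: "Dxu i j (\<lambda>p. bmono q k l p * h p) q = Dxu i j' (\<lambda>p. bmono_u q k l p * h p) q"
      unfolding j(1) Dxu_Suc_u total_deriv_bmono_mult(2)[OF h]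
      using 1 by (simp add: Dxu_add loc_smooth_mult loc_smooth_bmono loc_smooth_bmono_xu h Dh)
    show ?thesis
    proof (cases l)
      case 0
      then show ?thesis unfolding e using j by (simp add: bmono_u_def Dxu_0)
    next
      case (Suc l')
      then show ?thesis unfolding e
        using Suc.hyps(1)[OF j(2) h, of k l'] Suc.prems(2) j(1) by (simp add: bmono_u_def)
    qed
  qed
qed

lemma Dxu_bmono_xu:
  assumes "loc_smooth UNIV h" "i + j < k + l"
  shows "Dxu i j (\<lambda>p. bmono_x q k l p * h p) q = (if Suc i = k \<and> j = l then h q else 0)"
    "Dxu i j (\<lambda>p. bmono_u q k l p * h p) q = (if i = k \<and> Suc j = l then h q else 0)"
proof -
  show "Dxu i j (\<lambda>p. bmono_x q k l p * h p) q = (if Suc i = k \<and> j = l then h q else 0)"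
    using Dxu_bmono[OF assms(1), of i j "k - 1" l q] assms(2)
    by (cases k) (simp_all add: bmono_x_def Dxu_0)
  show "Dxu i j (\<lambda>p. bmono_u q k l p * h p) q = (if i = k \<and> Suc j = l then h q else 0)"
    using Dxu_bmono[OF assms(1), of i j k "l - 1" q] assms(2)
    by (cases l) (simp_all add: bmono_u_def Dxu_0)
qed

section \<open>Values of the test fields at the pivots\<close>

definition test_a :: "jet \<Rightarrow> nat \<Rightarrow> real \<Rightarrow> real" where
  "test_a q n x = (x - q c_x0) ^ n / fact n"

definition test_b :: "jet \<Rightarrow> nat \<Rightarrow> nat \<Rightarrow> real \<Rightarrow> real \<Rightarrow> real" where
  "test_b q k l x u = (x - q c_x0) ^ k / fact k * ((u - q c_u0) ^ l / fact l)"

lemma lift_test: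
  "lift_a (test_a q n) = bmono q n 0" "lift_b (test_b q k l) = bmono q k l"
  "lift_a (\<lambda>_. 0) = (\<lambda>_. 0)" "lift_b (\<lambda>_ _. 0) = (\<lambda>_. 0)"
  by (auto simp: lift_a_def lift_b_def test_a_def test_b_def bmono_def)

lemma smooth_test: "smooth_feedback (test_a q n) (\<lambda>_ _. 0)" "smooth_feedback (\<lambda>_. 0) (test_b q k l)"
  by (simp_all add: smooth_feedback_def lift_test smooth_on_iff_Ck Ck_const
      loc_smooth_Ck[OF loc_smooth_bmono])

lemma partial_bmono:
  "partial c_x0 (bmono q k l) = bmono_x q k l" "partial c_u0 (bmono q k l) = bmono_u q k l"
  by (rule ext, rule trans[OF partial_along], rule has_along_D, rule has_along_eq[OF has_along_bmono], simp)+

context feedback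
begin

lemma characteristic_eq:
  "characteristic (feedback_base a b) (feedback_vertical a) =
    (\<lambda>p. ax p * p c_f - (lift_a a p * p c_fx + (lift_b b p * p c_fu
       + (p c_v0 * bu p + p c_f * bx p) * p c_fv)))"
  by (rule ext) (simp add: characteristic_def feedback_vertical_def ax_def bx_def bu_def)

lemma X_Fib_vanishing:
  assumes "lift_a a q = 0" "lift_b b q = 0" "bx q = 0" "bu q = 0"
  shows "X (Fib (i, j, l)) q
    = Dxu i j ((total_deriv Dv ^^ l) (characteristic (feedback_base a b) (feedback_vertical a))) q"
  using assms by (simp add: X_Fib X_base Dxu_def)

end

text \<open>For k + l \<ge> 2 the base components vanish at \<open>q\<close>, so the coefficient is
  the iterated total derivative of the characteristic - b f_u - b_u v f_v - b_x f f_v. With fewer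
  than k + l derivatives the first term contributes nothing, and the other two only when b_u or b_x
  is differentiated to the top. The case of one \<open>Dv\<close> is the same after replacing the
  cofactors by their \<open>Dv\<close>-derivatives.\<close>

lemma X_test_b:
  fixes q :: jet
  assumes n: "k + l \<ge> 2" and ij: "i + j < k + l"
  defines "Y \<equiv> \<lambda>c. feedback_field (\<lambda>_. 0) (test_b q k l) c q"
  shows "Y (Base d) = 0"
    "Y (Fib (i, j, 0)) = (if i = k \<and> Suc j = l then - (q c_v0 * q c_fv) else 0)
        + (if Suc i = k \<and> j = l then - (q c_f * q c_fv) else 0)"
    "Y (Fib (i, j, Suc 0)) = (if i = k \<and> Suc j = l then - (q c_fv + q c_v0 * q c_fvv) else 0)
        + (if Suc i = k \<and> j = l then - (q c_fv * q c_fv + q c_f * q c_fvv) else 0)"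
proof -
  interpret feedback "\<lambda>_. 0" "test_b q k l" by unfold_locales (rule smooth_test)
  have b: "bx = bmono_x q k l" "bu = bmono_u q k l" "ax = (\<lambda>_. 0)"
    by (auto simp: bx_def bu_def ax_def lift_test partial_bmono partial_along)
  have z: "bmono q k l q = 0" "bx q = 0" "bu q = 0"
    using n by (auto simp: b bmono_x_def bmono_u_def bmono_self)
  show "Y (Base d) = 0" unfolding Y_def by (cases d) (simp_all add: X_base lift_test z)
  let ?Q = "characteristic (feedback_base (\<lambda>_. 0) (test_b q k l)) (feedback_vertical (\<lambda>_. 0))"
  have Q: "?Q = (\<lambda>p. bmono q k l p * (- p c_fu) +
      (bmono_u q k l p * (- (p c_v0 * p c_fv)) + bmono_x q k l p * (- (p c_f * p c_fv))))"
    unfolding characteristic_eq by (rule ext) (simp add: b lift_test algebra_simps)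
  have DQ: "total_deriv Dv ?Q = (\<lambda>p. bmono q k l p * (- p c_fuv) +
      (bmono_u q k l p * (- (p c_fv + p c_v0 * p c_fvv))
        + bmono_x q k l p * (- (p c_fv * p c_fv + p c_f * p c_fvv))))"
    unfolding Q
    by (rule ext, rule total_deriv_eqI, rule has_along_eq,
        (rule has_along_intros has_along_bmono has_along_bmono_xu | simp add: algebra_simps)+)
  have E: "Dxu i j (\<lambda>p. bmono q k l p * f p + (bmono_u q k l p * g p + bmono_x q k l p * h p)) q
     = (if i = k \<and> Suc j = l then g q else 0) + (if Suc i = k \<and> j = l then h q else 0)"
    if "loc_smooth UNIV f" "loc_smooth UNIV g" "loc_smooth UNIV h" for f g h
    using that Dxu_bmono[OF that(1), of i j k l q] ij
    by (auto simp: Dxu_add loc_smooth_add loc_smooth_mult loc_smooth_bmono loc_smooth_bmono_xu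
        Dxu_bmono_xu)
  note X = X_Fib_vanishing[of q, unfolded lift_test, OF refl z]
  show "Y (Fib (i, j, 0)) = (if i = k \<and> Suc j = l then - (q c_v0 * q c_fv) else 0)
        + (if Suc i = k \<and> j = l then - (q c_f * q c_fv) else 0)"
    unfolding Y_def X funpow_0 Q by (rule E) (intro loc_smooth_intros open_UNIV)+
  show "Y (Fib (i, j, Suc 0)) = (if i = k \<and> Suc j = l then - (q c_fv + q c_v0 * q c_fvv) else 0)
        + (if Suc i = k \<and> j = l then - (q c_fv * q c_fv + q c_f * q c_fvv) else 0)"
    unfolding Y_def X funpow.simps o_apply id_apply DQ by (rule E) (intro loc_smooth_intros open_UNIV)+
qed

text \<open>Here the characteristic is a_x f - a f_x. With fewer than n derivatives, only n - 1
  derivatives in x applied to a_x give a nonzero value at \<open>q\<close>.\<close>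

lemma X_test_a:
  fixes q :: jet
  assumes n: "n \<ge> 2" and ij: "i + j < n"
  defines "Y \<equiv> \<lambda>c. feedback_field (test_a q n) (\<lambda>_ _. 0) c q"
  shows "Y (Base d) = 0"
    "Y (Fib (i, j, 0)) = (if Suc i = n \<and> j = 0 then q c_f else 0)"
    "Y (Fib (i, j, Suc 0)) = (if Suc i = n \<and> j = 0 then q c_fv else 0)"
proof -
  interpret feedback "test_a q n" "\<lambda>_ _. 0" by unfold_locales (rule smooth_test)
  have b: "bx = (\<lambda>_. 0)" "bu = (\<lambda>_. 0)" "ax = bmono_x q n 0"
    by (auto simp: bx_def bu_def ax_def lift_test partial_bmono partial_along)
  have z: "bmono q n 0 q = 0" "bx q = 0" "bu q = 0"
    using n by (auto simp: b bmono_self)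
  show "Y (Base d) = 0" unfolding Y_def by (cases d) (simp_all add: X_base lift_test z)
  let ?Q = "characteristic (feedback_base (test_a q n) (\<lambda>_ _. 0)) (feedback_vertical (test_a q n))"
  have Q: "?Q = (\<lambda>p. bmono q n 0 p * (- p c_fx) + bmono_x q n 0 p * p c_f)"
    unfolding characteristic_eq by (rule ext) (simp add: b lift_test algebra_simps)
  have DQ: "total_deriv Dv ?Q = (\<lambda>p. bmono q n 0 p * (- p c_fxv) + bmono_x q n 0 p * p c_fv)"
    unfolding Q
    by (rule ext, rule total_deriv_eqI, rule has_along_eq,
        (rule has_along_intros has_along_bmono has_along_bmono_xu | simp add: algebra_simps)+)
  have E: "Dxu i j (\<lambda>p. bmono q n 0 p * f p + bmono_x q n 0 p * h p) q
     = (if Suc i = n \<and> j = 0 then h q else 0)"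
    if "loc_smooth UNIV f" "loc_smooth UNIV h" for f h
    using that Dxu_bmono[OF that(1), of i j n 0 q] ij
    by (auto simp: Dxu_add loc_smooth_mult loc_smooth_bmono loc_smooth_bmono_xu Dxu_bmono_xu)
  note X = X_Fib_vanishing[of q, unfolded lift_test, OF z(1) refl z(2,3)]
  show "Y (Fib (i, j, 0)) = (if Suc i = n \<and> j = 0 then q c_f else 0)"
    unfolding Y_def X funpow_0 Q by (rule E) (intro loc_smooth_intros open_UNIV)+
  show "Y (Fib (i, j, Suc 0)) = (if Suc i = n \<and> j = 0 then q c_fv else 0)"
    unfolding Y_def X funpow.simps o_apply id_apply DQ by (rule E) (intro loc_smooth_intros open_UNIV)+
qed

text \<open>The fields of degree zero and one in x and u; their base components need not vanish at
  \<open>q\<close>, so they are read off from the explicit coefficients.\<close>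

lemma X_test_low:
  "feedback_field (test_a q 0) (\<lambda>_ _. 0) c_x0 q = 1"
  "feedback_field (test_a q 0) (\<lambda>_ _. 0) c_u0 q = 0"
  "feedback_field (\<lambda>_. 0) (test_b q 0 0) c_x0 q = 0"
  "feedback_field (\<lambda>_. 0) (test_b q 0 0) c_u0 q = 1"
  "feedback_field (test_a q 1) (\<lambda>_ _. 0) c_x0 q = 0"
  "feedback_field (test_a q 1) (\<lambda>_ _. 0) c_u0 q = 0"
  "feedback_field (test_a q 1) (\<lambda>_ _. 0) c_v0 q = 0"
  "feedback_field (test_a q 1) (\<lambda>_ _. 0) c_f q = q c_f"
  "feedback_field (test_a q 1) (\<lambda>_ _. 0) c_fv q = q c_fv"
  "feedback_field (\<lambda>_. 0) (test_b q 1 0) c_x0 q = 0"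
  "feedback_field (\<lambda>_. 0) (test_b q 1 0) c_u0 q = 0"
  "feedback_field (\<lambda>_. 0) (test_b q 1 0) c_v0 q = q c_f"
  "feedback_field (\<lambda>_. 0) (test_b q 1 0) c_f q = 0"
  "feedback_field (\<lambda>_. 0) (test_b q 1 0) c_fv q = - (q c_fv * q c_fv)"
  "feedback_field (\<lambda>_. 0) (test_b q 0 1) c_x0 q = 0"
  "feedback_field (\<lambda>_. 0) (test_b q 0 1) c_u0 q = 0"
  "feedback_field (\<lambda>_. 0) (test_b q 0 1) c_v0 q = q c_v0"
  "feedback_field (\<lambda>_. 0) (test_b q 0 1) c_f q = 0"
  "feedback_field (\<lambda>_. 0) (test_b q 0 1) c_fv q = - q c_fv"
proof -
  interpret a: feedback "test_a q n" "\<lambda>_ _. 0" for n by unfold_locales (rule smooth_test)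
  interpret b: feedback "\<lambda>_. 0" "test_b q k l" for k l by unfold_locales (rule smooth_test)
  note d = a.ax_def a.bx_def a.bu_def b.ax_def b.bx_def b.bu_def lift_test partial_bmono
    partial_along[of _ "\<lambda>_. 0"] bmono_x_def bmono_u_def bmono_self
  note X = a.X_base a.X_f a.X_fv b.X_base b.X_f b.X_fv
  show "feedback_field (test_a q 0) (\<lambda>_ _. 0) c_x0 q = 1"
  "feedback_field (test_a q 0) (\<lambda>_ _. 0) c_u0 q = 0"
  "feedback_field (\<lambda>_. 0) (test_b q 0 0) c_x0 q = 0"
  "feedback_field (\<lambda>_. 0) (test_b q 0 0) c_u0 q = 1"
  "feedback_field (test_a q 1) (\<lambda>_ _. 0) c_x0 q = 0"
  "feedback_field (test_a q 1) (\<lambda>_ _. 0) c_u0 q = 0"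
  "feedback_field (test_a q 1) (\<lambda>_ _. 0) c_v0 q = 0"
  "feedback_field (test_a q 1) (\<lambda>_ _. 0) c_f q = q c_f"
  "feedback_field (test_a q 1) (\<lambda>_ _. 0) c_fv q = q c_fv"
  "feedback_field (\<lambda>_. 0) (test_b q 1 0) c_x0 q = 0"
  "feedback_field (\<lambda>_. 0) (test_b q 1 0) c_u0 q = 0"
  "feedback_field (\<lambda>_. 0) (test_b q 1 0) c_v0 q = q c_f"
  "feedback_field (\<lambda>_. 0) (test_b q 1 0) c_f q = 0"
  "feedback_field (\<lambda>_. 0) (test_b q 1 0) c_fv q = - (q c_fv * q c_fv)"
  "feedback_field (\<lambda>_. 0) (test_b q 0 1) c_x0 q = 0"
  "feedback_field (\<lambda>_. 0) (test_b q 0 1) c_u0 q = 0"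
  "feedback_field (\<lambda>_. 0) (test_b q 0 1) c_v0 q = q c_v0"
  "feedback_field (\<lambda>_. 0) (test_b q 0 1) c_f q = 0"
  "feedback_field (\<lambda>_. 0) (test_b q 0 1) c_fv q = - q c_fv"
    unfolding X by (simp_all add: d)
qed

text \<open>The highest order of derivatives of \<open>a\<close> and \<open>b\<close> entering the
  feedback component at this coordinate, for the pivots.\<close>

fun level :: "coord \<Rightarrow> nat" where
  "level (Base d) = (if d = Dv then 1 else 0)"
| "level (Fib (i, j, l)) = Suc (i + j)"

text \<open>The equations of level \<open>N\<close> involve only the derivatives of order \<open>N\<close> of \<open>a\<close> and \<open>b\<close>, so that
  the coefficients vanish level by level, from the top.\<close>

lemma pivots_independent:
  assumes q: "q \<in> reg_dom"
  shows "pivots_independent q"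
  unfolding pivots_independent_def
proof (intro allI impI, elim conjE)
  fix P :: "coord set" and \<mu> :: "coord \<Rightarrow> real"
  assume fin: "finite P" and piv: "\<forall>c\<in>P. \<not> invariant_coord c"
    and eq: "\<forall>a b. smooth_feedback a b \<longrightarrow> (\<Sum>c\<in>P. \<mu> c * feedback_field a b c q) = 0"
  \<comment> \<open>Extension of the coefficients by zero, so that shifted indices can be used
    without asking whether they lie in \<open>P\<close>.\<close>
  define lam where "lam c = (if c \<in> P then \<mu> c else 0)" for c
  define f where "f = q c_f"
  define v where "v = q c_v0"
  define fv where "fv = q c_fv"
  define fvv where "fvv = q c_fvv"
  note defs = f_def v_def fv_def fvv_def
  have n: "f \<noteq> 0" "fv \<noteq> 0" "fvv \<noteq> 0" "v * fv - f \<noteq> 0"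
    using reg_dom_D[OF q] by (simp_all add: defs)
  have mixed: "lam (Fib (i, j, l)) = 0" if "l \<ge> 2 \<or> l = Suc 0 \<and> i > 0 \<and> j > 0" for i j l
    using that piv by (force simp: lam_def)
  have pick: "(\<Sum>c\<in>P. if c = d then \<mu> c * r else 0) = lam d * r" for d r
    using fin by (simp add: lam_def)
  have step: "\<forall>c\<in>P. level c \<ge> N \<longrightarrow> \<mu> c = 0" if top: "\<forall>c\<in>P. level c \<ge> Suc N \<longrightarrow> \<mu> c = 0" for N
  proof (cases "N \<ge> 2")
    case True
    \<comment> \<open>Testing with the monomial of bidegree (k, l) isolates the coefficients at (k,
      l - 1) and (k - 1, l), with zero or one derivative in v. Higher levels drop out by
      \<open>top\<close>, lower ones because the test field vanishes at \<open>q\<close> to too high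
      an order.\<close>
    have B: "(if l = 0 then 0 else lam (Fib (k, l - 1, 0)) * (- (v * fv))
            + lam (Fib (k, l - 1, Suc 0)) * (- (fv + v * fvv)))
        + (if k = 0 then 0 else lam (Fib (k - 1, l, 0)) * (- (f * fv))
            + lam (Fib (k - 1, l, Suc 0)) * (- (fv * fv + f * fvv))) = 0"
      if kl: "k + l = N" for k l
    proof -
      let ?Y = "\<lambda>c. feedback_field (\<lambda>_. 0) (test_b q k l) c q"
      let ?pick = "\<lambda>d r c. if c = d then \<mu> c * r else 0"
      have "\<mu> c * ?Y c = (?pick (Fib (k, l - 1, 0)) (if l = 0 then 0 else - (v * fv)) c
           + ?pick (Fib (k, l - 1, Suc 0)) (if l = 0 then 0 else - (fv + v * fvv)) c)
           + (?pick (Fib (k - 1, l, 0)) (if k = 0 then 0 else - (f * fv)) c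
           + ?pick (Fib (k - 1, l, Suc 0)) (if k = 0 then 0 else - (fv * fv + f * fvv)) c)"
        if c: "c \<in> P" for c
      proof (cases c)
        case (Base d)
        then show ?thesis using X_test_b(1)[of k l 0 0 q d] True kl by simp
      next
        case (Fib \<sigma>)
        obtain i j r where \<sigma>: "\<sigma> = (i, j, r)" by (cases \<sigma>)
        show ?thesis
        proof (cases "i + j < N")
          case True
          have "r = 0 \<or> r = Suc 0" using piv c by (force simp: Fib \<sigma>)
          then show ?thesis
            using X_test_b(2,3)[of k l i j q] \<open>N \<ge> 2\<close> kl True
            by (elim disjE) (auto simp: Fib \<sigma> defs)
        next
          case False
          then have "\<mu> c = 0" using top c by (simp add: Fib \<sigma>)
          then show ?thesis by (simp only: mult_zero_left if_cancel add_0_left)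
        qed
      qed
      then have "(\<Sum>c\<in>P. \<mu> c * ?Y c) = (\<Sum>c\<in>P.
          (?pick (Fib (k, l - 1, 0)) (if l = 0 then 0 else - (v * fv)) c
           + ?pick (Fib (k, l - 1, Suc 0)) (if l = 0 then 0 else - (fv + v * fvv)) c)
           + (?pick (Fib (k - 1, l, 0)) (if k = 0 then 0 else - (f * fv)) c
           + ?pick (Fib (k - 1, l, Suc 0)) (if k = 0 then 0 else - (fv * fv + f * fvv)) c))"
        by (rule sum.cong[OF refl])
      then show ?thesis
        using eq smooth_test(2)[of q k l] unfolding sum.distrib pick by auto
    qed
    obtain n' where N: "N = Suc n'" "n' \<ge> 1" using True by (cases N) auto
    have A: "lam (Fib (n', 0, 0)) * f + lam (Fib (n', 0, Suc 0)) * fv = 0"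
    proof -
      let ?Y = "\<lambda>c. feedback_field (test_a q N) (\<lambda>_ _. 0) c q"
      let ?pick = "\<lambda>d r c. if c = d then \<mu> c * r else 0"
      have "\<mu> c * ?Y c = ?pick (Fib (n', 0, 0)) f c + ?pick (Fib (n', 0, Suc 0)) fv c"
        if c: "c \<in> P" for c
      proof (cases c)
        case (Base d)
        then show ?thesis using X_test_a(1)[of N 0 0 q d] True by simp
      next
        case (Fib \<sigma>)
        obtain i j r where \<sigma>: "\<sigma> = (i, j, r)" by (cases \<sigma>)
        show ?thesis
        proof (cases "i + j < N")
          case True
          have "r = 0 \<or> r = Suc 0" using piv c by (force simp: Fib \<sigma>)
          then show ?thesis
            using X_test_a(2,3)[of N i j q] \<open>N \<ge> 2\<close> True
            by (elim disjE) (auto simp: Fib \<sigma> defs N(1))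
        next
          case False
          then have "\<mu> c = 0" using top c by (simp add: Fib \<sigma>)
          then show ?thesis by (simp only: mult_zero_left if_cancel add_0_left)
        qed
      qed
      then have "(\<Sum>c\<in>P. \<mu> c * ?Y c)
          = (\<Sum>c\<in>P. ?pick (Fib (n', 0, 0)) f c + ?pick (Fib (n', 0, Suc 0)) fv c)"
        by (rule sum.cong[OF refl])
      then show ?thesis
        using eq smooth_test(1)[of q N] unfolding sum.distrib pick by auto
    qed
    \<comment> \<open>f_v times \<open>A\<close> plus the equation \<open>B\<close> for bidegree (N,
      0): the terms with f_v squared cancel and leave f f_vv.\<close>
    have "lam (Fib (n', 0, Suc 0)) * (f * fvv) = 0"
      using A B[of N 0] by (simp add: N) algebra
    then have T1: "lam (Fib (n', 0, Suc 0)) = 0" using n by simp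
    have T0: "lam (Fib (n', 0, 0)) = 0" using A n by (simp add: T1)
    \<comment> \<open>\<open>B\<close> links neighbouring coefficients (k, l - 1) and (k - 1, l),
      and the coefficients with one v in between vanish. The chain stops before (0, n'), where such
      a coefficient is itself a pivot still unknown.\<close>
    have chain: "lam (Fib (n' - t, t, 0)) = 0" if "t < n'" for t
      using that
    proof (induction t)
      case (Suc t)
      have "lam (Fib (n' - t, t, Suc 0)) = 0"
        using T1 mixed[of "Suc 0" "n' - t" t] Suc.prems by (cases "t = 0") auto
      moreover have "lam (Fib (n' - Suc t, Suc t, Suc 0)) = 0"
        using mixed[of "Suc 0" "n' - Suc t" "Suc t"] Suc.prems by auto
      moreover have "n' - t - 1 = n' - Suc t" "n' - t \<noteq> 0" using Suc.prems by auto
      ultimately show ?case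
        using B[of "n' - t" "Suc t"] Suc n by (simp add: N)
    qed (simp add: T0)
    have "lam (Fib (1, n' - 1, 0)) = 0" using chain[of "n' - 1"] N(2) by simp
    moreover have "lam (Fib (1, n' - 1, Suc 0)) = 0"
      using T1 mixed[of "Suc 0" 1 "n' - 1"] N(2) by (cases "n' = 1") auto
    ultimately have E1: "lam (Fib (0, n', 0)) * (f * fv) + lam (Fib (0, n', Suc 0)) * (fv * fv + f * fvv) = 0"
      using B[of 1 n'] N by (simp add: algebra_simps)
    have E2: "lam (Fib (0, n', 0)) * (v * fv) + lam (Fib (0, n', Suc 0)) * (fv + v * fvv) = 0"
      using B[of 0 N] N by (simp add: algebra_simps)
    \<comment> \<open>v times \<open>E1\<close> minus f times \<open>E2\<close>. This is where v f_v
      - f must be nonzero.\<close>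
    have "lam (Fib (0, n', Suc 0)) * (fv * (v * fv - f)) = 0"
      using E1 E2 by algebra
    then have L1: "lam (Fib (0, n', Suc 0)) = 0" using n by simp
    have L0: "lam (Fib (0, n', 0)) = 0" using E1 n by (simp add: L1)
    show ?thesis
    proof (intro ballI impI)
      fix c assume c: "c \<in> P" "N \<le> level c"
      show "\<mu> c = 0"
      proof (cases "Suc N \<le> level c")
        case False
        then have lev: "level c = N" using c by simp
        then obtain \<sigma> where \<sigma>: "c = Fib \<sigma>" using True by (cases c) (auto split: if_splits)
        obtain i j r where ijr: "\<sigma> = (i, j, r)" by (cases \<sigma>)
        have ij: "i = n' - j" "j \<le> n'" using lev N by (auto simp: \<sigma> ijr)
        have "r = 0 \<or> r = Suc 0" using piv c by (force simp: \<sigma> ijr)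
        then have "lam c = 0"
        proof
          assume "r = 0"
          then show ?thesis using chain[of j] L0 ij by (cases "j = n'") (auto simp: \<sigma> ijr)
        next
          assume "r = Suc 0"
          then show ?thesis
            using mixed[of "Suc 0" i j] T1 L1 ij by (cases "j = n'"; cases "j = 0") (auto simp: \<sigma> ijr)
        qed
        then show ?thesis using c by (simp add: lam_def)
      qed (use top c in blast)
    qed
  next
    case False
    \<comment> \<open>For N below two, any pivot outside these five has level at least
      \<open>Suc N\<close> and is already known to have coefficient zero.\<close>
    have S: "lam c_x0 * Y c_x0 + lam c_u0 * Y c_u0 + lam c_v0 * Y c_v0 + lam c_f * Y c_f
        + lam c_fv * Y c_fv = (\<Sum>c\<in>P. \<mu> c * Y c)" for Y
    proof -
      have "(\<Sum>c\<in>P. \<mu> c * Y c) = (\<Sum>c\<in>{c_x0, c_u0, c_v0, c_f, c_fv}. lam c * Y c)"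
      proof (rule sum.mono_neutral_cong)
        fix c assume c: "c \<in> P - {c_x0, c_u0, c_v0, c_f, c_fv}"
        have "level c \<ge> Suc N"
        proof (cases c)
          case (Base d)
          then show ?thesis using c by (cases d) auto
        next
          case (Fib \<sigma>)
          obtain i j r where \<sigma>: "\<sigma> = (i, j, r)" by (cases \<sigma>)
          have "r = 0 \<or> r = Suc 0" using piv c by (force simp: Fib \<sigma>)
          then have "i + j \<noteq> 0" using c by (auto simp: Fib \<sigma>)
          then have "N \<le> i + j" using False by linarith
          then show ?thesis by (simp add: Fib \<sigma>)
        qed
        then show "\<mu> c * Y c = 0" using top c by auto
      qed (auto simp: fin lam_def)
      then show ?thesis by simp
    qed
    note Sa = S[of "\<lambda>c. feedback_field (test_a q m) (\<lambda>_ _. 0) c q" for m,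
        unfolded eq[rule_format, OF smooth_test(1)]]
    note Sb = S[of "\<lambda>c. feedback_field (\<lambda>_. 0) (test_b q k l) c q" for k l,
        unfolded eq[rule_format, OF smooth_test(2)]]
    have two: "lam c_f = 0 \<and> lam c_fv = 0 \<and> lam c_v0 = 0"
    proof -
      have e: "lam c_f * f + lam c_fv * fv = 0" "lam c_v0 * f - lam c_fv * (fv * fv) = 0"
        "lam c_v0 * v - lam c_fv * fv = 0"
        using Sa[of 1] Sb[of 1 0] Sb[of 0 1] by (simp_all add: X_test_low[unfolded One_nat_def] defs)
      \<comment> \<open>f_v times the equation for b = u minus the one for b = x, both centred at
        \<open>q\<close>; again v f_v - f decides.\<close>
      have "lam c_v0 * (v * fv - f) = 0" using e(2,3) by algebra
      then have "lam c_v0 = 0" using n by simp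
      then show ?thesis using e n by simp
    qed
    show ?thesis
    proof (cases "N = 0")
      case True
      have "lam c_x0 = 0" "lam c_u0 = 0"
        using Sa[of 0] Sb[of 0 0] two by (simp_all add: X_test_low)
      then have z: "lam c = 0" if "c \<in> {c_x0, c_u0, c_v0, c_f, c_fv}" for c
        using two that by auto
      show ?thesis
      proof (intro ballI impI)
        fix c assume c: "c \<in> P"
        show "\<mu> c = 0"
        proof (cases "Suc N \<le> level c")
          case False
          then have "c \<in> {c_x0, c_u0}" using True dir.exhaust by (cases c rule: level.cases) (auto split: if_splits)
          then show ?thesis using z[of c] c by (auto simp: lam_def)
        qed (use top c in blast)
      qed
    next
      case False
      then have N1: "N = 1" using \<open>\<not> 2 \<le> N\<close> by simp
      show ?thesis
      proof (intro ballI impI)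
        fix c assume c: "c \<in> P" "N \<le> level c"
        show "\<mu> c = 0"
        proof (cases "Suc N \<le> level c")
          case False
          have "c \<in> {c_v0, c_f, c_fv}"
          proof (cases c)
            case (Base d)
            then show ?thesis using c N1 by (auto split: if_splits)
          next
            case (Fib \<sigma>)
            obtain i j r where \<sigma>: "\<sigma> = (i, j, r)" by (cases \<sigma>)
            have "r = 0 \<or> r = Suc 0" using piv c by (force simp: Fib \<sigma>)
            then show ?thesis using False N1 by (auto simp: Fib \<sigma>)
          qed
          then show ?thesis using two c by (auto simp: lam_def)
        qed (use top c in blast)
      qed
    qed
  qed
  define M where "M = Suc (Max (insert 0 (level ` P)))"
  have "level c < M" if "c \<in> P" for c
    unfolding M_def using fin that by (simp add: less_Suc_eq_le)
  then have base: "\<forall>c\<in>P. level c \<ge> M \<longrightarrow> \<mu> c = 0" by force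
  have "\<forall>c\<in>P. level c \<ge> 0 \<longrightarrow> \<mu> c = 0"
    by (rule inc_induct[of 0 M "\<lambda>N. \<forall>c\<in>P. level c \<ge> N \<longrightarrow> \<mu> c = 0"]) (use base step in auto)
  then show "\<forall>c\<in>P. \<mu> c = 0" by simp
qed

text \<open>The neighbourhood is \<open>reg_dom\<close> itself, the same for every \<open>k\<close>
  and \<open>S\<close>: it is saturated for the coordinates of order at most two, and the orbit
  cannot leave it.\<close>

theorem theorem3:
  fixes k :: nat and S :: "jet set"
  assumes "regular_orbit k S"
  shows "\<exists>N. jet_open k N \<and> S \<subseteq> N \<and>
           has_jet_order 2 N inv_J \<and> has_jet_order 3 N inv_K \<and>
           invariants_generated N"
proof (intro exI conjI)
  obtain p where p: "p \<in> reg_dom" "k \<ge> 2"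
    using assms by (auto simp: regular_orbit_def reg_dom_def)
  show "jet_open k reg_dom" by (rule jet_open_reg_dom[OF p(2)])
  show "S \<subseteq> reg_dom" by (rule regular_orbit_subset[OF assms])
  show "has_jet_order 2 reg_dom inv_J"
    by (rule has_jet_order_lead[OF lead_inv_J _ p(1)]) (use reg_dom_D[OF p(1)] in auto)
  show "has_jet_order 3 reg_dom inv_K"
    by (rule has_jet_order_lead[OF lead_inv_K _ p(1)]) (use reg_dom_D[OF p(1)] in auto)
  show "invariants_generated reg_dom"
    using feedback_invariant_gen_fun locally_generated_if_independent[OF pivots_independent]
    by (auto simp: invariants_generated_def)
qed

end
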